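(* Let $M$ be a PL $n$-manifold, let $\eta$ and $\eta'$ be (not necessarily distinct) ends of $M$, and let $N$ be the result of adding a 1-handle at infinity to $M$ along disjoint rays $r$ and $r'$ pointing to $\eta$ and $\eta'$ respectively. Then the canonical map $h:\mathcal{E}(N)\to\mathcal{E}(M)/(\eta\equiv\eta')$ is continuous. If $n\geq 2$, then $h$ is surjective. If (i) $n=2$, $\partial M$ is compact, and $\eta\neq\eta'$, or (ii) $n\geq 3$, then $h$ is a homeomorphism.
   Context: Manifolds are PL, Hausdorff and paracompact, possibly with boundary and possibly disconnected. Ends: For a connected, locally connected, locally compact, $\sigma$-compact Hausdorff space $X$, an end of $X$ is a function $\epsilon$ assigning to each compact $K\subset X$ a (nonempty) connected component $\epsilon(K)$ of $X\setminus K$, such that $K_1\subset K_2$ implies $\epsilon(K_2)\subset\epsilon(K_1)$. If $X$ is disconnected, an end $\epsilon$ of $X$ is an end of a connected component $X_0$ of $X$, and $\epsilon(K)$ means $\epsilon(K\cap X_0)$ for compact $K\subset X$. The space of ends $\mathcal{E}(X)$ is the set of ends with the topology having basis the sets $\{\beta\in\mathcal{E}(X):\beta(K)=\epsilon(K)\}$ for $\epsilon\in\mathcal{E}(X)$ and $K\subset X$ compact. A neighborhood of $\epsilon$ is a subset of $X$ containing $\epsilon(K)$ for some compact $K$. A proper map $r:[0,\infty)\to X$ points to $\epsilon$ if for each compact $K$ the component $\epsilon(K)$ contains $r((a,\infty))$ for some $a$. 1-handle at infinity: A ray in $M$ is a proper, locally flat embedding $r:[0,\infty)\to M$ with image in the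 manifold interior of $M$. A tubular neighborhood map of $r$ is a proper, locally flat embedding $\nu:[0,\infty)\times D^{n-1}\to M$ with image in the manifold interior and $\nu(x,0)=r(x)$. Let $r,r'$ be disjoint rays with tubular neighborhood maps $\nu,\nu'$ having disjoint images, and let $U,U'$ be the images under $\nu,\nu'$ of $(0,\infty)\times(D^{n-1})^\circ$. Let $E=\mathbb{R}\times\mathbb{R}^{n-1}$, $E_-=(-\infty,0)\times\mathbb{R}^{n-1}$, $E_0=\{0\}\times\mathbb{R}^{n-1}$, $E_+=(0,\infty)\times\mathbb{R}^{n-1}$. Fix an orientation-reversing isomorphism $\rho:(0,\infty)\to(0,\infty)$ and a radial expansion isomorphism $\lambda:(D^{n-1})^\circ\to\mathbb{R}^{n-1}$; set $\phi_+(t,y)=\nu(\rho(t),\lambda^{-1}(y))$ on $E_+$ and $\phi_-(t,y)=\nu'(\rho(-t),\lambda^{-1}(y))$ on $E_-$, giving isomorphisms $\phi_+:E_+\to U$, $\phi_-:E_-\to U'$. Then $N$ is the quotient of $M\sqcup E$ by the equivalence relation generated by $x\sim\phi_+(x)$ ($x\in E_+$) and $x\sim\phi_-(x)$ ($x\in E_-$); it is naturally an $n$-manifold, and the natural maps $i_M:M\to N$ and $i_E:E\to N$ are open embeddings. The map $h$: An end $\alpha$ of $N$ is ordinary if it has a neighborhood contained in $i_M(M)$ (equivalently, disjoint from $i_E(E_0)$), and extraordinary otherwise. If $\alpha$ is ordinary, there is a unique end $\beta$ of $M$ with $i_M(\beta(K))\subset\alpha(i_M(K))$ for all compact $K\subset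 M$, and $\beta\neq\eta,\eta'$; set $h(\alpha)=\beta$. If $\alpha$ is extraordinary, $h(\alpha)$ is the class of $\eta\equiv\eta'$. Here $\mathcal{E}(M)/(\eta\equiv\eta')$ is the topological quotient of $\mathcal{E}(M)$ by the equivalence relation generated by $\eta\equiv\eta'$. *)

theory Defs
  imports "HOL-Analysis.Analysis"
begin

section \<open>Point-set topology\<close>

definition paracompact_space :: "'a topology \<Rightarrow> bool" where
  "paracompact_space X \<longleftrightarrow>
     (\<forall>\<U>. (\<forall>U\<in>\<U>. openin X U) \<and> \<Union>\<U> = topspace X \<longrightarrow>
        (\<exists>\<V>. (\<forall>V\<in>\<V>. openin X V) \<and> \<Union>\<V> = topspace X \<and>
             (\<forall>V\<in>\<V>. \<exists>U\<in>\<U>. V \<subseteq> U) \<and> locally_finite_in X \<V>))"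

definition generated_equiv :: "'a set \<Rightarrow> ('a \<times> 'a) set \<Rightarrow> ('a \<times> 'a) set" where
  "generated_equiv A r = (r \<union> r\<inverse>)\<^sup>* \<inter> A \<times> A"

lemma equiv_generated_equiv: "equiv A (generated_equiv A r)"
proof -
  have "sym ((r \<union> r\<inverse>)\<^sup>*)"
    by (simp add: sym_rtrancl sym_Un_converse)
  then have "sym (generated_equiv A r)"
    unfolding generated_equiv_def sym_def by blast
  moreover have "trans (generated_equiv A r)"
    unfolding generated_equiv_def trans_def by (blast intro: rtrancl_trans)
  moreover have "refl_on A (generated_equiv A r)"
    unfolding generated_equiv_def refl_on_def by blast
  moreover have "generated_equiv A r \<subseteq> A \<times> A"
    unfolding generated_equiv_def by blast
  ultimately show ?thesis
    by (simp add: equiv_def)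
qed

lemma generated_equiv_least:
  assumes "equiv A s" "r \<subseteq> s"
  shows "generated_equiv A r \<subseteq> s"
proof -
  have s_trans: "trans s"
    using assms(1) by (simp add: equiv_def)
  have s_sym: "(v, u) \<in> s" if "(u, v) \<in> s" for u v
    using assms(1) that by (simp add: equiv_class_eq_iff)
  have "y \<in> A \<and> (x, y) \<in> s" if "(x, y) \<in> (r \<union> r\<inverse>)\<^sup>*" "x \<in> A" for x y
    using that
  proof (induction rule: rtrancl_induct)
    case base
    then show ?case using assms(1) by (simp add: equiv_def refl_on_def)
  next
    case (step y z)
    then have "(y, z) \<in> s"
      using assms(2) s_sym by blast
    then show ?case
      using step transE[OF s_trans, of x y z] equiv_class_eq_iff[OF assms(1)] by simp
  qed
  then show ?thesis
    unfolding generated_equiv_def by auto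
qed

text \<open>Points of the quotient are equivalence classes, so that the preimage of a set of classes
  is its union.\<close>

definition quotient_topology :: "'a topology \<Rightarrow> ('a \<times> 'a) set \<Rightarrow> 'a set topology" where
  "quotient_topology X R = topology (\<lambda>\<V>. \<V> \<subseteq> topspace X // R \<and> openin X (\<Union>\<V>))"

lemma openin_quotient_topology:
  assumes "equiv (topspace X) R"
  shows "openin (quotient_topology X R) \<V> \<longleftrightarrow> \<V> \<subseteq> topspace X // R \<and> openin X (\<Union>\<V>)"
proof -
  have Int: "openin X (\<Union>(\<V> \<inter> \<W>))"
    if "\<V> \<subseteq> topspace X // R" "\<W> \<subseteq> topspace X // R" "openin X (\<Union>\<V>)" "openin X (\<Union>\<W>)" for \<V> \<W>
  proof -
    have "\<Union>(\<V> \<inter> \<W>) = \<Union>\<V> \<inter> \<Union>\<W>"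
    proof
      show "\<Union>\<V> \<inter> \<Union>\<W> \<subseteq> \<Union>(\<V> \<inter> \<W>)"
      proof
        fix x assume "x \<in> \<Union>\<V> \<inter> \<Union>\<W>"
        then obtain V W where "V \<in> \<V>" "W \<in> \<W>" "x \<in> V" "x \<in> W" by blast
        moreover from this have "V = W"
          using quotient_disj[OF assms, of V W] that by blast
        ultimately show "x \<in> \<Union>(\<V> \<inter> \<W>)" by blast
      qed
    qed blast
    then show ?thesis using openin_Int[OF that(3,4)] by simp
  qed
  have Un: "openin X (\<Union>(\<Union>\<K>))" if "\<And>\<V>. \<V> \<in> \<K> \<Longrightarrow> openin X (\<Union>\<V>)" for \<K>
  proof -
    have "\<Union>(\<Union>\<K>) = \<Union>(Union ` \<K>)" by blast
    then show ?thesis using that by auto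
  qed
  have "istopology (\<lambda>\<V>. \<V> \<subseteq> topspace X // R \<and> openin X (\<Union>\<V>))"
    unfolding istopology_def using Int Un by (simp add: Sup_le_iff le_infI1)
  then show ?thesis
    by (simp add: quotient_topology_def topology_inverse')
qed

lemma topspace_quotient_topology:
  assumes "equiv (topspace X) R"
  shows "topspace (quotient_topology X R) = topspace X // R"
proof
  show "topspace (quotient_topology X R) \<subseteq> topspace X // R"
    using openin_quotient_topology[OF assms] by (meson openin_topspace)
  have "openin (quotient_topology X R) (topspace X // R)"
    by (simp add: openin_quotient_topology[OF assms] Union_quotient[OF assms])
  then show "topspace X // R \<subseteq> topspace (quotient_topology X R)"
    by (rule openin_subset)
qed

lemma quotient_map_quotient_topology:
  assumes "equiv (topspace X) R"
  shows "quotient_map X (quotient_topology X R) (\<lambda>x. R `` {x})"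
proof -
  have "{x \<in> topspace X. R `` {x} \<in> \<V>} = \<Union>\<V>" if "\<V> \<subseteq> topspace X // R" for \<V>
  proof
    show "{x \<in> topspace X. R `` {x} \<in> \<V>} \<subseteq> \<Union>\<V>"
      using equiv_class_self[OF assms] by blast
    show "\<Union>\<V> \<subseteq> {x \<in> topspace X. R `` {x} \<in> \<V>}"
    proof
      fix x assume "x \<in> \<Union>\<V>"
      then obtain V where V: "V \<in> \<V>" "x \<in> V" by blast
      then have "V \<in> topspace X // R"
        using that by blast
      then obtain y where "V = R `` {y}" "y \<in> topspace X"
        by (rule quotientE)
      moreover from this have "(y, x) \<in> R" using V by simp
      ultimately have "x \<in> topspace X" "R `` {x} = V"
        using assms equiv_class_eq_iff[OF assms, of y x] by simp_all
      then show "x \<in> {x \<in> topspace X. R `` {x} \<in> \<V>}" using V by simp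
    qed
  qed
  moreover have "(\<lambda>x. R `` {x}) ` topspace X = topspace X // R"
    unfolding quotient_def by blast
  ultimately show ?thesis
    unfolding quotient_map_def topspace_quotient_topology[OF assms] openin_quotient_topology[OF assms]
    by simp
qed

definition disjoint_sum_topology :: "'a topology \<Rightarrow> 'b topology \<Rightarrow> ('a + 'b) topology" where
  "disjoint_sum_topology X Y = topology (\<lambda>W. openin X (Inl -` W) \<and> openin Y (Inr -` W))"

lemma openin_disjoint_sum_topology:
  "openin (disjoint_sum_topology X Y) W \<longleftrightarrow> openin X (Inl -` W) \<and> openin Y (Inr -` W)"
proof -
  have "istopology (\<lambda>W. openin X (Inl -` W) \<and> openin Y (Inr -` W))"
    unfolding istopology_def by (auto simp: vimage_Union)
  then show ?thesis
    by (simp add: disjoint_sum_topology_def topology_inverse')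
qed

lemma topspace_disjoint_sum_topology:
  "topspace (disjoint_sum_topology X Y) = topspace X <+> topspace Y"
proof
  show "topspace (disjoint_sum_topology X Y) \<subseteq> topspace X <+> topspace Y"
  proof
    fix z assume z: "z \<in> topspace (disjoint_sum_topology X Y)"
    have *: "openin X (Inl -` topspace (disjoint_sum_topology X Y))"
            "openin Y (Inr -` topspace (disjoint_sum_topology X Y))"
      using openin_topspace[of "disjoint_sum_topology X Y"]
      unfolding openin_disjoint_sum_topology by simp_all
    show "z \<in> topspace X <+> topspace Y"
      using z *[THEN openin_subset] by (cases z) auto
  qed
  have "Inl -` (topspace X <+> topspace Y) = topspace X" "Inr -` (topspace X <+> topspace Y) = topspace Y"
    by auto
  then have "openin (disjoint_sum_topology X Y) (topspace X <+> topspace Y)"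
    by (simp add: openin_disjoint_sum_topology)
  then show "topspace X <+> topspace Y \<subseteq> topspace (disjoint_sum_topology X Y)"
    by (rule openin_subset)
qed


section \<open>Ends\<close>

text \<open>For a connected space \<open>X\<close>. Functions on compact subsets are made extensional, so that ends
  that agree on all compact sets are equal.\<close>

definition ends_connected :: "'a topology \<Rightarrow> ('a set \<Rightarrow> 'a set) set" where
  "ends_connected X = {\<epsilon> \<in> extensional {K. compactin X K}.
     (\<forall>K. compactin X K \<longrightarrow> \<epsilon> K \<in> connected_components_of (subtopology X (topspace X - K))) \<and>
     (\<forall>K\<^sub>1 K\<^sub>2. compactin X K\<^sub>1 \<longrightarrow> compactin X K\<^sub>2 \<longrightarrow> K\<^sub>1 \<subseteq> K\<^sub>2 \<longrightarrow> \<epsilon> K\<^sub>2 \<subseteq> \<epsilon> K\<^sub>1)}"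

text \<open>An end \<open>\<epsilon>\<close> of a component \<open>C\<close> of \<open>X\<close> is represented by the function
  \<open>K \<mapsto> \<epsilon> (K \<inter> C)\<close> on all compact subsets of \<open>X\<close>. It determines \<open>C\<close>, as its value at
  the empty set, and hence \<open>\<epsilon>\<close>; for connected \<open>X\<close> nothing changes.\<close>

definition ends :: "'a topology \<Rightarrow> ('a set \<Rightarrow> 'a set) set" where
  "ends X = (\<Union>C\<in>connected_components_of X.
     (\<lambda>\<epsilon>. \<lambda>K\<in>{K. compactin X K}. \<epsilon> (K \<inter> C)) ` ends_connected (subtopology X C))"

lemma ends_connected_space:
  assumes "connected_space X"
  shows "ends X = ends_connected X"
proof (cases "X = trivial_topology")
  case True
  have "ends_connected X = {}"
  proof (rule ccontr)
    assume "ends_connected X \<noteq> {}"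
    then obtain \<epsilon> where "\<epsilon> \<in> ends_connected X"
      by blast
    then have "\<epsilon> {} \<in> connected_components_of (subtopology X (topspace X - {}))"
      unfolding ends_connected_def using compactin_empty[of X] by blast
    then show False
      using True by (simp add: connected_components_of_def)
  qed
  then show ?thesis
    using True by (simp add: ends_def connected_components_of_def)
next
  case False
  then have "connected_components_of X = {topspace X}"
    using assms by (simp add: connected_components_of_eq_singleton connected_space_iff_components_eq)
  moreover have "(\<lambda>K\<in>{K. compactin X K}. \<epsilon> (K \<inter> topspace X)) = \<epsilon>" if "\<epsilon> \<in> ends_connected X" for \<epsilon>
  proof -
    have "\<epsilon> \<in> extensional {K. compactin X K}"
      using that by (simp add: ends_connected_def)
    moreover have "K \<inter> topspace X = K" if "compactin X K" for K
      using compactin_subset_topspace[OF that] by blast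
    ultimately show ?thesis
      by (auto simp: fun_eq_iff extensional_def)
  qed
  ultimately show ?thesis
    by (simp add: ends_def)
qed

definition basic_end_nbhd :: "'a topology \<Rightarrow> ('a set \<Rightarrow> 'a set) \<Rightarrow> 'a set \<Rightarrow> ('a set \<Rightarrow> 'a set) set" where
  "basic_end_nbhd X \<epsilon> K = {\<beta> \<in> ends X. \<beta> K = \<epsilon> K}"

definition ends_topology :: "'a topology \<Rightarrow> ('a set \<Rightarrow> 'a set) topology" where
  "ends_topology X =
     topology_generated_by {basic_end_nbhd X \<epsilon> K | \<epsilon> K. \<epsilon> \<in> ends X \<and> compactin X K}"

lemma topspace_ends_topology: "topspace (ends_topology X) = ends X"
proof
  show "topspace (ends_topology X) \<subseteq> ends X"
    unfolding ends_topology_def topology_generated_by_topspace basic_end_nbhd_def by blast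
  have "\<epsilon> \<in> basic_end_nbhd X \<epsilon> {}" if "\<epsilon> \<in> ends X" for \<epsilon>
    using that by (simp add: basic_end_nbhd_def)
  then show "ends X \<subseteq> topspace (ends_topology X)"
    unfolding ends_topology_def topology_generated_by_topspace using compactin_empty by blast
qed

definition end_neighborhood :: "'a topology \<Rightarrow> ('a set \<Rightarrow> 'a set) \<Rightarrow> 'a set \<Rightarrow> bool" where
  "end_neighborhood X \<epsilon> W \<longleftrightarrow> W \<subseteq> topspace X \<and> (\<exists>K. compactin X K \<and> \<epsilon> K \<subseteq> W)"

definition points_to :: "'a topology \<Rightarrow> (real \<Rightarrow> 'a) \<Rightarrow> ('a set \<Rightarrow> 'a set) \<Rightarrow> bool" where
  "points_to X r \<epsilon> \<longleftrightarrow> continuous_map (top_of_set {0..}) X r \<and> proper_map (top_of_set {0..}) X r \<and>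
     (\<forall>K. compactin X K \<longrightarrow> (\<exists>a\<ge>0. r ` {a<..} \<subseteq> \<epsilon> K))"

abbreviation ends_relation :: "'a topology \<Rightarrow> ('a set \<Rightarrow> 'a set) \<Rightarrow> ('a set \<Rightarrow> 'a set) \<Rightarrow>
    (('a set \<Rightarrow> 'a set) \<times> ('a set \<Rightarrow> 'a set)) set" where
  "ends_relation X \<eta> \<eta>' \<equiv> generated_equiv (ends X) {(\<eta>, \<eta>')}"

definition ends_quotient :: "'a topology \<Rightarrow> ('a set \<Rightarrow> 'a set) \<Rightarrow> ('a set \<Rightarrow> 'a set) \<Rightarrow>
    ('a set \<Rightarrow> 'a set) set topology" where
  "ends_quotient X \<eta> \<eta>' = quotient_topology (ends_topology X) (ends_relation X \<eta> \<eta>')"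


section \<open>Piecewise linear maps and manifolds\<close>

definition half_space :: "nat \<Rightarrow> (nat \<Rightarrow> real) set" where
  "half_space n = {x \<in> topspace (Euclidean_space n). 0 \<le> x 0}"

definition convex_polyhedron :: "nat \<Rightarrow> (nat \<Rightarrow> real) set \<Rightarrow> bool" where
  "convex_polyhedron m P \<longleftrightarrow> (\<exists>H :: ((nat \<Rightarrow> real) \<times> real) set. finite H \<and>
     P = {x \<in> topspace (Euclidean_space m). \<forall>(a, b)\<in>H. (\<Sum>i<m. a i * x i) \<le> b})"

definition affine_map_on :: "nat \<Rightarrow> nat \<Rightarrow> (nat \<Rightarrow> real) set \<Rightarrow> ((nat \<Rightarrow> real) \<Rightarrow> (nat \<Rightarrow> real)) \<Rightarrow> bool" where
  "affine_map_on m n S f \<longleftrightarrow> (\<exists>(A :: nat \<Rightarrow> nat \<Rightarrow> real) b.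
     \<forall>x\<in>S. \<forall>j<n. f x j = b j + (\<Sum>i<m. A j i * x i))"

text \<open>PL maps from (locally polyhedral) subsets of \<open>\<real>\<^sup>m\<close> to \<open>\<real>\<^sup>n\<close>: near each point the
  domain is a finite union of polyhedra on each of which the map is affine. Infinitely many pieces
  are allowed, provided they are locally finite in the domain.\<close>

definition pl_on :: "nat \<Rightarrow> (nat \<Rightarrow> real) set \<Rightarrow> nat \<Rightarrow> ((nat \<Rightarrow> real) \<Rightarrow> (nat \<Rightarrow> real)) \<Rightarrow> bool" where
  "pl_on m S n f \<longleftrightarrow>
     S \<subseteq> topspace (Euclidean_space m) \<and> f ` S \<subseteq> topspace (Euclidean_space n) \<and>
     (\<forall>x\<in>S. \<exists>W \<P>. openin (subtopology (Euclidean_space m) S) W \<and> x \<in> W \<and>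
        finite \<P> \<and> (\<forall>P\<in>\<P>. convex_polyhedron m P \<and> affine_map_on m n (P \<inter> W) f) \<and> W \<subseteq> \<Union>\<P>)"

definition pl_iso :: "nat \<Rightarrow> (nat \<Rightarrow> real) set \<Rightarrow> nat \<Rightarrow> (nat \<Rightarrow> real) set \<Rightarrow>
    ((nat \<Rightarrow> real) \<Rightarrow> (nat \<Rightarrow> real)) \<Rightarrow> bool" where
  "pl_iso m S n T f \<longleftrightarrow>
     homeomorphic_map (subtopology (Euclidean_space m) S) (subtopology (Euclidean_space n) T) f \<and>
     pl_on m S n f \<and> pl_on n T m (inv_into S f)"

type_synonym 'a chart = "'a set \<times> ('a \<Rightarrow> nat \<Rightarrow> real)"

definition is_chart :: "nat \<Rightarrow> 'a topology \<Rightarrow> 'a chart \<Rightarrow> bool" where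
  "is_chart n M = (\<lambda>(U, \<psi>). openin M U \<and> embedding_map (subtopology M U) (Euclidean_space n) \<psi> \<and>
     (openin (Euclidean_space n) (\<psi> ` U) \<or>
      openin (subtopology (Euclidean_space n) (half_space n)) (\<psi> ` U)))"

definition pl_compatible :: "nat \<Rightarrow> 'a chart \<Rightarrow> 'a chart \<Rightarrow> bool" where
  "pl_compatible n = (\<lambda>(U, \<psi>) (V, \<phi>).
     pl_iso n (\<psi> ` (U \<inter> V)) n (\<phi> ` (U \<inter> V)) (\<phi> \<circ> inv_into U \<psi>))"

definition pl_manifold :: "nat \<Rightarrow> 'a topology \<Rightarrow> 'a chart set \<Rightarrow> bool" where
  "pl_manifold n M \<A> \<longleftrightarrow> Hausdorff_space M \<and> paracompact_space M \<and>
     (\<forall>c\<in>\<A>. is_chart n M c) \<and> \<Union>(fst ` \<A>) = topspace M \<and>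
     (\<forall>c\<in>\<A>. \<forall>d\<in>\<A>. pl_compatible n c d)"

text \<open>The charts of the PL structure (maximal PL atlas) determined by the atlas \<open>\<A>\<close>.\<close>

definition pl_charts :: "nat \<Rightarrow> 'a topology \<Rightarrow> 'a chart set \<Rightarrow> 'a chart set" where
  "pl_charts n M \<A> = {c. is_chart n M c \<and> (\<forall>d\<in>\<A>. pl_compatible n c d \<and> pl_compatible n d c)}"

definition manifold_interior :: "nat \<Rightarrow> 'a topology \<Rightarrow> 'a set" where
  "manifold_interior n M = {p. \<exists>U. openin M U \<and> p \<in> U \<and>
     (\<exists>V. openin (Euclidean_space n) V \<and>
        subtopology M U homeomorphic_space subtopology (Euclidean_space n) V)}"

definition manifold_boundary :: "nat \<Rightarrow> 'a topology \<Rightarrow> 'a set" where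
  "manifold_boundary n M = topspace M - manifold_interior n M"

definition pl_map_into :: "nat \<Rightarrow> (nat \<Rightarrow> real) set \<Rightarrow> nat \<Rightarrow> 'a topology \<Rightarrow> 'a chart set \<Rightarrow>
    ((nat \<Rightarrow> real) \<Rightarrow> 'a) \<Rightarrow> bool" where
  "pl_map_into m S n M \<A> f \<longleftrightarrow> continuous_map (subtopology (Euclidean_space m) S) M f \<and>
     (\<forall>(U, \<psi>)\<in>\<A>. pl_on m (S \<inter> f -` U) n (\<psi> \<circ> f))"

text \<open>Local flatness of an \<open>m\<close>-manifold (possibly with boundary) in the interior of \<open>M\<close>:
  in suitable PL charts it is \<open>\<real>\<^sup>m\<close> or a half-space of \<open>\<real>\<^sup>m\<close>, in \<open>\<real>\<^sup>n\<close>.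
  Note that \<open>Euclidean_space m\<close> consists of the points whose coordinates from \<open>m\<close> on vanish.\<close>

definition locally_flat_in :: "nat \<Rightarrow> 'a topology \<Rightarrow> 'a chart set \<Rightarrow> nat \<Rightarrow> 'a set \<Rightarrow> bool" where
  "locally_flat_in n M \<A> m S \<longleftrightarrow> (\<forall>p\<in>S. \<exists>(U, \<psi>)\<in>pl_charts n M \<A>.
     p \<in> U \<and> openin (Euclidean_space n) (\<psi> ` U) \<and>
     (\<psi> ` (U \<inter> S) = \<psi> ` U \<inter> topspace (Euclidean_space m) \<or>
      \<psi> ` (U \<inter> S) = \<psi> ` U \<inter> half_space m))"


section \<open>1-handles at infinity\<close>

text \<open>\<open>\<real>\<close> and \<open>\<real> \<times> \<real>\<^sup>k\<close> are identified with \<open>\<real>\<^sup>1\<close> and \<open>\<real>\<^sup>k\<^sup>+\<^sup>1\<close> for the purpose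
  of piecewise linearity.\<close>

definition point1 :: "real \<Rightarrow> nat \<Rightarrow> real" where
  "point1 t = (\<lambda>i. if i = 0 then t else 0)"

definition split_first :: "(nat \<Rightarrow> real) \<Rightarrow> real \<times> (nat \<Rightarrow> real)" where
  "split_first x = (x 0, \<lambda>i. x (Suc i))"

text \<open>The PL disk \<open>D\<^sup>k\<close> is the cube \<open>[-1,1]\<^sup>k\<close>, i.e.\ \<open>cube k 1\<close>.\<close>

definition cube :: "nat \<Rightarrow> real \<Rightarrow> (nat \<Rightarrow> real) set" where
  "cube k s = {y \<in> topspace (Euclidean_space k). \<forall>i<k. \<bar>y i\<bar> \<le> s}"

definition open_disk :: "nat \<Rightarrow> (nat \<Rightarrow> real) set" where
  "open_disk k = {y \<in> topspace (Euclidean_space k). \<forall>i<k. \<bar>y i\<bar> < 1}"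

definition is_ray :: "nat \<Rightarrow> 'a topology \<Rightarrow> 'a chart set \<Rightarrow> (real \<Rightarrow> 'a) \<Rightarrow> bool" where
  "is_ray n M \<A> r \<longleftrightarrow>
     embedding_map (top_of_set {0..}) M r \<and> proper_map (top_of_set {0..}) M r \<and>
     pl_map_into 1 (half_space 1) n M \<A> (\<lambda>x. r (x 0)) \<and>
     locally_flat_in n M \<A> 1 (r ` {0..}) \<and>
     r ` {0..} \<subseteq> manifold_interior n M"

definition is_tubular_nbhd_map :: "nat \<Rightarrow> 'a topology \<Rightarrow> 'a chart set \<Rightarrow> (real \<Rightarrow> 'a) \<Rightarrow>
    (real \<times> (nat \<Rightarrow> real) \<Rightarrow> 'a) \<Rightarrow> bool" where
  "is_tubular_nbhd_map n M \<A> r \<nu> \<longleftrightarrow>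
     (let T = {0..} \<times> cube (n - 1) 1;
          X = prod_topology (top_of_set {0..}) (subtopology (Euclidean_space (n - 1)) (cube (n - 1) 1))
      in embedding_map X M \<nu> \<and> proper_map X M \<nu> \<and>
         pl_map_into n {x \<in> topspace (Euclidean_space n). split_first x \<in> T} n M \<A> (\<nu> \<circ> split_first) \<and>
         locally_flat_in n M \<A> n (\<nu> ` T) \<and>
         \<nu> ` T \<subseteq> manifold_interior n M \<and>
         (\<forall>t\<ge>0. \<nu> (t, \<lambda>_. 0) = r t))"

definition orientation_reversing_iso :: "(real \<Rightarrow> real) \<Rightarrow> bool" where
  "orientation_reversing_iso \<rho> \<longleftrightarrow>
     pl_iso 1 (point1 ` {0<..}) 1 (point1 ` {0<..}) (\<lambda>x. point1 (\<rho> (x 0))) \<and>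
     (\<forall>s>0. \<forall>t>s. \<rho> t < \<rho> s)"

text \<open>A PL homeomorphism from the open disk onto \<open>\<real>\<^sup>k\<close> cannot map each radius into a radius
  when \<open>k \<ge> 2\<close>: on every linear piece it would be a multiple of the identity. As usual in the PL
  category, radial is therefore taken to mean that concentric disks go to concentric disks by a
  radial reparametrization \<open>g\<close>, while directions are controlled up to orthants. For example
  \<open>\<lambda>y i. g\<^sub>0 (y i)\<close> has these properties for any odd increasing PL homeomorphism \<open>g\<^sub>0\<close> from
  \<open>(-1,1)\<close> to \<open>\<real>\<close>.\<close>

definition radial_expansion_iso :: "nat \<Rightarrow> ((nat \<Rightarrow> real) \<Rightarrow> (nat \<Rightarrow> real)) \<Rightarrow> bool" where
  "radial_expansion_iso k l \<longleftrightarrow>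
     pl_iso k (open_disk k) k (topspace (Euclidean_space k)) l \<and>
     (\<exists>g :: real \<Rightarrow> real. strict_mono_on {0..<1} g \<and> g ` {0..<1} = {0..} \<and>
        (\<forall>s\<in>{0..<1}. l ` cube k s = cube k (g s))) \<and>
     (\<forall>y\<in>open_disk k. \<forall>i<k. sgn (l y i) = sgn (y i))"

definition handle :: "nat \<Rightarrow> (real \<times> (nat \<Rightarrow> real)) topology" where
  "handle n = prod_topology euclideanreal (Euclidean_space (n - 1))"

definition handle_plus :: "nat \<Rightarrow> (real \<times> (nat \<Rightarrow> real)) set" where
  "handle_plus n = {0<..} \<times> topspace (Euclidean_space (n - 1))"

definition handle_minus :: "nat \<Rightarrow> (real \<times> (nat \<Rightarrow> real)) set" where
  "handle_minus n = {..<0} \<times> topspace (Euclidean_space (n - 1))"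

definition phi_plus :: "nat \<Rightarrow> (real \<times> (nat \<Rightarrow> real) \<Rightarrow> 'a) \<Rightarrow> (real \<Rightarrow> real) \<Rightarrow>
    ((nat \<Rightarrow> real) \<Rightarrow> (nat \<Rightarrow> real)) \<Rightarrow> real \<times> (nat \<Rightarrow> real) \<Rightarrow> 'a" where
  "phi_plus n \<nu> \<rho> l = (\<lambda>(t, y). \<nu> (\<rho> t, inv_into (open_disk (n - 1)) l y))"

definition phi_minus :: "nat \<Rightarrow> (real \<times> (nat \<Rightarrow> real) \<Rightarrow> 'a) \<Rightarrow> (real \<Rightarrow> real) \<Rightarrow>
    ((nat \<Rightarrow> real) \<Rightarrow> (nat \<Rightarrow> real)) \<Rightarrow> real \<times> (nat \<Rightarrow> real) \<Rightarrow> 'a" where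
  "phi_minus n \<nu>' \<rho> l = (\<lambda>(t, y). \<nu>' (\<rho> (- t), inv_into (open_disk (n - 1)) l y))"

definition handle_relation :: "nat \<Rightarrow> 'a topology \<Rightarrow> (real \<times> (nat \<Rightarrow> real) \<Rightarrow> 'a) \<Rightarrow>
    (real \<times> (nat \<Rightarrow> real) \<Rightarrow> 'a) \<Rightarrow> (real \<Rightarrow> real) \<Rightarrow> ((nat \<Rightarrow> real) \<Rightarrow> (nat \<Rightarrow> real)) \<Rightarrow>
    (('a + real \<times> (nat \<Rightarrow> real)) \<times> ('a + real \<times> (nat \<Rightarrow> real))) set" where
  "handle_relation n M \<nu> \<nu>' \<rho> l =
     generated_equiv (topspace (disjoint_sum_topology M (handle n)))
       ({(Inr x, Inl (phi_plus n \<nu> \<rho> l x)) | x. x \<in> handle_plus n} \<union>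
        {(Inr x, Inl (phi_minus n \<nu>' \<rho> l x)) | x. x \<in> handle_minus n})"

definition add_handle :: "nat \<Rightarrow> 'a topology \<Rightarrow> (real \<times> (nat \<Rightarrow> real) \<Rightarrow> 'a) \<Rightarrow>
    (real \<times> (nat \<Rightarrow> real) \<Rightarrow> 'a) \<Rightarrow> (real \<Rightarrow> real) \<Rightarrow> ((nat \<Rightarrow> real) \<Rightarrow> (nat \<Rightarrow> real)) \<Rightarrow>
    ('a + real \<times> (nat \<Rightarrow> real)) set topology" where
  "add_handle n M \<nu> \<nu>' \<rho> l =
     quotient_topology (disjoint_sum_topology M (handle n)) (handle_relation n M \<nu> \<nu>' \<rho> l)"

definition add_handle_incl :: "nat \<Rightarrow> 'a topology \<Rightarrow> (real \<times> (nat \<Rightarrow> real) \<Rightarrow> 'a) \<Rightarrow>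
    (real \<times> (nat \<Rightarrow> real) \<Rightarrow> 'a) \<Rightarrow> (real \<Rightarrow> real) \<Rightarrow> ((nat \<Rightarrow> real) \<Rightarrow> (nat \<Rightarrow> real)) \<Rightarrow>
    'a \<Rightarrow> ('a + real \<times> (nat \<Rightarrow> real)) set" where
  "add_handle_incl n M \<nu> \<nu>' \<rho> l p = handle_relation n M \<nu> \<nu>' \<rho> l `` {Inl p}"


section \<open>The canonical map between spaces of ends\<close>

definition ordinary_end :: "'a topology \<Rightarrow> 'b topology \<Rightarrow> ('a \<Rightarrow> 'b) \<Rightarrow> ('b set \<Rightarrow> 'b set) \<Rightarrow> bool" where
  "ordinary_end M N i \<alpha> \<longleftrightarrow> (\<exists>W. end_neighborhood N \<alpha> W \<and> W \<subseteq> i ` topspace M)"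

text \<open>\<open>N\<close> is the result of adding a 1-handle at infinity to \<open>M\<close>, and \<open>i\<close> is the natural map
  from \<open>M\<close> to \<open>N\<close>; the end of \<open>M\<close> described in the first case then exists and is unique.\<close>

definition canonical_end_map :: "'a topology \<Rightarrow> 'b topology \<Rightarrow> ('a \<Rightarrow> 'b) \<Rightarrow>
    ('a set \<Rightarrow> 'a set) \<Rightarrow> ('a set \<Rightarrow> 'a set) \<Rightarrow> ('b set \<Rightarrow> 'b set) \<Rightarrow> ('a set \<Rightarrow> 'a set) set" where
  "canonical_end_map M N i \<eta> \<eta>' \<alpha> =
     (if ordinary_end M N i \<alpha>
      then ends_relation M \<eta> \<eta>' ``
             {THE \<beta>. \<beta> \<in> ends M \<and> (\<forall>K. compactin M K \<longrightarrow> i ` \<beta> K \<subseteq> \<alpha> (i ` K))}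
      else ends_relation M \<eta> \<eta>' `` {\<eta>})"

end

theory Submission
  imports Defs "HOL-Homology.Invariance_of_Domain"
begin

text \<open>
  Let \<open>E\<^sub>0\<close> be the core of the handle, a closed copy of \<open>\<real>\<^sup>n\<^sup>-\<^sup>1\<close> in \<open>N\<close> with complement \<open>M\<close>. By properness
  of the tubular neighbourhoods, a compact subset of \<open>M\<close> avoids a whole slab around \<open>E\<^sub>0\<close>. Therefore
  the components of \<open>N - K\<close>, for \<open>K \<subseteq> M\<close> compact, are the components of \<open>M - K\<close>, except that those
  belonging to \<open>\<eta>\<close> and \<open>\<eta>'\<close> are joined to one component containing \<open>E\<^sub>0\<close>. An end of \<open>N\<close> is ordinary
  iff some such \<open>K\<close> separates it from \<open>E\<^sub>0\<close>, and the ordinary ends are the ends of \<open>M\<close> other than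
  \<open>\<eta>\<close> and \<open>\<eta>'\<close>. An extraordinary end meets \<open>E\<^sub>0\<close> outside every compact set, so it is unique, and
  \<open>h\<close> is a homeomorphism, as soon as for every compact \<open>L\<close> the part of \<open>E\<^sub>0\<close> far out lies in one
  component of \<open>N - L\<close>. For \<open>n \<ge> 3\<close> this part is itself connected. For \<open>n = 2\<close> it consists of two
  half-lines; if \<open>L\<close> separated them, there would be a map to the circle on the surface \<open>M\<close>
  minus a point, equal to \<open>1\<close> outside a compact subset of the interior and of odd degree around the
  point. This contradicts the parity theorem that the number of points of odd degree is even.
\<close>

section \<open>Ends and their neighbourhoods\<close>

text \<open>For surfaces, everything depends on making the circle-valued map equal to 1 off a
  compact set of interior points; both hypotheses of case (i) serve this. A compact set separates
  \<eta> from \<eta>' and contains a neighbourhood of the boundary; the map lives on the side of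
  \<eta> only and is cut off near that set. For \<eta> = \<eta>' there is no such side: a handle can
  turn the plane, with one end, into an open annulus with two. With noncompact boundary, joining the
  two ends of \<open>[0,1] \<times> \<real>\<close> leaves two ends, one at each end of the core. As
  \<open>M\<close> may be non-orientable, integral degrees cannot be added over it. Their parity
  can, and it has an orientation-free form: the degree around a point is even iff the map has a
  continuous square root on a punctured neighbourhood. The parity theorem clears one disc after
  another and so avoids triangulations. In every dimension, the difficulty in comparing ends lies in
  the compact sets of \<open>N\<close> that meet the core. They do not come from \<open>M\<close>
  and have to be traded for compact sets that do.\<close>

lemma connected_components_of_subtopology_iff:
  "D \<in> connected_components_of (subtopology X S) \<longleftrightarrow>
     D \<noteq> {} \<and> connectedin X D \<and> D \<subseteq> S \<and>
     (\<forall>T. connectedin X T \<and> T \<subseteq> S \<and> T \<inter> D \<noteq> {} \<longrightarrow> T \<subseteq> D)" (is "?L \<longleftrightarrow> ?R")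
proof
  assume L: ?L
  have "connectedin X D" "D \<subseteq> S"
    using connectedin_connected_components_of[OF L] by (auto simp: connectedin_subtopology)
  moreover have "D \<noteq> {}" using nonempty_connected_components_of[OF L] .
  moreover have "T \<subseteq> D" if "connectedin X T" "T \<subseteq> S" "T \<inter> D \<noteq> {}" for T
    using connected_components_of_maximal[OF L, of T] that
    by (auto simp: connectedin_subtopology disjnt_def)
  ultimately show ?R by blast
next
  assume R: ?R
  then obtain x where x: "x \<in> D" by blast
  have D: "connectedin (subtopology X S) D" using R by (simp add: connectedin_subtopology)
  have "D \<subseteq> connected_component_of_set (subtopology X S) x"
    by (simp add: D connected_component_of_maximal x)
  moreover have "connected_component_of_set (subtopology X S) x \<subseteq> D"
  proof -
    have "connectedin (subtopology X S) (connected_component_of_set (subtopology X S) x)"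
      by (rule connectedin_connected_component_of)
    moreover have "x \<in> connected_component_of_set (subtopology X S) x"
      using calculation \<open>D \<subseteq> _\<close> x by blast
    ultimately show ?thesis
      using R x by (meson connectedin_subtopology disjoint_iff)
  qed
  moreover have "x \<in> topspace (subtopology X S)"
    using D x connectedin_subset_topspace by blast
  ultimately show ?L
    by (metis connected_component_in_connected_components_of subset_antisym)
qed

lemma connected_components_of_iff:
  "D \<in> connected_components_of X \<longleftrightarrow>
     D \<noteq> {} \<and> connectedin X D \<and> (\<forall>T. connectedin X T \<and> T \<inter> D \<noteq> {} \<longrightarrow> T \<subseteq> D)"
  using connected_components_of_subtopology_iff[of D X "topspace X"]
  by simp (metis connectedin_subset_topspace)

text \<open>The value at the empty set is a component \<open>C\<close>, and monotonicity confines
  all other values to it. Components of \<open>C - K\<close> are exactly the components of the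
  complement of \<open>K\<close> that lie in \<open>C\<close>. So disconnected spaces need no
  separate treatment below.\<close>

lemma ends_eq_ends_connected: "ends X = ends_connected X"
proof -
  have comp: "D \<in> connected_components_of (subtopology (subtopology X C) (topspace (subtopology X C) - (K \<inter> C)))
      \<longleftrightarrow> D \<in> connected_components_of (subtopology X (topspace X - K)) \<and> D \<subseteq> C"
    if C: "C \<in> connected_components_of X" for C D K
  proof -
    have CX: "C \<subseteq> topspace X" "topspace X \<inter> C = C" using connected_components_of_subset[OF C] by auto
    have "topspace X \<inter> C \<inter> (topspace X \<inter> C - K \<inter> C) = C - K" using CX by blast
    moreover have "C \<inter> (topspace X \<inter> C - K \<inter> C) = C - K" using CX by blast
    ultimately have eq: "subtopology (subtopology X C) (topspace (subtopology X C) - (K \<inter> C)) = subtopology X (C - K)"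
      by (simp add: subtopology_subtopology)
    show ?thesis
      unfolding eq connected_components_of_subtopology_iff
    proof (intro iffI conjI; (elim conjE)?)
      assume D: "D \<noteq> {}" "D \<subseteq> C - K" "\<forall>T. connectedin X T \<and> T \<subseteq> C - K \<and> T \<inter> D \<noteq> {} \<longrightarrow> T \<subseteq> D"
      show "\<forall>T. connectedin X T \<and> T \<subseteq> topspace X - K \<and> T \<inter> D \<noteq> {} \<longrightarrow> T \<subseteq> D"
      proof (intro allI impI)
        fix T assume T: "connectedin X T \<and> T \<subseteq> topspace X - K \<and> T \<inter> D \<noteq> {}"
        then have "T \<inter> C \<noteq> {}" using D(2) by blast
        then have "T \<subseteq> C" using C T unfolding connected_components_of_iff by blast
        then show "T \<subseteq> D" using D(3) T by blast
      qed
    next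
      assume D: "D \<subseteq> C" "\<forall>T. connectedin X T \<and> T \<subseteq> topspace X - K \<and> T \<inter> D \<noteq> {} \<longrightarrow> T \<subseteq> D"
      show "\<forall>T. connectedin X T \<and> T \<subseteq> C - K \<and> T \<inter> D \<noteq> {} \<longrightarrow> T \<subseteq> D"
        using D CX(1) by (meson Diff_mono order_refl order_trans)
    qed (use CX(1) in auto)
  qed
  show ?thesis
  proof (intro equalityI subsetI)
    fix \<beta> assume "\<beta> \<in> ends X"
    then obtain C e where C: "C \<in> connected_components_of X"
      and e: "e \<in> ends_connected (subtopology X C)"
      and b: "\<beta> = (\<lambda>K\<in>{K. compactin X K}. e (K \<inter> C))"
      unfolding ends_def by blast
    have cK: "compactin (subtopology X C) (K \<inter> C)" if "compactin X K" for K
      using that closedin_connected_components_of[OF C] by (simp add: compactin_subtopology compact_Int_closedin)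
    have b1: "\<beta> K = e (K \<inter> C)" if "compactin X K" for K using that b by simp
    have "\<beta> K \<in> connected_components_of (subtopology X (topspace X - K))" if "compactin X K" for K
      using e cK[OF that] comp[OF C, of "\<beta> K" K] b1[OF that] unfolding ends_connected_def by auto
    moreover have "\<beta> K2 \<subseteq> \<beta> K1" if "compactin X K1" "compactin X K2" "K1 \<subseteq> K2" for K1 K2
    proof -
      have "e (K2 \<inter> C) \<subseteq> e (K1 \<inter> C)"
        using e cK[OF that(1)] cK[OF that(2)] that(3) unfolding ends_connected_def by blast
      then show ?thesis using b1 that by simp
    qed
    ultimately show "\<beta> \<in> ends_connected X"
      unfolding ends_connected_def b by auto
  next
    fix \<beta> assume b: "\<beta> \<in> ends_connected X"
    have bc: "\<beta> K \<in> connected_components_of (subtopology X (topspace X - K))" if "compactin X K" for K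
      using b that by (simp add: ends_connected_def)
    have bm: "\<beta> K2 \<subseteq> \<beta> K1" if "compactin X K1" "compactin X K2" "K1 \<subseteq> K2" for K1 K2
      using b that by (simp add: ends_connected_def)
    define C where "C = \<beta> {}"
    have C: "C \<in> connected_components_of X" using bc[of "{}"] by (simp add: C_def)
    have bC: "\<beta> K \<subseteq> C" if "compactin X K" for K using bm[of "{}" K] that by (simp add: C_def)
    have cK: "compactin X (K \<inter> C)" if "compactin X K" for K
      using that closedin_connected_components_of[OF C] by (simp add: compact_Int_closedin)
    have eqK: "\<beta> (K \<inter> C) = \<beta> K" if K: "compactin X K" for K
    proof
      show s: "\<beta> K \<subseteq> \<beta> (K \<inter> C)" using bm[OF cK[OF K] K] by simp
      have 1: "\<beta> K \<noteq> {}" "\<And>T. connectedin X T \<Longrightarrow> T \<subseteq> topspace X - K \<Longrightarrow> T \<inter> \<beta> K \<noteq> {} \<Longrightarrow> T \<subseteq> \<beta> K"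
        using bc[OF K] unfolding connected_components_of_subtopology_iff by auto
      have 2: "connectedin X (\<beta> (K \<inter> C))" "\<beta> (K \<inter> C) \<subseteq> topspace X - (K \<inter> C)"
        using bc[OF cK[OF K]] unfolding connected_components_of_subtopology_iff by auto
      show "\<beta> (K \<inter> C) \<subseteq> \<beta> K"
        using 1(2)[OF 2(1)] 2 1(1) s bC[OF cK[OF K]] by blast
    qed
    define e where "e = (\<lambda>K\<in>{K. compactin (subtopology X C) K}. \<beta> K)"
    have e1: "e K = \<beta> K" if "compactin X K" "K \<subseteq> C" for K
      using that by (simp add: e_def compactin_subtopology)
    have "e \<in> ends_connected (subtopology X C)"
      unfolding ends_connected_def
    proof (intro CollectI conjI allI impI)
      show "e \<in> extensional {K. compactin (subtopology X C) K}" by (simp add: e_def)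
      fix K assume K: "compactin (subtopology X C) K"
      then have K': "compactin X K" "K \<subseteq> C" by (auto simp: compactin_subtopology)
      have "K \<inter> C = K" using K' by blast
      then show "e K \<in> connected_components_of (subtopology (subtopology X C) (topspace (subtopology X C) - K))"
        using comp[OF C, of "\<beta> K" K] bc[OF K'(1)] bC[OF K'(1)] e1[OF K'] by simp
    next
      fix K1 K2 assume "compactin (subtopology X C) K1" "compactin (subtopology X C) K2" "K1 \<subseteq> K2"
      then show "e K2 \<subseteq> e K1"
        using e1 bm by (auto simp: compactin_subtopology)
    qed
    moreover have "\<beta> = (\<lambda>K\<in>{K. compactin X K}. e (K \<inter> C))"
    proof
      fix K show "\<beta> K = (\<lambda>K\<in>{K. compactin X K}. e (K \<inter> C)) K"
        using b e1[of "K \<inter> C"] cK eqK unfolding ends_connected_def extensional_def by auto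
    qed
    ultimately show "\<beta> \<in> ends X" unfolding ends_def using C by blast
  qed
qed

lemma end_component:
  assumes "\<epsilon> \<in> ends X" "compactin X K"
  shows "\<epsilon> K \<in> connected_components_of (subtopology X (topspace X - K))"
  using assms by (simp add: ends_eq_ends_connected ends_connected_def)

lemma end_mono:
  assumes "\<epsilon> \<in> ends X" "compactin X K" "compactin X K'" "K \<subseteq> K'"
  shows "\<epsilon> K' \<subseteq> \<epsilon> K"
  using assms by (simp add: ends_eq_ends_connected ends_connected_def)

lemma end_nonempty: "\<epsilon> \<in> ends X \<Longrightarrow> compactin X K \<Longrightarrow> \<epsilon> K \<noteq> {}"
  using end_component nonempty_connected_components_of by blast

lemma end_connected: "\<epsilon> \<in> ends X \<Longrightarrow> compactin X K \<Longrightarrow> connectedin X (\<epsilon> K)"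
  using end_component[of \<epsilon> X K] by (simp add: connected_components_of_subtopology_iff)

lemma end_subset: "\<epsilon> \<in> ends X \<Longrightarrow> compactin X K \<Longrightarrow> \<epsilon> K \<subseteq> topspace X - K"
  using end_component[of \<epsilon> X K] by (simp add: connected_components_of_subtopology_iff)

lemma end_maximal:
  assumes "\<epsilon> \<in> ends X" "compactin X K" "connectedin X T" "T \<inter> K = {}" "T \<inter> \<epsilon> K \<noteq> {}"
  shows "T \<subseteq> \<epsilon> K"
proof -
  have "T \<subseteq> topspace X - K" using assms(3,4) connectedin_subset_topspace by blast
  with assms show ?thesis
    using end_component[OF assms(1,2)] by (simp add: connected_components_of_subtopology_iff)
qed

lemma end_eq_if_overlap:
  assumes "\<epsilon> \<in> ends X" "\<epsilon>' \<in> ends X" "compactin X K" "\<epsilon> K \<inter> \<epsilon>' K \<noteq> {}"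
  shows "\<epsilon> K = \<epsilon>' K"
  using assms connected_components_of_overlap end_component by blast

lemma end_eq_mono:
  assumes "\<epsilon> \<in> ends X" "\<epsilon>' \<in> ends X" "compactin X K" "compactin X K'" "K \<subseteq> K'" "\<epsilon> K' = \<epsilon>' K'"
  shows "\<epsilon> K = \<epsilon>' K"
proof -
  have "\<epsilon> K' \<subseteq> \<epsilon> K" "\<epsilon> K' \<subseteq> \<epsilon>' K"
    using end_mono[OF assms(1,3,4,5)] end_mono[OF assms(2,3,4,5)] assms(6) by auto
  then have "\<epsilon> K \<inter> \<epsilon>' K \<noteq> {}" using end_nonempty[OF assms(1,4)] by blast
  then show ?thesis using end_eq_if_overlap assms by blast
qed

lemma end_eqI:
  assumes "\<epsilon> \<in> ends X" "\<epsilon>' \<in> ends X" "\<And>K. compactin X K \<Longrightarrow> \<epsilon> K = \<epsilon>' K"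
  shows "\<epsilon> = \<epsilon>'"
  using assms unfolding ends_eq_ends_connected ends_connected_def
  by (auto intro!: extensionalityI[where A="{K. compactin X K}"])

lemma openin_end:
  assumes "locally_connected_space X" "Hausdorff_space X" "\<epsilon> \<in> ends X" "compactin X K"
  shows "openin X (\<epsilon> K)"
proof -
  have "openin X (topspace X - K)"
    using compactin_imp_closedin[OF assms(2,4)] by blast
  then show ?thesis
    using assms(1) end_component[OF assms(3,4)]
    by (auto simp: locally_connected_space_open_connected_components)
qed

text \<open>The sets \<open>S K\<close> need not be nested. As soon as \<open>S K\<close> and
  \<open>S K'\<close> meet, maximality puts the component around \<open>S K'\<close> inside the one
  around \<open>S K\<close>. All ends below are constructed in this way.\<close>

lemma end_exists:
  assumes S: "\<And>K. compactin X K \<Longrightarrow> connectedin X (S K) \<and> S K \<noteq> {} \<and> S K \<inter> K = {}"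
    and meet: "\<And>K K'. compactin X K \<Longrightarrow> compactin X K' \<Longrightarrow> K \<subseteq> K' \<Longrightarrow> S K \<inter> S K' \<noteq> {}"
  obtains \<epsilon> where "\<epsilon> \<in> ends X" "\<And>K. compactin X K \<Longrightarrow> S K \<subseteq> \<epsilon> K"
proof -
  have "\<exists>D. D \<in> connected_components_of (subtopology X (topspace X - K)) \<and> S K \<subseteq> D"
    if "compactin X K" for K
  proof -
    have "connectedin (subtopology X (topspace X - K)) (S K)"
      using S[OF that] connectedin_subset_topspace by (fastforce simp: connectedin_subtopology)
    moreover have "topspace (subtopology X (topspace X - K)) \<noteq> {}"
      using calculation S[OF that] connectedin_subset_topspace by blast
    ultimately show ?thesis
      by (metis S that exists_connected_component_of_superset topspace_discrete_topology subtopology_trivial_iff null_topspace_iff_trivial)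
  qed
  then obtain D where D: "\<And>K. compactin X K \<Longrightarrow> D K \<in> connected_components_of (subtopology X (topspace X - K))"
    "\<And>K. compactin X K \<Longrightarrow> S K \<subseteq> D K" by metis
  define e where "e = (\<lambda>K\<in>{K. compactin X K}. D K)"
  have "D K' \<subseteq> D K" if "compactin X K" "compactin X K'" "K \<subseteq> K'" for K K'
  proof -
    have 1: "connectedin X (D K')" "D K' \<subseteq> topspace X - K'"
      using D(1)[OF that(2)] by (auto simp: connected_components_of_subtopology_iff)
    have "D K \<inter> D K' \<noteq> {}" using meet[OF that] D(2) that by blast
    then show ?thesis
      using D(1)[OF that(1)] 1 that(3) unfolding connected_components_of_subtopology_iff by blast
  qed
  then have "e \<in> ends X"
    unfolding ends_eq_ends_connected ends_connected_def e_def using D(1) by auto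
  then show thesis using that[of e] D(2) by (simp add: e_def)
qed

text \<open>The generating sets form a base, because agreement of two ends at
  \<open>K \<union> K'\<close> forces agreement at \<open>K\<close> and at
  \<open>K'\<close>.\<close>

lemma openin_ends_topology:
  "openin (ends_topology X) U \<longleftrightarrow>
     U \<subseteq> ends X \<and> (\<forall>\<epsilon>\<in>U. \<exists>K. compactin X K \<and> basic_end_nbhd X \<epsilon> K \<subseteq> U)" (is "?L \<longleftrightarrow> ?R")
proof
  assume ?R
  have "openin (ends_topology X) (basic_end_nbhd X \<epsilon> K)" if "\<epsilon> \<in> ends X" "compactin X K" for \<epsilon> K
    unfolding ends_topology_def by (rule topology_generated_by_Basis) (use that in blast)
  moreover have "\<epsilon> \<in> basic_end_nbhd X \<epsilon> K" if "\<epsilon> \<in> ends X" for \<epsilon> K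
    using that by (simp add: basic_end_nbhd_def)
  ultimately show ?L
    using \<open>?R\<close> by (subst openin_subopen) (metis (no_types, lifting) subsetD)
next
  assume L: ?L
  have "generate_topology_on {basic_end_nbhd X \<epsilon> K | \<epsilon> K. \<epsilon> \<in> ends X \<and> compactin X K} U"
    using L unfolding ends_topology_def openin_topology_generated_by_iff .
  then have "\<forall>\<epsilon>\<in>U. \<exists>K. compactin X K \<and> basic_end_nbhd X \<epsilon> K \<subseteq> U"
  proof induction
    case Empty
    then show ?case by simp
  next
    case (Int a b)
    show ?case
    proof
      fix \<epsilon> assume e: "\<epsilon> \<in> a \<inter> b"
      then obtain K K' where K: "compactin X K" "basic_end_nbhd X \<epsilon> K \<subseteq> a"
        "compactin X K'" "basic_end_nbhd X \<epsilon> K' \<subseteq> b" using Int.IH by blast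
      have eX: "\<epsilon> \<in> ends X"
      proof -
        have "openin (ends_topology X) a"
          using Int.hyps(1) unfolding ends_topology_def openin_topology_generated_by_iff .
        then have "a \<subseteq> topspace (ends_topology X)" by (rule openin_subset)
        then show ?thesis using e by (auto simp: topspace_ends_topology)
      qed
      have U: "compactin X (K \<union> K')" using K by (simp add: compactin_Un)
      have *: "\<beta> K = \<epsilon> K \<and> \<beta> K' = \<epsilon> K'" if "\<beta> \<in> ends X" "\<beta> (K \<union> K') = \<epsilon> (K \<union> K')" for \<beta>
        using end_eq_mono[OF that(1) eX _ U _ that(2)] K by auto
      have "basic_end_nbhd X \<epsilon> (K \<union> K') \<subseteq> basic_end_nbhd X \<epsilon> K \<inter> basic_end_nbhd X \<epsilon> K'"
        using * by (auto simp: basic_end_nbhd_def)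
      then have "basic_end_nbhd X \<epsilon> (K \<union> K') \<subseteq> a \<inter> b"
        using K(2,4) by (meson Int_mono order_trans)
      then show "\<exists>K. compactin X K \<and> basic_end_nbhd X \<epsilon> K \<subseteq> a \<inter> b" using U by blast
    qed
  next
    case (UN \<K>)
    then show ?case by (meson Union_iff Sup_upper order_trans)
  next
    case (Basis s)
    then show ?case by (auto simp: basic_end_nbhd_def)
  qed
  then show ?R
    using L openin_subset topspace_ends_topology by metis
qed

section \<open>Identifying two ends\<close>

lemma equiv_ends_relation: "equiv (ends X) (ends_relation X \<eta> \<eta>')"
  by (rule equiv_generated_equiv)

lemma ends_relation_eq:
  assumes "\<eta> \<in> ends X" "\<eta>' \<in> ends X"
  shows "ends_relation X \<eta> \<eta>' = Id_on (ends X) \<union> {\<eta>, \<eta>'} \<times> {\<eta>, \<eta>'}"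
proof
  show "ends_relation X \<eta> \<eta>' \<subseteq> Id_on (ends X) \<union> {\<eta>, \<eta>'} \<times> {\<eta>, \<eta>'}"
  proof (rule generated_equiv_least)
    show "equiv (ends X) (Id_on (ends X) \<union> {\<eta>, \<eta>'} \<times> {\<eta>, \<eta>'})"
      using assms by (auto simp: equiv_def refl_on_def sym_def trans_def)
  qed auto
  have e: "equiv (ends X) (ends_relation X \<eta> \<eta>')" by (rule equiv_ends_relation)
  have 1: "(\<eta>, \<eta>') \<in> ends_relation X \<eta> \<eta>'"
    using assms by (auto simp: generated_equiv_def)
  have r: "(x, x) \<in> ends_relation X \<eta> \<eta>'" if "x \<in> ends X" for x
    using e that by (simp add: equiv_def refl_on_def)
  have 2: "(\<eta>', \<eta>) \<in> ends_relation X \<eta> \<eta>'"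
    using e 1 by (meson equivE symE)
  show "Id_on (ends X) \<union> {\<eta>, \<eta>'} \<times> {\<eta>, \<eta>'} \<subseteq> ends_relation X \<eta> \<eta>'"
    using 1 2 r assms by auto
qed

lemma topspace_ends_quotient: "topspace (ends_quotient X \<eta> \<eta>') = ends X // ends_relation X \<eta> \<eta>'"
  unfolding ends_quotient_def
  using topspace_quotient_topology[of "ends_topology X" "ends_relation X \<eta> \<eta>'"]
    equiv_ends_relation[of X \<eta> \<eta>']
  by (simp add: topspace_ends_topology)

lemma openin_ends_quotient:
  "openin (ends_quotient X \<eta> \<eta>') W \<longleftrightarrow>
     W \<subseteq> ends X // ends_relation X \<eta> \<eta>' \<and> openin (ends_topology X) (\<Union>W)"
  unfolding ends_quotient_def
  using openin_quotient_topology[of "ends_topology X" "ends_relation X \<eta> \<eta>'"]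
    equiv_ends_relation[of X \<eta> \<eta>']
  by (simp add: topspace_ends_topology)

section \<open>Coordinates on the handle\<close>

abbreviation coords :: "nat \<Rightarrow> (nat \<Rightarrow> real) set" where
  "coords m \<equiv> {y. \<forall>j\<ge>m. y j = 0}"

definition open_cube :: "nat \<Rightarrow> real \<Rightarrow> (nat \<Rightarrow> real) set" where
  "open_cube m s = {y \<in> coords m. \<forall>j<m. \<bar>y j\<bar> < s}"

lemma Euclidean_space_eq_top_of_set: "Euclidean_space m = top_of_set (coords m)"
  by (simp add: Euclidean_space_def euclidean_product_topology)

lemma cube_eq: "cube m s = {y \<in> coords m. \<forall>j<m. \<bar>y j\<bar> \<le> s}"
  by (simp add: cube_def topspace_Euclidean_space)

lemma prod_topology_euclidean:
  "prod_topology (euclidean :: 'a::topological_space topology) (euclidean :: 'b::topological_space topology) = euclidean"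
  unfolding topology_eq openin_prod_topology_alt
  by (simp add: open_prod_def Ball_def split_paired_All conj_assoc)

lemma prod_Euclidean_space_eq_top_of_set:
  "prod_topology euclideanreal (Euclidean_space m) = top_of_set (UNIV \<times> coords m)"
  by (simp add: Euclidean_space_eq_top_of_set prod_topology_subtopology(2) prod_topology_euclidean)

lemma compact_cube: "compact (cube m s)"
proof -
  have "cube m s = PiE UNIV (\<lambda>j. if j < m then {-s..s} else {0})"
    by (auto simp: cube_eq PiE_def Pi_def abs_le_iff not_less split: if_splits)

  moreover have "compactin (product_topology (\<lambda>j::nat. euclideanreal) UNIV) (PiE UNIV (\<lambda>j. if j < m then {-s..s} else {0}))"
    unfolding compactin_PiE by auto
  ultimately show ?thesis by (simp add: euclidean_product_topology)
qed

lemma open_coordinate_box: "open {y::nat \<Rightarrow> real. \<forall>j<m. \<bar>y j\<bar> < s}"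
proof -
  have "{y::nat \<Rightarrow> real. \<forall>j<m. \<bar>y j\<bar> < s} = (\<Inter>j\<in>{..<m}. {y. \<bar>y j\<bar> < s})" by auto
  moreover have "open {y::nat \<Rightarrow> real. \<bar>y j\<bar> < s}" for j
    by (intro open_Collect_less continuous_intros continuous_on_product_coordinates)
  ultimately show ?thesis by (simp add: open_INT)
qed

lemma open_cube_subset_cube: "open_cube m s \<subseteq> cube m s"
  by (force simp: open_cube_def cube_eq)

lemma open_cube_mono: "s \<le> t \<Longrightarrow> open_cube m s \<subseteq> open_cube m t"
  unfolding open_cube_def by (auto intro: less_le_trans)

lemma zero_in_cube: "s \<ge> 0 \<Longrightarrow> (\<lambda>_. 0) \<in> cube m s"
  by (simp add: cube_eq)

lemma connected_coords: "connected (coords m)"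
proof -
  have "connectedin euclidean (coords m)"
    unfolding connectedin_def using connected_Euclidean_space[of m] by (simp add: Euclidean_space_eq_top_of_set)
  then show ?thesis by (simp only: connectedin_iff_connected)
qed

lemma connected_interval_times_coords: "connected ({a<..<b::real} \<times> coords m)"
  by (intro connected_Times connected_coords) simp

lemma connected_line: "connected ({a<..<b::real} \<times> {y::nat \<Rightarrow> real})"
  by (intro connected_Times) auto

section \<open>Attaching a handle at infinity\<close>

text \<open>The comparison of ends uses only these properties of the construction: \<open>M\<close>
  and the core partition \<open>N\<close>, and by \<open>tail\<close> the two halves of a thin slab
  enter the components of \<eta> and \<eta>'. Rays, tubes and the PL structure are hidden behind
  them; \<open>m\<close> stands for \<open>n - 1\<close>.\<close>

locale handle_at_infinity =
  fixes M :: "'a topology" and N :: "'b topology" and i :: "'a \<Rightarrow> 'b"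
    and e :: "real \<times> (nat \<Rightarrow> real) \<Rightarrow> 'b" and m :: nat and \<eta> \<eta>' :: "'a set \<Rightarrow> 'a set"
  assumes Hausdorff_M: "Hausdorff_space M" and locally_compact_M: "locally_compact_space M"
    and locally_connected_M: "locally_connected_space M"
    and \<eta>: "\<eta> \<in> ends M" and \<eta>': "\<eta>' \<in> ends M"
    and cont_i: "continuous_map M N i" and open_i: "open_map M N i" and inj_i: "inj_on i (topspace M)"
    and cont_e: "continuous_map (top_of_set (UNIV \<times> coords m)) N e"
    and open_e: "open_map (top_of_set (UNIV \<times> coords m)) N e"
    and inj_e: "inj_on e (UNIV \<times> coords m)"
    and topspace_N: "topspace N = i ` topspace M \<union> e ` ({0} \<times> coords m)"
    and disjoint_core: "i ` topspace M \<inter> e ` ({0} \<times> coords m) = {}"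
    and tail: "\<And>K. compactin M K \<Longrightarrow> \<exists>\<epsilon>>0. e ` ({0<..<\<epsilon>} \<times> coords m) \<subseteq> i ` \<eta> K \<and>
                 e ` ({-\<epsilon><..<0} \<times> coords m) \<subseteq> i ` \<eta>' K"
begin

definition core :: "'b set" where "core = e ` ({0} \<times> coords m)"

definition preim :: "'b set \<Rightarrow> 'a set" where "preim A = {x \<in> topspace M. i x \<in> A}"

lemma e_in_topspace: "y \<in> coords m \<Longrightarrow> e (t, y) \<in> topspace N"
  using cont_e by (auto simp: continuous_map_def Pi_iff)

lemma e_eq_iff: "y \<in> coords m \<Longrightarrow> y' \<in> coords m \<Longrightarrow> e (t, y) = e (t', y') \<longleftrightarrow> t = t' \<and> y = y'"
  using inj_on_eq_iff[OF inj_e, of "(t, y)" "(t', y')"] by simp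

lemma e_in_image: "y \<in> coords m \<Longrightarrow> S \<subseteq> UNIV \<times> coords m \<Longrightarrow> e (t, y) \<in> e ` S \<longleftrightarrow> (t, y) \<in> S"
  using inj_on_image_mem_iff[OF inj_e, of "(t, y)" S] by simp

lemma core_subset: "core \<subseteq> topspace N" by (simp add: core_def topspace_N)

lemma i_image_eq: "i ` topspace M = topspace N - core"
  using disjoint_core unfolding topspace_N core_def by blast

lemma not_core_iff: "x \<in> topspace N \<Longrightarrow> x \<notin> core \<longleftrightarrow> x \<in> i ` topspace M"
  by (simp add: i_image_eq)

lemma e_in_core: "y \<in> coords m \<Longrightarrow> e (t, y) \<in> core \<longleftrightarrow> t = 0"
  unfolding core_def by (auto simp: e_eq_iff)

lemma i_preim: "A \<subseteq> i ` topspace M \<Longrightarrow> i ` preim A = A"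
  by (auto simp: preim_def)

lemma preim_i: "A \<subseteq> topspace M \<Longrightarrow> preim (i ` A) = A"
  using inj_i by (auto simp: preim_def inj_on_def)

lemma preim_mono: "A \<subseteq> B \<Longrightarrow> preim A \<subseteq> preim B" by (auto simp: preim_def)

lemma i_image_subset_iff: "A \<subseteq> topspace M \<Longrightarrow> B \<subseteq> topspace M \<Longrightarrow> i ` A \<subseteq> i ` B \<longleftrightarrow> A \<subseteq> B"
  by (metis image_mono preim_i preim_mono)

lemma i_image_eq_iff: "A \<subseteq> topspace M \<Longrightarrow> B \<subseteq> topspace M \<Longrightarrow> i ` A = i ` B \<longleftrightarrow> A = B"
  by (metis preim_i)

lemma i_image_Int: "A \<subseteq> topspace M \<Longrightarrow> B \<subseteq> topspace M \<Longrightarrow> i ` A \<inter> i ` B = i ` (A \<inter> B)"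
  using inj_i by (simp add: inj_on_image_Int)

lemma openin_i: "openin M U \<Longrightarrow> openin N (i ` U)"
  using open_i by (simp add: open_map_def)

lemma openin_e: "open U \<Longrightarrow> openin N (e ` (U \<inter> UNIV \<times> coords m))"
  using open_e openin_open_Int[of U "UNIV \<times> coords m"] unfolding open_map_def by (simp add: inf_commute)

lemma openin_slab: "openin N (e ` ({a<..<b} \<times> coords m))"
proof -
  have "{a<..<b} \<times> coords m = ({a<..<b} \<times> UNIV) \<inter> UNIV \<times> coords m" by auto
  then show ?thesis using openin_e[of "{a<..<b} \<times> UNIV"] by (simp add: open_Times)
qed

lemma openin_box: "openin N (e ` ({a<..<b} \<times> open_cube m s))"
proof -
  have "{a<..<b} \<times> open_cube m s = ({a<..<b} \<times> {y. \<forall>j<m. \<bar>y j\<bar> < s}) \<inter> UNIV \<times> coords m"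
    by (auto simp: open_cube_def)
  then show ?thesis using openin_e[of "{a<..<b} \<times> {y. \<forall>j<m. \<bar>y j\<bar> < s}"] open_coordinate_box by (simp add: open_Times)
qed

lemma connectedin_e: "connected C \<Longrightarrow> C \<subseteq> UNIV \<times> coords m \<Longrightarrow> connectedin N (e ` C)"
  by (rule connectedin_continuous_map_image[OF cont_e]) (simp add: connectedin_subtopology)

lemma compactin_e: "compact C \<Longrightarrow> C \<subseteq> UNIV \<times> coords m \<Longrightarrow> compactin N (e ` C)"
  by (rule image_compactin[OF _ cont_e]) (simp add: compactin_subtopology)

lemma compactin_box: "compactin N (e ` ({a..b} \<times> cube m s))"
proof (rule compactin_e)
  show "compact ({a..b} \<times> cube m s)" by (intro compact_Times compact_cube) simp
qed (auto simp: cube_eq)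

lemma compactin_i: "compactin M K \<Longrightarrow> compactin N (i ` K)"
  using image_compactin[OF _ cont_i] .

lemma connectedin_i: "connectedin M K \<Longrightarrow> connectedin N (i ` K)"
  using connectedin_continuous_map_image[OF cont_i] .

lemma inverse_i: obtains g where "continuous_map (subtopology N (i ` topspace M)) M g"
  "\<And>x. x \<in> topspace M \<Longrightarrow> g (i x) = x"
proof -
  have "embedding_map M N i" using cont_i open_i inj_i by (simp add: injective_open_imp_embedding_map)
  then obtain g where "homeomorphic_maps M (subtopology N (i ` topspace M)) i g"
    by (auto simp: embedding_map_def homeomorphic_map_maps)
  then show thesis using that[of g] by (auto simp: homeomorphic_maps_def)
qed

lemma
  assumes "A \<subseteq> i ` topspace M"
  shows compactin_preim: "compactin N A \<Longrightarrow> compactin M (preim A)"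
    and connectedin_preim: "connectedin N A \<Longrightarrow> connectedin M (preim A)"
proof -
  obtain g where g: "continuous_map (subtopology N (i ` topspace M)) M g"
    "\<And>x. x \<in> topspace M \<Longrightarrow> g (i x) = x" by (rule inverse_i) (use that in blast)
  have "preim A = g ` A" using assms g(2) by (force simp: preim_def)
  then show "compactin N A \<Longrightarrow> compactin M (preim A)" "connectedin N A \<Longrightarrow> connectedin M (preim A)"
    using image_compactin[OF _ g(1), of A] connectedin_continuous_map_image[OF g(1), of A] assms
    by (auto simp: compactin_subtopology connectedin_subtopology)
qed

lemma openin_i_topspace: "openin N (i ` topspace M)" using openin_i by simp

lemma core_nonempty: "core \<noteq> {}" unfolding core_def by (auto intro!: exI[of _ "\<lambda>_. 0"])

text \<open>The open halves of the slab lie in the images of \<eta> K and \<eta>' K, which miss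
  \<open>K\<close>, and the level in the middle is the core, which misses the image of
  \<open>M\<close>.\<close>

lemma avoid_slab:
  assumes "compactin M K"
  obtains \<epsilon> where "\<epsilon> > 0" "e ` ({-\<epsilon><..<\<epsilon>} \<times> coords m) \<inter> i ` K = {}"
    "e ` ({0<..<\<epsilon>} \<times> coords m) \<subseteq> i ` \<eta> K" "e ` ({-\<epsilon><..<0} \<times> coords m) \<subseteq> i ` \<eta>' K"
proof -
  obtain \<epsilon> where \<epsilon>: "\<epsilon> > 0" "e ` ({0<..<\<epsilon>} \<times> coords m) \<subseteq> i ` \<eta> K" "e ` ({-\<epsilon><..<0} \<times> coords m) \<subseteq> i ` \<eta>' K"
    using tail[OF assms] by blast
  have K: "K \<subseteq> topspace M" using assms compactin_subset_topspace by blast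
  have "\<eta> K \<subseteq> topspace M - K" "\<eta>' K \<subseteq> topspace M - K"
    using end_subset \<eta> \<eta>' assms by blast+
  then have 1: "i ` \<eta> K \<inter> i ` K = {}" "i ` \<eta>' K \<inter> i ` K = {}"
    using K by (subst i_image_Int; auto)+
  have "e ` ({-\<epsilon><..<\<epsilon>} \<times> coords m) \<inter> i ` K = {}"
  proof (rule ccontr)
    assume "\<not> ?thesis"
    then obtain z where z: "z \<in> {-\<epsilon><..<\<epsilon>} \<times> coords m" "e z \<in> i ` K" by blast
    obtain t y where "z = (t, y)" by (cases z)
    then have ty: "- \<epsilon> < t" "t < \<epsilon>" "y \<in> coords m" "e (t, y) \<in> i ` K" using z by auto
    then have "e (t, y) \<in> i ` topspace M" using K by blast
    then have "e (t, y) \<notin> core" unfolding i_image_eq by blast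
    then have "t \<noteq> 0" using e_in_core[OF ty(3)] by blast
    then consider "t > 0" | "t < 0" by linarith
    then show False
    proof cases
      case 1 then have "e (t, y) \<in> e ` ({0<..<\<epsilon>} \<times> coords m)" using ty by (intro imageI) auto
      then have "e (t, y) \<in> i ` \<eta> K" using \<epsilon>(2) by blast
      then show False using ty(4) \<open>i ` \<eta> K \<inter> i ` K = {}\<close> by blast
    next
      case 2 then have "e (t, y) \<in> e ` ({-\<epsilon><..<0} \<times> coords m)" using ty by (intro imageI) auto
      then have "e (t, y) \<in> i ` \<eta>' K" using \<epsilon>(3) by blast
      then show False using ty(4) \<open>i ` \<eta>' K \<inter> i ` K = {}\<close> by blast
    qed
  qed
  then show thesis by (rule that[OF \<epsilon>(1) _ \<epsilon>(2,3)])
qed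

lemma locally_connected_N: "locally_connected_space N"
  unfolding locally_connected_space
proof (intro allI impI, elim conjE)
  fix V x assume V: "openin N V" "x \<in> V"
  then have "x \<in> topspace N" using openin_subset by blast
  show "\<exists>U. openin N U \<and> connectedin N U \<and> x \<in> U \<and> U \<subseteq> V"
  proof (cases "x \<in> core")
    case False
    then obtain z where z: "x = i z" "z \<in> topspace M" using not_core_iff \<open>x \<in> topspace N\<close> by blast
    have "openin M (preim V)" unfolding preim_def using openin_continuous_map_preimage[OF cont_i V(1)] .
    moreover have "z \<in> preim V" using z V by (simp add: preim_def)
    ultimately obtain U where "openin M U" "connectedin M U" "z \<in> U" "U \<subseteq> preim V"
      using locally_connected_M unfolding locally_connected_space by blast
    then show ?thesis using openin_i connectedin_i z by (intro exI[of _ "i ` U"]) (auto simp: preim_def)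
  next
    case True
    let ?E = "top_of_set ((UNIV :: real set) \<times> coords m)"
    obtain z where z: "x = e z" "z \<in> UNIV \<times> coords m" using True by (auto simp: core_def)
    have "locally_connected_space ?E"
      unfolding prod_Euclidean_space_eq_top_of_set[symmetric]
      by (simp add: locally_connected_space_prod_topology locally_connected_space_euclideanreal
          locally_path_connected_Euclidean_space locally_path_connected_imp_locally_connected_space)
    moreover have "openin ?E {z \<in> topspace ?E. e z \<in> V}"
      using openin_continuous_map_preimage[OF cont_e V(1)] .
    moreover have "z \<in> {z \<in> topspace ?E. e z \<in> V}" using z V by simp
    ultimately obtain U where U: "openin ?E U" "connectedin ?E U" "z \<in> U" "U \<subseteq> {z \<in> topspace ?E. e z \<in> V}"
      unfolding locally_connected_space by meson
    have "openin N (e ` U)" using U(1) open_e by (simp add: open_map_def)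
    moreover have "connectedin N (e ` U)" using connectedin_continuous_map_image[OF cont_e U(2)] .
    ultimately show ?thesis using U z by (intro exI[of _ "e ` U"]) auto
  qed
qed

text \<open>Separating a point of \<open>M\<close> from a core point is where properness of the
  tubes matters: a compact neighbourhood of the former misses a slab around the core.\<close>

lemma Hausdorff_N: "Hausdorff_space N"
proof -
  have mixed: "\<exists>U V. openin N U \<and> openin N V \<and> x \<in> U \<and> y \<in> V \<and> disjnt U V"
    if x: "x \<in> i ` topspace M" and y: "y \<in> core" for x y
  proof -
    obtain z where z: "x = i z" "z \<in> topspace M" using x by blast
    then obtain U K where UK: "openin M U" "compactin M K" "z \<in> U" "U \<subseteq> K"
      using locally_compact_M unfolding locally_compact_space_def by blast
    obtain \<epsilon> where e: "\<epsilon> > 0" "e ` ({-\<epsilon><..<\<epsilon>} \<times> coords m) \<inter> i ` K = {}"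
      by (rule avoid_slab[OF UK(2)]) (rule that; assumption)
    have "y \<in> e ` ({-\<epsilon><..<\<epsilon>} \<times> coords m)" using y e(1) by (auto simp: core_def)
    moreover have "disjnt (i ` U) (e ` ({-\<epsilon><..<\<epsilon>} \<times> coords m))" using e(2) UK(4) by (auto simp: disjnt_def)
    ultimately show ?thesis using openin_i[OF UK(1)] openin_slab UK(3) z(1) by blast
  qed
  show ?thesis
    unfolding Hausdorff_space_def
  proof (intro allI impI, elim conjE)
    fix x y assume xy: "x \<in> topspace N" "y \<in> topspace N" "x \<noteq> y"
    consider "x \<in> i ` topspace M" "y \<in> i ` topspace M" | "x \<in> i ` topspace M" "y \<in> core"
      | "x \<in> core" "y \<in> i ` topspace M" | "x \<in> core" "y \<in> core"
      using xy not_core_iff by blast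
    then show "\<exists>U V. openin N U \<and> openin N V \<and> x \<in> U \<and> y \<in> V \<and> disjnt U V"
    proof cases
      case 1
      then obtain a b where ab: "x = i a" "y = i b" "a \<in> topspace M" "b \<in> topspace M" by blast
      then obtain U V where "openin M U" "openin M V" "a \<in> U" "b \<in> V" "disjnt U V"
        using Hausdorff_M xy(3) unfolding Hausdorff_space_def by metis
      moreover then have "disjnt (i ` U) (i ` V)"
        unfolding disjnt_def by (subst i_image_Int) (auto dest: openin_subset)
      ultimately show ?thesis using openin_i ab by blast
    next
      case 2 then show ?thesis by (rule mixed)
    next
      case 3 then show ?thesis using mixed[of y x] by (metis disjnt_sym)
    next
      case 4
      then obtain a b where ab: "x = e (0, a)" "y = e (0, b)" "a \<in> coords m" "b \<in> coords m"
        by (auto simp: core_def)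
      then have "a \<noteq> b" using xy(3) by blast
      then obtain j where j: "a j \<noteq> b j" by blast
      define c where "c = (a j + b j) / 2"
      have sep: "\<exists>U V. openin N U \<and> openin N V \<and> e (0, a) \<in> U \<and> e (0, b) \<in> V \<and> disjnt U V"
        if "a j < b j" "a \<in> coords m" "b \<in> coords m" for a b :: "nat \<Rightarrow> real"
      proof -
        define c where "c = (a j + b j) / 2"
        let ?U = "{z::real \<times> (nat \<Rightarrow> real). snd z j < c}" and ?V = "{z::real \<times> (nat \<Rightarrow> real). c < snd z j}"
        have "continuous_on UNIV (\<lambda>z::real \<times> (nat \<Rightarrow> real). snd z j)"
          by (rule continuous_on_compose2[OF continuous_on_product_coordinates]) (auto intro: continuous_intros)
        then have "open ?U" "open ?V" by (auto intro!: open_Collect_less continuous_intros)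
        then have "openin N (e ` (?U \<inter> UNIV \<times> coords m))" "openin N (e ` (?V \<inter> UNIV \<times> coords m))"
          using openin_e[of ?U] openin_e[of ?V] by auto
        moreover have "disjnt (e ` (?U \<inter> UNIV \<times> coords m)) (e ` (?V \<inter> UNIV \<times> coords m))"
          unfolding disjnt_def using inj_e by (subst inj_on_image_Int[OF inj_e, symmetric]) auto
        moreover have "e (0, a) \<in> e ` (?U \<inter> UNIV \<times> coords m)" "e (0, b) \<in> e ` (?V \<inter> UNIV \<times> coords m)"
          using that by (auto simp: c_def)
        ultimately show ?thesis by blast
      qed
      show ?thesis
      proof (cases "a j < b j")
        case True then show ?thesis using sep ab by blast
      next
        case False then have "b j < a j" using j by simp
        then show ?thesis using sep[of b a] ab by (metis disjnt_sym)
      qed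
    qed
  qed
qed

lemma closedin_compact: "compactin N L \<Longrightarrow> closedin N L"
  using compactin_imp_closedin Hausdorff_N by blast

lemma compact_core_bounded:
  assumes "compactin N L"
  obtains s where "s > 0" "\<And>y. y \<in> coords m \<Longrightarrow> e (0, y) \<in> L \<Longrightarrow> y \<in> open_cube m s"
proof -
  \<comment> \<open>An increasing open cover, so that a finite subcover is contained in a single
    member.\<close>
  define U where "U n = i ` topspace M \<union> e ` ({-1<..<1} \<times> open_cube m (real n))" for n :: nat
  have mono: "U a \<subseteq> U b" if "a \<le> b" for a b
    unfolding U_def using open_cube_mono[of "real a" "real b" m] that by (intro Un_mono image_mono Sigma_mono) auto
  have cover: "L \<subseteq> \<Union>(range U)"
  proof
    fix x assume "x \<in> L"
    then have x: "x \<in> topspace N" using assms compactin_subset_topspace by blast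
    show "x \<in> \<Union>(range U)"
    proof (cases "x \<in> core")
      case False
      then show ?thesis using x not_core_iff by (auto simp: U_def)
    next
      case True
      then obtain y where y: "y \<in> coords m" "x = e (0, y)" by (auto simp: core_def)
      obtain n :: nat where n: "(\<Sum>j<m. \<bar>y j\<bar>) < real n" using reals_Archimedean2 by blast
      have "\<bar>y j\<bar> \<le> (\<Sum>j<m. \<bar>y j\<bar>)" if "j < m" for j
        by (rule member_le_sum) (use that in auto)
      then have "y \<in> open_cube m (real n)" using y n by (fastforce simp: open_cube_def)
      then have "e (0, y) \<in> e ` ({-1<..<1} \<times> open_cube m (real n))" by (intro imageI) auto
      then have "x \<in> U n" using y by (simp only: U_def) blast
      then show ?thesis by blast
    qed
  qed
  have "openin N (U n)" for n unfolding U_def by (intro openin_Un openin_i_topspace openin_box)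
  then have "\<exists>\<F>. finite \<F> \<and> \<F> \<subseteq> range U \<and> L \<subseteq> \<Union>\<F>"
    by (intro compactinD[OF assms _ cover]) auto
  then obtain \<F> where F: "finite \<F>" "\<F> \<subseteq> range U" "L \<subseteq> \<Union>\<F>"
    by blast
  obtain A where A: "finite A" "\<F> = U ` A" using finite_subset_image[OF F(1,2)] by blast
  have n: "a \<le> Max A" if "a \<in> A" for a using A(1) that by simp
  define n where "n = Max A"
  note n = n[folded n_def]
  \<comment> \<open>\<open>Suc n\<close> keeps the bound positive even when the maximum is 0. For
    empty \<open>A\<close> any bound works.\<close>
  have "\<Union>\<F> \<subseteq> U (Suc n)" unfolding A(2)
  proof (rule UN_least)
    fix a assume "a \<in> A" then show "U a \<subseteq> U (Suc n)" using n[of a] by (intro mono) simp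
  qed
  then have LU: "L \<subseteq> U (Suc n)" using F(3) by (rule order_trans[rotated])
  show thesis
  proof
    show "real (Suc n) > 0" by simp
    fix y assume y: "y \<in> coords m" "e (0, y) \<in> L"
    then have "e (0, y) \<in> e ` ({-1<..<1} \<times> open_cube m (real (Suc n)))"
      using LU e_in_core[OF y(1), of 0] i_image_eq unfolding U_def by blast
    then show "y \<in> open_cube m (real (Suc n))"
      using e_in_image[OF y(1), of "{-1<..<1} \<times> open_cube m (real (Suc n))"] by (auto simp: open_cube_def)
  qed
qed

text \<open>The part of \<open>L\<close> outside an open box over \<open>open_cube m s\<close>
  misses the core, hence is a compact subset of \<open>M\<close> and misses a slab. In this way a
  bound that holds on the core persists nearby.\<close>

lemma compact_slab_bounded:
  assumes L: "compactin N L" and s: "\<And>y. y \<in> coords m \<Longrightarrow> e (0, y) \<in> L \<Longrightarrow> y \<in> open_cube m s"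
  obtains \<delta> where "\<delta> > 0" "\<And>t y. \<bar>t\<bar> < \<delta> \<Longrightarrow> y \<in> coords m \<Longrightarrow> e (t, y) \<in> L \<Longrightarrow> y \<in> open_cube m s"
proof -
  let ?B = "e ` ({-1<..<1} \<times> open_cube m s)"
  have "closedin N (topspace N - ?B)" using openin_box by blast
  moreover have "L - ?B = L \<inter> (topspace N - ?B)" using L compactin_subset_topspace by blast
  ultimately have c: "compactin N (L - ?B)" using L compact_Int_closedin by metis
  have sub: "L - ?B \<subseteq> i ` topspace M"
  proof
    fix x assume x: "x \<in> L - ?B"
    then have "x \<in> topspace N" using L compactin_subset_topspace by blast
    moreover have "x \<notin> core" using x s by (auto simp: core_def)
    ultimately show "x \<in> i ` topspace M" using not_core_iff by blast
  qed
  obtain \<epsilon> where e: "\<epsilon> > 0" "e ` ({-\<epsilon><..<\<epsilon>} \<times> coords m) \<inter> i ` preim (L - ?B) = {}"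
    by (rule avoid_slab[OF compactin_preim[OF sub c]]) (rule that; assumption)
  show thesis
  proof
    show "min \<epsilon> 1 > 0" using e by simp
    fix t y assume ty: "\<bar>t\<bar> < min \<epsilon> 1" "y \<in> coords m" "e (t, y) \<in> L"
    then have "e (t, y) \<in> e ` ({-\<epsilon><..<\<epsilon>} \<times> coords m)" by (intro imageI) auto
    moreover have "e ` ({-\<epsilon><..<\<epsilon>} \<times> coords m) \<inter> (L - ?B) = {}" using e(2) unfolding i_preim[OF sub] .
    ultimately have "e (t, y) \<notin> L - ?B" by (simp only: disjoint_iff not_False_eq_True)
    then have "e (t, y) \<in> ?B" using ty(3) by simp
    then show "y \<in> open_cube m s"
      using e_in_image[OF ty(2), of "{-1<..<1} \<times> open_cube m s"] by (auto simp: open_cube_def)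
  qed
qed

end

lemma openin_minus_component:
  assumes "locally_connected_space X" "openin X W" "C \<in> connected_components_of (subtopology X W)"
  shows "openin X (W - C)"
proof -
  let ?X = "subtopology X W"
  have "topspace ?X - C = \<Union>(connected_components_of ?X - {C})"
    by (rule complement_connected_components_of_Union[OF assms(3)])
  moreover have "openin X (\<Union>(connected_components_of ?X - {C}))"
    using assms(1,2) unfolding locally_connected_space_open_connected_components by blast
  ultimately show ?thesis using openin_subset[OF assms(2)] by (simp add: Int_absorb1)
qed

lemma openin_minus_end:
  assumes "locally_connected_space X" "Hausdorff_space X" "\<epsilon> \<in> ends X" "compactin X K"
  shows "openin X (topspace X - K - \<epsilon> K)"
  using compactin_imp_closedin[OF assms(2,4)] openin_minus_component[OF assms(1) _ end_component[OF assms(3,4)]]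
  by blast

section \<open>Ends of \<open>N\<close> compared with ends of \<open>M\<close>\<close>

context handle_at_infinity
begin

lemma end_M_subset: "\<beta> \<in> ends M \<Longrightarrow> compactin M K \<Longrightarrow> \<beta> K \<subseteq> topspace M"
  using end_subset by blast

lemma connectedin_slab: "connectedin N (e ` ({a<..<b} \<times> coords m))"
  by (rule connectedin_e[OF connected_interval_times_coords]) auto

text \<open>A slab around the core meets the images of both \<eta> K and \<eta>' K, so the three
  together are connected. Their union is open, and so is the rest of the complement of the image of
  \<open>K\<close>; hence the union is a whole component.\<close>

lemma core_subset_end:
  assumes \<alpha>: "\<alpha> \<in> ends N" and K: "compactin M K"
    and meet: "\<alpha> (i ` K) \<inter> (core \<union> i ` \<eta> K \<union> i ` \<eta>' K) \<noteq> {}"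
  shows "core \<subseteq> \<alpha> (i ` K)" and "\<alpha> (i ` K) \<subseteq> core \<union> i ` \<eta> K \<union> i ` \<eta>' K"
proof -
  obtain \<epsilon> where e: "\<epsilon> > 0" "e ` ({-\<epsilon><..<\<epsilon>} \<times> coords m) \<inter> i ` K = {}"
    "e ` ({0<..<\<epsilon>} \<times> coords m) \<subseteq> i ` \<eta> K" "e ` ({-\<epsilon><..<0} \<times> coords m) \<subseteq> i ` \<eta>' K"
    using K by (rule avoid_slab)
  let ?S = "e ` ({-\<epsilon><..<\<epsilon>} \<times> coords m)"
  let ?C = "core \<union> i ` \<eta> K \<union> i ` \<eta>' K"
  have cK: "compactin N (i ` K)" using compactin_i[OF K] .
  have KM: "K \<subseteq> topspace M" using K compactin_subset_topspace by blast
  have cS: "connectedin N ?S" by (rule connectedin_slab)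
  have coreS: "core \<subseteq> ?S" unfolding core_def using e(1) by (intro image_mono) auto
  have c\<eta>: "connectedin N (i ` \<eta> K)" "connectedin N (i ` \<eta>' K)"
    using end_connected[OF \<eta> K] end_connected[OF \<eta>' K] connectedin_i by auto
  have disj: "i ` \<eta> K \<inter> i ` K = {}" "i ` \<eta>' K \<inter> i ` K = {}"
    using end_subset[OF \<eta> K] end_subset[OF \<eta>' K] KM by (subst i_image_Int; auto)+
  have m1: "e (\<epsilon> / 2, \<lambda>_. 0) \<in> ?S \<inter> i ` \<eta> K"
  proof -
    have "e (\<epsilon> / 2, \<lambda>_. 0) \<in> e ` ({0<..<\<epsilon>} \<times> coords m)" using e(1) by (intro imageI) auto
    moreover have "e (\<epsilon> / 2, \<lambda>_. 0) \<in> ?S" using e(1) by (intro imageI) auto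
    ultimately show ?thesis using e(3) by blast
  qed
  have m2: "e (- \<epsilon> / 2, \<lambda>_. 0) \<in> ?S \<inter> i ` \<eta>' K"
  proof -
    have "e (- \<epsilon> / 2, \<lambda>_. 0) \<in> e ` ({-\<epsilon><..<0} \<times> coords m)" using e(1) by (intro imageI) auto
    moreover have "e (- \<epsilon> / 2, \<lambda>_. 0) \<in> ?S" using e(1) by (intro imageI) auto
    ultimately show ?thesis using e(4) by blast
  qed
  have "connectedin N (?S \<union> i ` \<eta> K)" by (rule connectedin_Un[OF cS c\<eta>(1)]) (use m1 in blast)
  then have cC: "connectedin N (?S \<union> i ` \<eta> K \<union> i ` \<eta>' K)"
    by (rule connectedin_Un[OF _ c\<eta>(2)]) (use m2 in blast)
  have sub: "?S \<union> i ` \<eta> K \<union> i ` \<eta>' K \<subseteq> \<alpha> (i ` K)"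
  proof (rule end_maximal[OF \<alpha> cK cC])
    show "(?S \<union> i ` \<eta> K \<union> i ` \<eta>' K) \<inter> i ` K = {}" using e(2) disj by blast
    show "(?S \<union> i ` \<eta> K \<union> i ` \<eta>' K) \<inter> \<alpha> (i ` K) \<noteq> {}" using meet coreS by blast
  qed
  then show "core \<subseteq> \<alpha> (i ` K)" using coreS by blast
  have S: "?S \<subseteq> ?C"
  proof
    fix x assume "x \<in> ?S"
    then obtain t y where ty: "x = e (t, y)" "-\<epsilon> < t" "t < \<epsilon>" "y \<in> coords m" by auto
    consider "t = 0" | "t > 0" | "t < 0" by linarith
    then show "x \<in> ?C"
    proof cases
      case 1 then show ?thesis using ty e_in_core by simp
    next
      case 2 then have "x \<in> e ` ({0<..<\<epsilon>} \<times> coords m)" using ty by auto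
      then show ?thesis using e(3) by blast
    next
      case 3 then have "x \<in> e ` ({-\<epsilon><..<0} \<times> coords m)" using ty by auto
      then show ?thesis using e(4) by blast
    qed
  qed
  have Ceq: "?C = ?S \<union> i ` \<eta> K \<union> i ` \<eta>' K" using S coreS by blast
  have opC: "openin N ?C"
    unfolding Ceq using openin_slab openin_i openin_end[OF locally_connected_M Hausdorff_M _ K] \<eta> \<eta>' by blast
  let ?R = "i ` ((topspace M - K - \<eta> K) \<inter> (topspace M - K - \<eta>' K))"
  have opR: "openin N ?R"
    using openin_i openin_minus_end[OF locally_connected_M Hausdorff_M _ K] \<eta> \<eta>' by blast
  have cover: "\<alpha> (i ` K) \<subseteq> ?C \<union> ?R"
  proof
    fix x assume x: "x \<in> \<alpha> (i ` K)"
    then have x': "x \<in> topspace N" "x \<notin> i ` K" using end_subset[OF \<alpha> cK] by auto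
    show "x \<in> ?C \<union> ?R"
    proof (cases "x \<in> core")
      case False
      then obtain z where "x = i z" "z \<in> topspace M" using x'(1) not_core_iff by blast
      then show ?thesis using x'(2) by blast
    qed blast
  qed
  have "?C \<inter> ?R = {}"
  proof -
    have "core \<inter> ?R = {}" using i_image_eq by blast
    moreover have "i ` \<eta> K \<inter> ?R = {}" "i ` \<eta>' K \<inter> ?R = {}"
      using end_M_subset[OF \<eta> K] end_M_subset[OF \<eta>' K] by (subst i_image_Int; auto)+
    ultimately show ?thesis by blast
  qed
  then have dis: "?C \<inter> ?R \<inter> \<alpha> (i ` K) = {}" by blast
  have "?C \<inter> \<alpha> (i ` K) \<noteq> {}" using meet by blast
  then have "?R \<inter> \<alpha> (i ` K) = {}"
    using connectedinD[OF end_connected[OF \<alpha> cK] opC opR cover dis] by blast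
  then show "\<alpha> (i ` K) \<subseteq> ?C" using cover by blast
qed

text \<open>The set \<open>B\<close> trades the part of \<open>L\<close> near the core for two faces
  of a box \<open>S\<close>, so that it lies in \<open>M\<close>. Suppose that the component
  \<open>D\<close> of the complement of \<open>L \<union> S\<close> met no core point outside the
  cube. Then \<open>D\<close> would be open and closed in \<alpha> B, since a point of
  \<open>D\<close> in the slab could be slid along the handle to the core. But the centre of the box
  belongs to \<alpha> B and not to \<open>D\<close>.\<close>

lemma extraordinary_meets_core:
  assumes L: "compactin N L" and s: "s > 0" "\<And>y. y \<in> coords m \<Longrightarrow> e (0, y) \<in> L \<Longrightarrow> y \<in> open_cube m s"
  obtains K where "compactin M K"
    "\<And>\<alpha>. \<alpha> \<in> ends N \<Longrightarrow> \<alpha> (i ` K) \<inter> core \<noteq> {} \<Longrightarrow> \<exists>y\<in>coords m - cube m s. e (0, y) \<in> \<alpha> L"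
proof -
  obtain \<delta> where \<delta>: "\<delta> > 0" "\<And>t y. \<bar>t\<bar> < \<delta> \<Longrightarrow> y \<in> coords m \<Longrightarrow> e (t, y) \<in> L \<Longrightarrow> y \<in> open_cube m s"
    using compact_slab_bounded[OF L s(2)] by blast
  define d where "d = \<delta> / 2"
  have d: "d > 0" "d < \<delta>" using \<delta>(1) by (auto simp: d_def)
  define S where "S = e ` ({-d..d} \<times> cube m s)"
  define S0 where "S0 = e ` ({-d<..<d} \<times> open_cube m s)"
  \<comment> \<open>With these faces in \<open>B\<close>, each point of the box that is not in
    \<open>B\<close> lies strictly inside the slab, which can then serve as its
    neighbourhood.\<close>
  define F where "F = e ` ({d, -d} \<times> cube m s)"
  define B where "B = (L - S0) \<union> F"
  have cube_sub: "cube m s \<subseteq> coords m" "open_cube m s \<subseteq> coords m" by (auto simp: cube_eq open_cube_def)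
  have cS: "compactin N S" unfolding S_def by (rule compactin_box)
  have cF: "compactin N F" unfolding F_def
    by (rule compactin_e) (use cube_sub in \<open>auto intro!: compact_Times compact_cube\<close>)
  have opS0: "openin N S0" unfolding S0_def by (rule openin_box)
  have cLS: "compactin N (L - S0)"
  proof -
    have "closedin N (topspace N - S0)" using opS0 by blast
    moreover have "L - S0 = L \<inter> (topspace N - S0)" using L compactin_subset_topspace by blast
    ultimately show ?thesis using L compact_Int_closedin by metis
  qed
  have cB: "compactin N B" unfolding B_def using cLS cF by (rule compactin_Un)
  have FS: "F \<subseteq> S" unfolding F_def S_def using d by (intro image_mono) auto
  have BLS: "B \<subseteq> L \<union> S" using FS by (auto simp: B_def)
  have B0: "B \<inter> core = {}"
  proof -
    have "e (0, y) \<notin> B" if y: "y \<in> coords m" for y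
    proof -
      have "e (0, y) \<in> S0" if "e (0, y) \<in> L"
        unfolding S0_def using s(2)[OF y that] d by (intro imageI) auto
      moreover have "e (0, y) \<notin> F"
        unfolding F_def using e_in_image[OF y, of "{d, -d} \<times> cube m s" 0] cube_sub d by auto
      ultimately show ?thesis by (auto simp: B_def)
    qed
    then show ?thesis by (auto simp: core_def)
  qed
  have BM: "B \<subseteq> i ` topspace M" using B0 compactin_subset_topspace[OF cB] i_image_eq by blast
  have iB: "i ` preim B = B" by (rule i_preim[OF BM])
  show thesis
  proof (rule that)
    show cK: "compactin M (preim B)" by (rule compactin_preim[OF BM cB])
    fix \<alpha> assume \<alpha>: "\<alpha> \<in> ends N" and meet: "\<alpha> (i ` preim B) \<inter> core \<noteq> {}"
    show "\<exists>y\<in>coords m - cube m s. e (0, y) \<in> \<alpha> L"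
    proof (rule ccontr)
      assume contra: "\<not> ?thesis"
      have coreD: "core \<subseteq> \<alpha> B" using core_subset_end(1)[OF \<alpha> cK] meet iB by auto
      have cLS: "compactin N (L \<union> S)" using L cS by (rule compactin_Un)
      define D where "D = \<alpha> (L \<union> S)"
      have DL: "D \<subseteq> \<alpha> L" "D \<subseteq> \<alpha> B"
        unfolding D_def using end_mono[OF \<alpha> _ cLS] L cB BLS by auto
      have Ddis: "D \<inter> (L \<union> S) = {}" unfolding D_def using end_subset[OF \<alpha> cLS] by blast
      have opD: "openin N D" unfolding D_def by (rule openin_end[OF locally_connected_N Hausdorff_N \<alpha> cLS])
      have opE: "openin N (topspace N - (L \<union> S) - D)" unfolding D_def
        by (rule openin_minus_end[OF locally_connected_N Hausdorff_N \<alpha> cLS])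
      \<comment> \<open>This says that \<open>D\<close> is closed in \<alpha> B.\<close>
      have nbhd: "\<exists>U. openin N U \<and> q \<in> U \<and> U \<inter> D = {}" if q: "q \<in> \<alpha> B - D" for q
      proof (cases "q \<in> L \<union> S")
        case False
        have "q \<in> topspace N" using q end_subset[OF \<alpha> cB] by blast
        then show ?thesis using opE q False by (intro exI[of _ "topspace N - (L \<union> S) - D"]) auto
      next
        case True
        have "q \<notin> B" using q end_subset[OF \<alpha> cB] by blast
        let ?U = "e ` ({-d<..<d} \<times> coords m)"
        have "q \<in> ?U"
        proof (cases "q \<in> L")
          case True
          then have "q \<in> S0" using \<open>q \<notin> B\<close> by (simp add: B_def)
          then show ?thesis unfolding S0_def using cube_sub by blast
        next
          case False
          then have "q \<in> S" using True by simp
          then obtain t y where ty: "q = e (t, y)" "-d \<le> t" "t \<le> d" "y \<in> cube m s" by (auto simp: S_def)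
          have "t \<noteq> d \<and> t \<noteq> -d"
            using \<open>q \<notin> B\<close> ty by (auto simp: B_def F_def)
          then show ?thesis using ty cube_sub by (intro image_eqI[of _ _ "(t, y)"]) auto
        qed
        moreover have "?U \<inter> D = {}"
        proof (rule ccontr)
          assume "?U \<inter> D \<noteq> {}"
          then obtain t y where ty: "-d < t" "t < d" "y \<in> coords m" "e (t, y) \<in> D" by auto
          have "y \<notin> cube m s"
          proof
            assume "y \<in> cube m s"
            then have "e (t, y) \<in> S" unfolding S_def using ty by (intro imageI) auto
            then show False using Ddis ty by blast
          qed
          \<comment> \<open>The sliding line at height \<open>y\<close>. It misses \<open>L\<close>
            by the choice of \<delta> and misses the box because \<open>y\<close> lies outside the
            cube, so it stays in \<open>D\<close> and carries a forbidden core point into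
            it.\<close>
          let ?l = "e ` ({-d<..<d} \<times> {y})"
          have "connectedin N ?l" by (rule connectedin_e[OF connected_line]) (use ty in auto)
          moreover have "?l \<inter> (L \<union> S) = {}"
          proof -
            have "e (u, y) \<notin> L \<union> S" if "-d < u" "u < d" for u
            proof -
              have "\<bar>u\<bar> < \<delta>" using that d by linarith
              then have "e (u, y) \<notin> L"
                using \<delta>(2)[of u y] that d ty \<open>y \<notin> cube m s\<close> open_cube_subset_cube[of m s] by auto
              moreover have "e (u, y) \<notin> S"
                unfolding S_def using e_in_image[OF ty(3), of "{-d..d} \<times> cube m s"] cube_sub \<open>y \<notin> cube m s\<close> by auto
              ultimately show ?thesis by blast
            qed
            note off = this
            have "x \<notin> L \<union> S" if "x \<in> ?l" for x
            proof -
              obtain z where z: "x = e z" "z \<in> {-d<..<d} \<times> {y}" using \<open>x \<in> ?l\<close> by (rule imageE)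
              then show ?thesis using off[of "fst z"] by (cases z) simp
            qed
            then show ?thesis unfolding disjoint_iff by iprover
          qed
          moreover have "?l \<inter> D \<noteq> {}"
          proof -
            have "e (t, y) \<in> ?l" using ty by (intro imageI) auto
            then have "e (t, y) \<in> ?l \<inter> D" using ty(4) by (rule IntI)
            then show ?thesis by (metis empty_iff)
          qed
          ultimately have "?l \<subseteq> D" unfolding D_def by (rule end_maximal[OF \<alpha> cLS])
          moreover have "e (0, y) \<in> ?l" using d by (intro imageI) auto
          ultimately show False using contra DL \<open>y \<notin> cube m s\<close> ty(3) by blast
        qed
        ultimately show ?thesis using openin_slab by blast
      qed
      define V where "V = \<Union>{U. openin N U \<and> U \<inter> D = {}}"
      have opV: "openin N V" unfolding V_def by blast
      have "\<alpha> B \<subseteq> D \<union> V" using nbhd unfolding V_def by blast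
      moreover have "D \<inter> V \<inter> \<alpha> B = {}" unfolding V_def by blast
      moreover have "D \<inter> \<alpha> B \<noteq> {}" using DL end_nonempty[OF \<alpha> cLS] by (auto simp: D_def)
      moreover have "V \<inter> \<alpha> B \<noteq> {}"
      proof -
        have z: "e (0, \<lambda>_. 0) \<in> core" using e_in_core[of "\<lambda>_. 0" 0] by simp
        moreover have "e (0, \<lambda>_. 0) \<in> S"
          unfolding S_def using zero_in_cube[of s m] s(1) d by (intro imageI) auto
        ultimately have "e (0, \<lambda>_. 0) \<in> \<alpha> B - D" using coreD Ddis by blast
        then show ?thesis using nbhd unfolding V_def by blast
      qed
      ultimately show False using connectedinD[OF end_connected[OF \<alpha> cB] opD opV] by blast
    qed
  qed
qed

text \<open>A neighbourhood of \<alpha> inside \<open>M\<close> may come from a compact set that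
  meets the core. By \<open>extraordinary_meets_core\<close> a compact subset of \<open>M\<close>
  does the same.\<close>

lemma ordinary_iff:
  assumes \<alpha>: "\<alpha> \<in> ends N"
  shows "ordinary_end M N i \<alpha> \<longleftrightarrow> (\<exists>K. compactin M K \<and> \<alpha> (i ` K) \<inter> core = {})"
proof
  assume "ordinary_end M N i \<alpha>"
  then obtain L where L: "compactin N L" "\<alpha> L \<subseteq> i ` topspace M"
    unfolding ordinary_end_def end_neighborhood_def by blast
  obtain s where s: "s > 0" "\<And>y. y \<in> coords m \<Longrightarrow> e (0, y) \<in> L \<Longrightarrow> y \<in> open_cube m s"
    using compact_core_bounded[OF L(1)] by blast
  obtain K where K: "compactin M K"
    "\<And>\<alpha>. \<alpha> \<in> ends N \<Longrightarrow> \<alpha> (i ` K) \<inter> core \<noteq> {} \<Longrightarrow> \<exists>y\<in>coords m - cube m s. e (0, y) \<in> \<alpha> L"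
    using extraordinary_meets_core[OF L(1) s] by blast
  have "\<alpha> (i ` K) \<inter> core = {}"
  proof (rule ccontr)
    assume "\<not> ?thesis"
    then obtain y where "y \<in> coords m" "e (0, y) \<in> \<alpha> L" using K(2)[OF \<alpha>] by blast
    then show False using L(2) e_in_core[of y 0] i_image_eq by blast
  qed
  then show "\<exists>K. compactin M K \<and> \<alpha> (i ` K) \<inter> core = {}" using K(1) by blast
next
  assume "\<exists>K. compactin M K \<and> \<alpha> (i ` K) \<inter> core = {}"
  then obtain K where K: "compactin M K" "\<alpha> (i ` K) \<inter> core = {}" by blast
  have "\<alpha> (i ` K) \<subseteq> topspace N" using end_subset[OF \<alpha> compactin_i[OF K(1)]] by blast
  then have "\<alpha> (i ` K) \<subseteq> i ` topspace M" using K(2) i_image_eq by blast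
  then show "ordinary_end M N i \<alpha>" unfolding ordinary_end_def end_neighborhood_def
    using compactin_i[OF K(1)] \<open>\<alpha> (i ` K) \<subseteq> topspace N\<close> by blast
qed

lemma ordinary_end_exists:
  assumes \<alpha>: "\<alpha> \<in> ends N" and K0: "compactin M K0" "\<alpha> (i ` K0) \<inter> core = {}"
  obtains \<beta> where "\<beta> \<in> ends M" "\<And>K. compactin M K \<Longrightarrow> i ` \<beta> K \<subseteq> \<alpha> (i ` K)"
    "\<And>K. compactin M K \<Longrightarrow> K0 \<subseteq> K \<Longrightarrow> i ` \<beta> K = \<alpha> (i ` K)"
proof -
  \<comment> \<open>Enlarging \<open>K\<close> by \<open>K0\<close> keeps the component of \<alpha>
    off the core, so that it can be pulled back to \<open>M\<close>.\<close>
  define S where "S K = preim (\<alpha> (i ` (K \<union> K0)))" for K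
  have cU: "compactin M (K \<union> K0)" if "compactin M K" for K using that K0(1) by (rule compactin_Un)
  have sub: "\<alpha> (i ` (K \<union> K0)) \<subseteq> i ` topspace M" if "compactin M K" for K
  proof -
    have "\<alpha> (i ` (K \<union> K0)) \<subseteq> \<alpha> (i ` K0)"
      by (rule end_mono[OF \<alpha> compactin_i[OF K0(1)] compactin_i[OF cU[OF that]]]) auto
    then show ?thesis using K0(2) end_subset[OF \<alpha> compactin_i[OF K0(1)]] i_image_eq by blast
  qed
  have iS: "i ` S K = \<alpha> (i ` (K \<union> K0))" if "compactin M K" for K
    unfolding S_def by (rule i_preim[OF sub[OF that]])
  have ne: "S K \<noteq> {}" if "compactin M K" for K
    using iS[OF that] end_nonempty[OF \<alpha> compactin_i[OF cU[OF that]]] by auto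
  obtain \<beta> where \<beta>: "\<beta> \<in> ends M" "\<And>K. compactin M K \<Longrightarrow> S K \<subseteq> \<beta> K"
  proof (rule end_exists[of M S])
    show "connectedin M (S K) \<and> S K \<noteq> {} \<and> S K \<inter> K = {}" if K: "compactin M K" for K
    proof (intro conjI)
      show "connectedin M (S K)" unfolding S_def
        by (rule connectedin_preim[OF sub[OF K] end_connected[OF \<alpha> compactin_i[OF cU[OF K]]]])
      show "S K \<noteq> {}" by (rule ne[OF K])
      show "S K \<inter> K = {}"
        using end_subset[OF \<alpha> compactin_i[OF cU[OF K]]] by (auto simp: S_def preim_def)
    qed
    show "S K \<inter> S K' \<noteq> {}" if K: "compactin M K" "compactin M K'" "K \<subseteq> K'" for K K'
    proof -
      have "\<alpha> (i ` (K' \<union> K0)) \<subseteq> \<alpha> (i ` (K \<union> K0))"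
        by (rule end_mono[OF \<alpha> compactin_i[OF cU[OF K(1)]] compactin_i[OF cU[OF K(2)]]]) (use K(3) in auto)
      then have "S K' \<subseteq> S K" unfolding S_def by (rule preim_mono)
      then show ?thesis using ne[OF K(2)] by blast
    qed
  qed (use that in blast)
  have incl: "i ` \<beta> K \<subseteq> \<alpha> (i ` K)" if K: "compactin M K" for K
  proof (rule end_maximal[OF \<alpha> compactin_i[OF K] connectedin_i[OF end_connected[OF \<beta>(1) K]]])
    show "i ` \<beta> K \<inter> i ` K = {}"
      using end_subset[OF \<beta>(1) K] compactin_subset_topspace[OF K] by (subst i_image_Int) auto
    have "i ` S K \<subseteq> \<alpha> (i ` K)" unfolding iS[OF K]
      by (rule end_mono[OF \<alpha> compactin_i[OF K] compactin_i[OF cU[OF K]]]) auto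
    then show "i ` \<beta> K \<inter> \<alpha> (i ` K) \<noteq> {}" using \<beta>(2)[OF K] ne[OF K] by blast
  qed
  have eq: "i ` \<beta> K = \<alpha> (i ` K)" if K: "compactin M K" "K0 \<subseteq> K" for K
  proof
    show "i ` \<beta> K \<subseteq> \<alpha> (i ` K)" by (rule incl[OF K(1)])
    have "K \<union> K0 = K" using K(2) by blast
    then have "\<alpha> (i ` K) = i ` S K" using iS[OF K(1)] by simp
    then show "\<alpha> (i ` K) \<subseteq> i ` \<beta> K" using \<beta>(2)[OF K(1)] by blast
  qed
  show thesis by (rule that[OF \<beta>(1) incl eq])
qed

text \<open>Past \<open>K0\<close> both ends have their values in the same component, and values at
  large compact sets determine those at smaller ones.\<close>

lemma ordinary_end_unique:
  assumes \<alpha>: "\<alpha> \<in> ends N" and K0: "compactin M K0"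
    and \<beta>: "\<beta> \<in> ends M" "\<And>K. compactin M K \<Longrightarrow> K0 \<subseteq> K \<Longrightarrow> i ` \<beta> K = \<alpha> (i ` K)"
    and \<beta>': "\<beta>' \<in> ends M" "\<And>K. compactin M K \<Longrightarrow> i ` \<beta>' K \<subseteq> \<alpha> (i ` K)"
  shows "\<beta>' = \<beta>"
proof (rule end_eqI[OF \<beta>'(1) \<beta>(1)])
  fix K assume K: "compactin M K"
  have cU: "compactin M (K \<union> K0)" using K K0 by (rule compactin_Un)
  have "i ` \<beta>' (K \<union> K0) \<subseteq> i ` \<beta> (K \<union> K0)" using \<beta>(2)[OF cU] \<beta>'(2)[OF cU] by simp
  then have "\<beta>' (K \<union> K0) \<subseteq> \<beta> (K \<union> K0)"
    by (subst (asm) i_image_subset_iff) (use end_M_subset \<beta>(1) \<beta>'(1) cU in auto)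
  then have "\<beta>' (K \<union> K0) = \<beta> (K \<union> K0)"
    using end_nonempty[OF \<beta>'(1) cU] by (intro end_eq_if_overlap[OF \<beta>'(1) \<beta>(1) cU]) auto
  then show "\<beta>' K = \<beta> K" by (intro end_eq_mono[OF \<beta>'(1) \<beta>(1) K cU]) auto
qed

section \<open>The values of \<open>h\<close> and its continuity\<close>

abbreviation h where "h \<equiv> canonical_end_map M N i \<eta> \<eta>'"

abbreviation R where "R \<equiv> ends_relation M \<eta> \<eta>'"

lemma R_class: "\<beta> \<in> ends M \<Longrightarrow> \<beta> \<noteq> \<eta> \<Longrightarrow> \<beta> \<noteq> \<eta>' \<Longrightarrow> R `` {\<beta>} = {\<beta>}"
  unfolding ends_relation_eq[OF \<eta> \<eta>'] by auto

lemma R_class_\<eta>: "R `` {\<eta>} = {\<eta>, \<eta>'}" "R `` {\<eta>'} = {\<eta>, \<eta>'}"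
  unfolding ends_relation_eq[OF \<eta> \<eta>'] using \<eta> \<eta>' by auto

lemma quotient_R: "ends M // R = insert {\<eta>, \<eta>'} ((\<lambda>\<beta>. {\<beta>}) ` (ends M - {\<eta>, \<eta>'}))"
proof
  show "ends M // R \<subseteq> insert {\<eta>, \<eta>'} ((\<lambda>\<beta>. {\<beta>}) ` (ends M - {\<eta>, \<eta>'}))"
  proof
    fix c assume "c \<in> ends M // R"
    then obtain \<beta> where "\<beta> \<in> ends M" "c = R `` {\<beta>}" by (rule quotientE)
    then show "c \<in> insert {\<eta>, \<eta>'} ((\<lambda>\<beta>. {\<beta>}) ` (ends M - {\<eta>, \<eta>'}))"
      using R_class[of \<beta>] R_class_\<eta> by (cases "\<beta> = \<eta> \<or> \<beta> = \<eta>'") auto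
  qed
  show "insert {\<eta>, \<eta>'} ((\<lambda>\<beta>. {\<beta>}) ` (ends M - {\<eta>, \<eta>'})) \<subseteq> ends M // R"
  proof
    fix c assume "c \<in> insert {\<eta>, \<eta>'} ((\<lambda>\<beta>. {\<beta>}) ` (ends M - {\<eta>, \<eta>'}))"
    then show "c \<in> ends M // R"
      using quotientI[OF \<eta>, of R] R_class_\<eta> R_class quotientI[where r=R and A="ends M"] by fastforce
  qed
qed

text \<open>If \<beta> agreed with \<eta> or \<eta>' at \<open>K0\<close>, the component of \<alpha>
  there would contain the core. So the set that makes \<alpha> ordinary also separates \<beta> from
  \<eta> and \<eta>'.\<close>

lemma h_ordinary:
  assumes \<alpha>: "\<alpha> \<in> ends N" and K0: "compactin M K0" "\<alpha> (i ` K0) \<inter> core = {}"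
  obtains \<beta> where "\<beta> \<in> ends M" "h \<alpha> = {\<beta>}" "\<beta> \<noteq> \<eta>" "\<beta> \<noteq> \<eta>'" "\<beta> K0 \<noteq> \<eta> K0" "\<beta> K0 \<noteq> \<eta>' K0"
    "\<And>K. compactin M K \<Longrightarrow> i ` \<beta> K \<subseteq> \<alpha> (i ` K)"
    "\<And>K. compactin M K \<Longrightarrow> K0 \<subseteq> K \<Longrightarrow> i ` \<beta> K = \<alpha> (i ` K)"
proof -
  obtain \<beta> where \<beta>: "\<beta> \<in> ends M" "\<And>K. compactin M K \<Longrightarrow> i ` \<beta> K \<subseteq> \<alpha> (i ` K)"
    "\<And>K. compactin M K \<Longrightarrow> K0 \<subseteq> K \<Longrightarrow> i ` \<beta> K = \<alpha> (i ` K)"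
    by (rule ordinary_end_exists[OF \<alpha> K0]) (use that in blast)
  have the: "(THE \<beta>. \<beta> \<in> ends M \<and> (\<forall>K. compactin M K \<longrightarrow> i ` \<beta> K \<subseteq> \<alpha> (i ` K))) = \<beta>"
  proof (rule the_equality)
    show "\<beta> \<in> ends M \<and> (\<forall>K. compactin M K \<longrightarrow> i ` \<beta> K \<subseteq> \<alpha> (i ` K))" using \<beta> by blast
    show "\<beta>' = \<beta>" if "\<beta>' \<in> ends M \<and> (\<forall>K. compactin M K \<longrightarrow> i ` \<beta>' K \<subseteq> \<alpha> (i ` K))" for \<beta>'
      by (rule ordinary_end_unique[OF \<alpha> K0(1) \<beta>(1) \<beta>(3)]) (use that in auto)
  qed
  have ne: "\<beta> K0 \<noteq> \<eta> K0" "\<beta> K0 \<noteq> \<eta>' K0"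
  proof -
    have "\<not> core \<subseteq> \<alpha> (i ` K0)" using K0(2) core_nonempty by blast
    then have "\<alpha> (i ` K0) \<inter> (i ` \<eta> K0 \<union> i ` \<eta>' K0) = {}"
      using core_subset_end(1)[OF \<alpha> K0(1)] by blast
    moreover have "i ` \<beta> K0 = \<alpha> (i ` K0)" using \<beta>(3)[OF K0(1)] by simp
    moreover have "\<alpha> (i ` K0) \<noteq> {}" by (rule end_nonempty[OF \<alpha> compactin_i[OF K0(1)]])
    ultimately show "\<beta> K0 \<noteq> \<eta> K0" "\<beta> K0 \<noteq> \<eta>' K0" by auto
  qed
  then have "\<beta> \<noteq> \<eta>" "\<beta> \<noteq> \<eta>'" by auto
  moreover have "ordinary_end M N i \<alpha>" using ordinary_iff[OF \<alpha>] K0 by blast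
  then have "h \<alpha> = {\<beta>}"
    unfolding canonical_end_map_def the using R_class[OF \<beta>(1)] calculation by simp
  ultimately show thesis using that \<beta> ne by blast
qed

lemma h_extraordinary:
  assumes \<alpha>: "\<alpha> \<in> ends N" and "\<And>K. compactin M K \<Longrightarrow> \<alpha> (i ` K) \<inter> core \<noteq> {}"
  shows "h \<alpha> = {\<eta>, \<eta>'}"
proof -
  have "\<not> ordinary_end M N i \<alpha>" using ordinary_iff[OF \<alpha>] assms(2) by blast
  then show ?thesis unfolding canonical_end_map_def using R_class_\<eta> by simp
qed

lemma h_in_quotient: 
  assumes \<alpha>: "\<alpha> \<in> ends N"
  shows "h \<alpha> \<in> ends M // R"
proof (cases "\<exists>K. compactin M K \<and> \<alpha> (i ` K) \<inter> core = {}")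
  case True
  then obtain K where "compactin M K" "\<alpha> (i ` K) \<inter> core = {}" by blast
  then show ?thesis by (rule h_ordinary[OF \<alpha>]) (simp add: quotient_R)
next
  case False
  then show ?thesis using h_extraordinary[OF \<alpha>] quotient_R by blast
qed

lemma continuous_h: "continuous_map (ends_topology N) (ends_quotient M \<eta> \<eta>') h"
  unfolding continuous_map_def topspace_ends_quotient topspace_ends_topology
proof (intro conjI allI impI)
  show "h \<in> ends N \<rightarrow> ends M // R" using h_in_quotient by blast
  fix W assume "openin (ends_quotient M \<eta> \<eta>') W"
  then have W: "W \<subseteq> ends M // R" "\<And>\<beta>. \<beta> \<in> \<Union>W \<Longrightarrow> \<exists>K. compactin M K \<and> basic_end_nbhd M \<beta> K \<subseteq> \<Union>W"
    unfolding openin_ends_quotient openin_ends_topology by auto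
  have single: "{\<beta>} \<in> W" if "\<beta> \<in> \<Union>W" "\<beta> \<noteq> \<eta>" "\<beta> \<noteq> \<eta>'" for \<beta>
    using that W(1) unfolding quotient_R by auto
  show "openin (ends_topology N) {\<alpha> \<in> ends N. h \<alpha> \<in> W}"
    unfolding openin_ends_topology
  proof (intro conjI ballI)
    fix \<alpha> assume "\<alpha> \<in> {\<alpha> \<in> ends N. h \<alpha> \<in> W}"
    then have \<alpha>: "\<alpha> \<in> ends N" "h \<alpha> \<in> W" by auto
    show "\<exists>L. compactin N L \<and> basic_end_nbhd N \<alpha> L \<subseteq> {\<alpha> \<in> ends N. h \<alpha> \<in> W}"
    proof (cases "\<exists>K. compactin M K \<and> \<alpha> (i ` K) \<inter> core = {}")
      case True
      then obtain K0 where K0: "compactin M K0" "\<alpha> (i ` K0) \<inter> core = {}" by blast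
      obtain \<beta> where \<beta>: "\<beta> \<in> ends M" "h \<alpha> = {\<beta>}" 
        "\<And>K. compactin M K \<Longrightarrow> K0 \<subseteq> K \<Longrightarrow> i ` \<beta> K = \<alpha> (i ` K)"
        by (rule h_ordinary[OF \<alpha>(1) K0]) (use that in blast)
      then have "\<beta> \<in> \<Union>W" using \<alpha>(2) by auto
      then obtain K where K: "compactin M K" "basic_end_nbhd M \<beta> K \<subseteq> \<Union>W" using W(2) by blast
      have cU: "compactin M (K \<union> K0)" using K(1) K0(1) by (rule compactin_Un)
      have "h \<alpha>' \<in> W" if a': "\<alpha>' \<in> ends N" "\<alpha>' (i ` (K \<union> K0)) = \<alpha> (i ` (K \<union> K0))" for \<alpha>'
      proof -
        have "\<alpha> (i ` (K \<union> K0)) \<subseteq> \<alpha> (i ` K0)"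
          by (rule end_mono[OF \<alpha>(1) compactin_i[OF K0(1)] compactin_i[OF cU]]) auto
        then have ord: "\<alpha>' (i ` (K \<union> K0)) \<inter> core = {}" using a'(2) K0(2) by auto
        obtain \<beta>' where \<beta>': "\<beta>' \<in> ends M" "h \<alpha>' = {\<beta>'}" "\<beta>' \<noteq> \<eta>" "\<beta>' \<noteq> \<eta>'"
          "\<And>K'. compactin M K' \<Longrightarrow> K \<union> K0 \<subseteq> K' \<Longrightarrow> i ` \<beta>' K' = \<alpha>' (i ` K')"
          by (rule h_ordinary[OF a'(1) cU ord]) (use that in blast)
        have "i ` \<beta>' (K \<union> K0) = i ` \<beta> (K \<union> K0)" using \<beta>'(5)[OF cU] \<beta>(3)[OF cU] a'(2) by simp
        then have "\<beta>' (K \<union> K0) = \<beta> (K \<union> K0)"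
          by (subst (asm) i_image_eq_iff) (use end_M_subset \<beta>(1) \<beta>'(1) cU in auto)
        then have "\<beta>' K = \<beta> K" by (intro end_eq_mono[OF \<beta>'(1) \<beta>(1) K(1) cU]) auto
        then have "\<beta>' \<in> \<Union>W" using K(2) \<beta>'(1) by (auto simp: basic_end_nbhd_def)
        then show ?thesis using single \<beta>'(2-4) by simp
      qed
      then show ?thesis using compactin_i[OF cU]
        by (intro exI[of _ "i ` (K \<union> K0)"]) (auto simp: basic_end_nbhd_def)
    next
      case False
      then have h\<alpha>: "h \<alpha> = {\<eta>, \<eta>'}" and meet: "\<And>K. compactin M K \<Longrightarrow> \<alpha> (i ` K) \<inter> core \<noteq> {}"
        using h_extraordinary[OF \<alpha>(1)] by auto
      then have "\<eta> \<in> \<Union>W" "\<eta>' \<in> \<Union>W" using \<alpha>(2) by auto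
      then obtain K1 K2 where K: "compactin M K1" "basic_end_nbhd M \<eta> K1 \<subseteq> \<Union>W"
        "compactin M K2" "basic_end_nbhd M \<eta>' K2 \<subseteq> \<Union>W" using W(2) by meson
      \<comment> \<open>The component of \<alpha>' at \<open>K\<close> is the one around the core.
        So a \<beta>' arising from it agrees at \<open>K\<close> with \<eta> or with \<eta>', and it
        is not known with which; \<open>K\<close> has to serve both.\<close>
      define K where "K = K1 \<union> K2"
      have cK: "compactin M K" unfolding K_def using K(1,3) by (rule compactin_Un)
      have "h \<alpha>' \<in> W" if a': "\<alpha>' \<in> ends N" "\<alpha>' (i ` K) = \<alpha> (i ` K)" for \<alpha>'
      proof (cases "\<exists>K. compactin M K \<and> \<alpha>' (i ` K) \<inter> core = {}")
        case True
        then obtain K0 where K0: "compactin M K0" "\<alpha>' (i ` K0) \<inter> core = {}" by blast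
        obtain \<beta>' where \<beta>': "\<beta>' \<in> ends M" "h \<alpha>' = {\<beta>'}" "\<beta>' \<noteq> \<eta>" "\<beta>' \<noteq> \<eta>'"
          "\<And>K. compactin M K \<Longrightarrow> i ` \<beta>' K \<subseteq> \<alpha>' (i ` K)"
          by (rule h_ordinary[OF a'(1) K0]) (use that in blast)
        have "\<alpha>' (i ` K) \<subseteq> core \<union> i ` \<eta> K \<union> i ` \<eta>' K"
          using core_subset_end(2)[OF a'(1) cK] meet[OF cK] a'(2) by auto
        moreover have "i ` \<beta>' K \<inter> core = {}"
          using end_M_subset[OF \<beta>'(1) cK] i_image_eq by blast
        ultimately have "i ` \<beta>' K \<subseteq> i ` (\<eta> K \<union> \<eta>' K)" using \<beta>'(5)[OF cK] by blast
        then have "\<beta>' K \<subseteq> \<eta> K \<union> \<eta>' K"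
          by (subst (asm) i_image_subset_iff) (use end_M_subset \<beta>'(1) \<eta> \<eta>' cK in auto)
        then have "\<beta>' K \<inter> \<eta> K \<noteq> {} \<or> \<beta>' K \<inter> \<eta>' K \<noteq> {}" using end_nonempty[OF \<beta>'(1) cK] by blast
        then have "\<beta>' K = \<eta> K \<or> \<beta>' K = \<eta>' K"
          using end_eq_if_overlap[OF \<beta>'(1) _ cK] \<eta> \<eta>' by blast
        then have "\<beta>' K1 = \<eta> K1 \<or> \<beta>' K2 = \<eta>' K2"
          using end_eq_mono[OF \<beta>'(1) \<eta> K(1) cK] end_eq_mono[OF \<beta>'(1) \<eta>' K(3) cK] by (auto simp: K_def)
        then have "\<beta>' \<in> \<Union>W" using K(2,4) \<beta>'(1) by (auto simp: basic_end_nbhd_def)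
        then show ?thesis using single \<beta>'(2-4) by simp
      next
        case False
        then show ?thesis using h_extraordinary[OF a'(1)] h\<alpha> \<alpha>(2) by auto
      qed
      then show ?thesis using compactin_i[OF cK]
        by (intro exI[of _ "i ` K"]) (auto simp: basic_end_nbhd_def)
    qed
  qed auto
qed

section \<open>Ends of \<open>N\<close> over given ends of \<open>M\<close>, and surjectivity of
  \<open>h\<close>\<close>

lemma closedin_i_end:
  assumes \<beta>: "\<beta> \<in> ends M" and K: "compactin M K" and ne: "\<beta> K \<noteq> \<eta> K" "\<beta> K \<noteq> \<eta>' K"
  shows "closedin N (i ` (\<beta> K \<union> K))"
proof -
  obtain \<epsilon> where e: "\<epsilon> > 0" "e ` ({-\<epsilon><..<\<epsilon>} \<times> coords m) \<inter> i ` K = {}"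
    "e ` ({0<..<\<epsilon>} \<times> coords m) \<subseteq> i ` \<eta> K" "e ` ({-\<epsilon><..<0} \<times> coords m) \<subseteq> i ` \<eta>' K"
    using K by (rule avoid_slab)
  let ?S = "e ` ({-\<epsilon><..<\<epsilon>} \<times> coords m)"
  have KM: "K \<subseteq> topspace M" using K compactin_subset_topspace by blast
  have bM: "\<beta> K \<subseteq> topspace M - K" by (rule end_subset[OF \<beta> K])
  have d: "\<beta> K \<inter> \<eta> K = {}" "\<beta> K \<inter> \<eta>' K = {}"
    using end_eq_if_overlap[OF \<beta> _ K] \<eta> \<eta>' ne by blast+
  have d': "i ` \<beta> K \<inter> i ` \<eta> K = {}" "i ` \<beta> K \<inter> i ` \<eta>' K = {}"
    using d end_M_subset[OF \<beta> K] end_M_subset[OF \<eta> K] end_M_subset[OF \<eta>' K] by (subst i_image_Int; auto)+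
  \<comment> \<open>In \<open>N\<close> the set could accumulate only at the core. It does not,
    because the halves of the slab lie in the components of \<eta> and \<eta>', which are disjoint
    from \<beta> K.\<close>
  have Sd: "?S \<inter> i ` (\<beta> K \<union> K) = {}"
  proof -
    have "e (t, y) \<notin> i ` \<beta> K" if ty: "-\<epsilon> < t" "t < \<epsilon>" "y \<in> coords m" for t y
    proof -
      consider "t = 0" | "t > 0" | "t < 0" by linarith
      then show ?thesis
      proof cases
        case 1 then have "e (t, y) \<in> core" using ty e_in_core by simp
        then show ?thesis using bM i_image_eq by blast
      next
        case 2 then have "e (t, y) \<in> e ` ({0<..<\<epsilon>} \<times> coords m)" using ty by (intro imageI) auto
        then show ?thesis using e(3) d' by blast
      next
        case 3 then have "e (t, y) \<in> e ` ({-\<epsilon><..<0} \<times> coords m)" using ty by (intro imageI) auto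
        then show ?thesis using e(4) d' by blast
      qed
    qed
    note off = this
    have "x \<notin> i ` \<beta> K" if "x \<in> ?S" for x
    proof -
      obtain z where z: "x = e z" "z \<in> {-\<epsilon><..<\<epsilon>} \<times> coords m" using \<open>x \<in> ?S\<close> by (rule imageE)
      obtain t y where "z = (t, y)" by (cases z)
      then show ?thesis using z off[of t y] by simp
    qed
    then have "?S \<inter> i ` \<beta> K = {}" unfolding disjoint_iff by iprover
    then show ?thesis using e(2) by (simp only: image_Un Int_Un_distrib) simp
  qed
  have "core \<subseteq> ?S" unfolding core_def using e(1) by (intro image_mono) auto
  then have "topspace N - i ` (\<beta> K \<union> K) = i ` (topspace M - K - \<beta> K) \<union> ?S"
  proof -
    assume cS: "core \<subseteq> ?S"
    have 1: "i ` topspace M - i ` (\<beta> K \<union> K) = i ` (topspace M - K - \<beta> K)"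
      using inj_i KM bM by (auto simp: inj_on_def)
    have "topspace N = i ` topspace M \<union> ?S"
      using i_image_eq cS core_subset openin_subset[OF openin_slab] by blast
    then show ?thesis using 1 Sd by blast
  qed
  moreover have "openin N (i ` (topspace M - K - \<beta> K) \<union> ?S)"
    using openin_i[OF openin_minus_end[OF locally_connected_M Hausdorff_M \<beta> K]] openin_slab by blast
  moreover have "i ` (\<beta> K \<union> K) \<subseteq> topspace N" using KM bM topspace_N by blast
  ultimately show ?thesis by (simp add: closedin_def)
qed

text \<open>The compact set \<open>K0\<close> separates \<open>\<beta>\<close> from the handle, so that near \<open>\<beta>\<close> only the part of \<open>L\<close> on the
  side of \<open>\<beta>\<close> matters, and this part is a compact subset of \<open>M\<close>.\<close>

definition trace :: "'a set \<Rightarrow> 'a set \<Rightarrow> 'b set \<Rightarrow> 'a set" where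
  "trace K0 B L = K0 \<union> preim (L \<inter> i ` (B \<union> K0))"

lemma compactin_trace:
  assumes \<beta>: "\<beta> \<in> ends M" and K: "compactin M K" and ne: "\<beta> K \<noteq> \<eta> K" "\<beta> K \<noteq> \<eta>' K" and L: "compactin N L"
  shows "compactin M (trace K (\<beta> K) L)"
proof -
  have "compactin N (L \<inter> i ` (\<beta> K \<union> K))"
    using compact_Int_closedin[OF L closedin_i_end[OF \<beta> K ne]] .
  moreover have "L \<inter> i ` (\<beta> K \<union> K) \<subseteq> i ` topspace M"
    using end_M_subset[OF \<beta> K] compactin_subset_topspace[OF K] by blast
  ultimately show ?thesis unfolding trace_def using K compactin_preim by (intro compactin_Un) auto
qed

lemma trace_avoids:
  assumes \<beta>: "\<beta> \<in> ends M" and K: "compactin M K" and ne: "\<beta> K \<noteq> \<eta> K" "\<beta> K \<noteq> \<eta>' K" and L: "compactin N L"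
  shows "i ` \<beta> (trace K (\<beta> K) L) \<inter> L = {}"
proof -
  have c: "compactin M (trace K (\<beta> K) L)" by (rule compactin_trace[OF assms])
  have "\<beta> (trace K (\<beta> K) L) \<subseteq> \<beta> K" by (rule end_mono[OF \<beta> K c]) (auto simp: trace_def)
  moreover have "\<beta> (trace K (\<beta> K) L) \<subseteq> topspace M - trace K (\<beta> K) L" by (rule end_subset[OF \<beta> c])
  ultimately show ?thesis by (auto simp: trace_def preim_def)
qed

text \<open>At a compact \<open>L\<close> of \<open>N\<close>, the end \<alpha> takes the component
  that contains \<beta> of the trace of \<open>L\<close>. It is ordinary: otherwise \<beta> K would
  lie in the union of \<eta> K and \<eta>' K and coincide with one of them.\<close>

lemma end_above:
  assumes \<beta>: "\<beta> \<in> ends M" "\<beta> \<noteq> \<eta>" "\<beta> \<noteq> \<eta>'"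
  obtains \<alpha> where "\<alpha> \<in> ends N" "h \<alpha> = {\<beta>}" "\<And>K. compactin M K \<Longrightarrow> i ` \<beta> K \<subseteq> \<alpha> (i ` K)"
proof -
  obtain K1 where K1: "compactin M K1" "\<beta> K1 \<noteq> \<eta> K1" using end_eqI[OF \<beta>(1) \<eta>] \<beta>(2) by blast
  obtain K2 where K2: "compactin M K2" "\<beta> K2 \<noteq> \<eta>' K2" using end_eqI[OF \<beta>(1) \<eta>'] \<beta>(3) by blast
  define K where "K = K1 \<union> K2"
  have K: "compactin M K" unfolding K_def using K1(1) K2(1) by (rule compactin_Un)
  have ne: "\<beta> K \<noteq> \<eta> K" "\<beta> K \<noteq> \<eta>' K"
    using end_eq_mono[OF \<beta>(1) \<eta> K1(1) K] end_eq_mono[OF \<beta>(1) \<eta>' K2(1) K] K1(2) K2(2) by (auto simp: K_def)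
  define T where "T L = trace K (\<beta> K) L" for L
  have cT: "compactin M (T L)" if "compactin N L" for L
    unfolding T_def by (rule compactin_trace[OF \<beta>(1) K ne that])
  obtain \<alpha> where \<alpha>: "\<alpha> \<in> ends N" "\<And>L. compactin N L \<Longrightarrow> i ` \<beta> (T L) \<subseteq> \<alpha> L"
  proof (rule end_exists[of N "\<lambda>L. i ` \<beta> (T L)"])
    show "connectedin N (i ` \<beta> (T L)) \<and> i ` \<beta> (T L) \<noteq> {} \<and> i ` \<beta> (T L) \<inter> L = {}" if L: "compactin N L" for L
      using connectedin_i[OF end_connected[OF \<beta>(1) cT[OF L]]] end_nonempty[OF \<beta>(1) cT[OF L]]
        trace_avoids[OF \<beta>(1) K ne L] by (simp add: T_def)
    show "i ` \<beta> (T L) \<inter> i ` \<beta> (T L') \<noteq> {}" if L: "compactin N L" "compactin N L'" "L \<subseteq> L'" for L L'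
    proof -
      have "T L \<subseteq> T L'" unfolding T_def trace_def using L(3) by (auto simp: preim_def)
      then have "\<beta> (T L') \<subseteq> \<beta> (T L)" by (rule end_mono[OF \<beta>(1) cT[OF L(1)] cT[OF L(2)]])
      then show ?thesis using end_nonempty[OF \<beta>(1) cT[OF L(2)]] by blast
    qed
  qed (use that in blast)
  have incl: "i ` \<beta> K' \<subseteq> \<alpha> (i ` K')" if K': "compactin M K'" for K'
  proof (rule end_maximal[OF \<alpha>(1) compactin_i[OF K'] connectedin_i[OF end_connected[OF \<beta>(1) K']]])
    show "i ` \<beta> K' \<inter> i ` K' = {}"
      using end_subset[OF \<beta>(1) K'] compactin_subset_topspace[OF K'] by (subst i_image_Int) auto
    have c: "compactin M (K' \<union> T (i ` K'))" using K' cT[OF compactin_i[OF K']] by (rule compactin_Un)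
    have "\<beta> (K' \<union> T (i ` K')) \<subseteq> \<beta> K'" "\<beta> (K' \<union> T (i ` K')) \<subseteq> \<beta> (T (i ` K'))"
      using end_mono[OF \<beta>(1) K' c] end_mono[OF \<beta>(1) cT[OF compactin_i[OF K']] c] by auto
    then show "i ` \<beta> K' \<inter> \<alpha> (i ` K') \<noteq> {}"
      using \<alpha>(2)[OF compactin_i[OF K']] end_nonempty[OF \<beta>(1) c] by blast
  qed
  have "\<alpha> (i ` K) \<inter> core = {}"
  proof (rule ccontr)
    assume "\<alpha> (i ` K) \<inter> core \<noteq> {}"
    then have "\<alpha> (i ` K) \<subseteq> core \<union> i ` \<eta> K \<union> i ` \<eta>' K"
      using core_subset_end(2)[OF \<alpha>(1) K] by blast
    moreover have "i ` \<beta> K \<inter> core = {}" using end_M_subset[OF \<beta>(1) K] i_image_eq by blast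
    ultimately have "i ` \<beta> K \<subseteq> i ` (\<eta> K \<union> \<eta>' K)" using incl[OF K] by blast
    then have "\<beta> K \<subseteq> \<eta> K \<union> \<eta>' K"
      by (subst (asm) i_image_subset_iff) (use end_M_subset \<beta>(1) \<eta> \<eta>' K in auto)
    then have "\<beta> K \<inter> \<eta> K \<noteq> {} \<or> \<beta> K \<inter> \<eta>' K \<noteq> {}" using end_nonempty[OF \<beta>(1) K] by blast
    then show False using end_eq_if_overlap[OF \<beta>(1) _ K] \<eta> \<eta>' ne by blast
  qed
  then obtain \<beta>' where \<beta>': "\<beta>' \<in> ends M" "h \<alpha> = {\<beta>'}"
    "\<And>K'. compactin M K' \<Longrightarrow> K \<subseteq> K' \<Longrightarrow> i ` \<beta>' K' = \<alpha> (i ` K')"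
    by (rule h_ordinary[OF \<alpha>(1) K]) (use that in blast)
  have "\<beta> = \<beta>'" by (rule ordinary_end_unique[OF \<alpha>(1) K \<beta>'(1) \<beta>'(3) \<beta>(1) incl])
  then show thesis using that[OF \<alpha>(1) _ incl] \<beta>'(2) by blast
qed

text \<open>The trace depends only on \<open>K\<close>, \<open>L\<close> and \<beta> K. So \<beta>
  determines the component \<alpha> L of an ordinary end, which gives injectivity and openness of
  \<open>h\<close> at ordinary ends.\<close>

lemma trace_subset_end:
  assumes \<alpha>: "\<alpha> \<in> ends N" and K: "compactin M K" "\<alpha> (i ` K) \<inter> core = {}" and L: "compactin N L"
    and \<beta>: "\<beta> \<in> ends M" "h \<alpha> = {\<beta>}"
  shows "i ` \<beta> (trace K (\<beta> K) L) \<subseteq> \<alpha> L" "compactin M (trace K (\<beta> K) L)" "\<beta> K \<noteq> \<eta> K" "\<beta> K \<noteq> \<eta>' K"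
proof -
  obtain \<beta>' where \<beta>': "h \<alpha> = {\<beta>'}" "\<beta>' K \<noteq> \<eta> K" "\<beta>' K \<noteq> \<eta>' K"
    "\<And>K'. compactin M K' \<Longrightarrow> K \<subseteq> K' \<Longrightarrow> i ` \<beta>' K' = \<alpha> (i ` K')"
    by (rule h_ordinary[OF \<alpha> K]) (use that in blast)
  then have "\<beta>' = \<beta>" using \<beta>(2) by simp
  then show ne: "\<beta> K \<noteq> \<eta> K" "\<beta> K \<noteq> \<eta>' K" using \<beta>' by auto
  have eq: "i ` \<beta> K' = \<alpha> (i ` K')" if "compactin M K'" "K \<subseteq> K'" for K' using \<beta>'(4) that \<open>\<beta>' = \<beta>\<close> by simp
  define T where "T = trace K (\<beta> K) L"
  show cT: "compactin M (trace K (\<beta> K) L)" by (rule compactin_trace[OF \<beta>(1) K(1) ne L])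
  have KT: "K \<subseteq> T" by (auto simp: T_def trace_def)
  have av: "i ` \<beta> T \<inter> L = {}" unfolding T_def by (rule trace_avoids[OF \<beta>(1) K(1) ne L])
  have cT': "compactin M T" using cT by (simp add: T_def)
  have "i ` \<beta> T \<subseteq> \<alpha> L"
  proof (rule end_maximal[OF \<alpha> L connectedin_i[OF end_connected[OF \<beta>(1) cT']] av])
    have c: "compactin N (L \<union> i ` T)" using L compactin_i[OF cT'] by (rule compactin_Un)
    have "\<alpha> (L \<union> i ` T) \<subseteq> \<alpha> L" "\<alpha> (L \<union> i ` T) \<subseteq> \<alpha> (i ` T)"
      using end_mono[OF \<alpha> L c] end_mono[OF \<alpha> compactin_i[OF cT'] c] by auto
    moreover have "\<alpha> (i ` T) = i ` \<beta> T" using eq[OF cT' KT] by simp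
    ultimately show "i ` \<beta> T \<inter> \<alpha> L \<noteq> {}" using end_nonempty[OF \<alpha> c] by blast
  qed
  then show "i ` \<beta> (trace K (\<beta> K) L) \<subseteq> \<alpha> L" by (simp add: T_def)
qed

text \<open>The end escapes along the positive first axis of the core, of which a compact set meets
  only a bounded part. For \<open>m = 0\<close> the core is a single point, which has no such
  axis.\<close>

lemma extraordinary_exists:
  assumes m: "m \<ge> 1"
  obtains \<alpha> where "\<alpha> \<in> ends N" "h \<alpha> = {\<eta>, \<eta>'}"
proof -
  define p where "p t = (\<lambda>j::nat. if j = 0 then t else 0 :: real)" for t
  have pc: "p t \<in> coords m" for t using m by (auto simp: p_def)
  have "\<exists>s. \<forall>t\<ge>s. e (0, p t) \<notin> L" if "compactin N L" for L
  proof -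
    obtain s where s: "s > 0" "\<And>y. y \<in> coords m \<Longrightarrow> e (0, y) \<in> L \<Longrightarrow> y \<in> open_cube m s"
      using compact_core_bounded[OF \<open>compactin N L\<close>] by blast
    have "p t \<notin> open_cube m s" if "t \<ge> s" for t
      using that m s(1) by (auto simp: open_cube_def p_def intro!: exI[of _ 0])
    then show ?thesis using s(2) pc by blast
  qed
  then obtain s where s: "\<And>L t. compactin N L \<Longrightarrow> t \<ge> s L \<Longrightarrow> e (0, p t) \<notin> L" by metis
  define S where "S L = e ` ({0} \<times> p ` {s L..})" for L
  have contp: "continuous_on UNIV p"
    unfolding p_def
  proof (rule continuous_on_coordinatewise_then_product)
    show "continuous_on UNIV (\<lambda>t. if j = 0 then t else 0 :: real)" for j :: nat by (cases "j = 0") auto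
  qed
  obtain \<alpha> where \<alpha>: "\<alpha> \<in> ends N" "\<And>L. compactin N L \<Longrightarrow> S L \<subseteq> \<alpha> L"
  proof (rule end_exists[of N S])
    show "connectedin N (S L) \<and> S L \<noteq> {} \<and> S L \<inter> L = {}" if L: "compactin N L" for L
    proof (intro conjI)
      show "connectedin N (S L)" unfolding S_def
      proof (rule connectedin_e)
        show "connected ({0} \<times> p ` {s L..})"
          by (intro connected_Times connected_continuous_image continuous_on_subset[OF contp]) auto
      qed (use pc in auto)
      show "S L \<noteq> {}" by (auto simp: S_def)
      show "S L \<inter> L = {}" using s[OF L] by (auto simp: S_def)
    qed
    show "S L \<inter> S L' \<noteq> {}" for L L'
    proof -
      have "e (0, p (max (s L) (s L'))) \<in> S L \<inter> S L'" by (auto simp: S_def)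
      then show ?thesis by blast
    qed
  qed (use that in blast)
  have "\<alpha> (i ` K) \<inter> core \<noteq> {}" if K: "compactin M K" for K
  proof -
    have "e (0, p (s (i ` K))) \<in> S (i ` K)" by (auto simp: S_def)
    moreover have "e (0, p (s (i ` K))) \<in> core" using e_in_core[OF pc] by simp
    ultimately show ?thesis using \<alpha>(2)[OF compactin_i[OF K]] by blast
  qed
  then show thesis using that \<alpha>(1) h_extraordinary by blast
qed

lemma surj_h:
  assumes "m \<ge> 1"
  shows "h ` ends N = topspace (ends_quotient M \<eta> \<eta>')"
  unfolding topspace_ends_quotient
proof
  show "h ` ends N \<subseteq> ends M // R" using h_in_quotient by blast
  show "ends M // R \<subseteq> h ` ends N"
  proof
    fix c assume "c \<in> ends M // R"
    then consider "c = {\<eta>, \<eta>'}" | \<beta> where "\<beta> \<in> ends M" "\<beta> \<noteq> \<eta>" "\<beta> \<noteq> \<eta>'" "c = {\<beta>}"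
      unfolding quotient_R by blast
    then show "c \<in> h ` ends N"
    proof cases
      case 1
      obtain \<alpha> where "\<alpha> \<in> ends N" "h \<alpha> = {\<eta>, \<eta>'}" using extraordinary_exists[OF assms] by blast
      then show ?thesis using 1 by (intro image_eqI[of _ _ \<alpha>]) auto
    next
      case 2
      obtain \<alpha> where "\<alpha> \<in> ends N" "h \<alpha> = {\<beta>}" by (rule end_above[OF 2(1-3)]) (use that in blast)
      then show ?thesis using 2 by (intro image_eqI[of _ _ \<alpha>]) auto
    qed
  qed
qed

text \<open>The second hypothesis says that the core far out lies in one component \<open>C\<close>
  of the complement of \<open>L\<close>. Every end whose component at a suitable compact set meets
  the core must then take the component around \<open>C\<close> at \<open>L\<close>.\<close>

lemma homeomorphic_h:
  assumes m: "m \<ge> 1"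
    and core_connected_at_infinity: "\<And>L. compactin N L \<Longrightarrow> \<exists>s>0. \<exists>C.
      (\<forall>y\<in>coords m. e (0, y) \<in> L \<longrightarrow> y \<in> open_cube m s) \<and>
      connectedin N C \<and> C \<inter> L = {} \<and> e ` ({0} \<times> (coords m - cube m s)) \<subseteq> C"
  shows "homeomorphic_map (ends_topology N) (ends_quotient M \<eta> \<eta>') h"
proof -
  \<comment> \<open>Ordinary ends are included on purpose: injectivity compares two extraordinary
    ends, but openness at an extraordinary end compares it with ordinary ends nearby.\<close>
  have unique: "\<exists>K. compactin M K \<and> (\<forall>\<alpha>\<in>ends N. \<forall>\<alpha>'\<in>ends N.
      \<alpha> (i ` K) \<inter> core \<noteq> {} \<longrightarrow> \<alpha>' (i ` K) \<inter> core \<noteq> {} \<longrightarrow> \<alpha> L = \<alpha>' L)"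
    if L: "compactin N L" for L
  proof -
    obtain s C where s': "s > 0" "\<forall>y\<in>coords m. e (0, y) \<in> L \<longrightarrow> y \<in> open_cube m s"
      and C: "connectedin N C" "C \<inter> L = {}" "e ` ({0} \<times> (coords m - cube m s)) \<subseteq> C"
      using core_connected_at_infinity[OF L] by (elim exE conjE) (rule that; assumption)
    have s: "s > 0" "\<And>y. y \<in> coords m \<Longrightarrow> e (0, y) \<in> L \<Longrightarrow> y \<in> open_cube m s"
      using s' by auto
    obtain K where K: "compactin M K"
      "\<And>\<alpha>. \<alpha> \<in> ends N \<Longrightarrow> \<alpha> (i ` K) \<inter> core \<noteq> {} \<Longrightarrow> \<exists>y\<in>coords m - cube m s. e (0, y) \<in> \<alpha> L"
      using extraordinary_meets_core[OF L s] by blast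
    have CL: "C \<subseteq> \<alpha> L \<and> C \<noteq> {}" if \<alpha>: "\<alpha> \<in> ends N" "\<alpha> (i ` K) \<inter> core \<noteq> {}" for \<alpha>
    proof -
      obtain y where y: "y \<in> coords m - cube m s" "e (0, y) \<in> \<alpha> L" using K(2)[OF \<alpha>] by blast
      have "e (0, y) \<in> C" using C(3) y(1) by blast
      then show ?thesis using end_maximal[OF \<alpha>(1) L C(1,2)] y(2) by blast
    qed
    have "\<alpha> L = \<alpha>' L" if "\<alpha> \<in> ends N" "\<alpha>' \<in> ends N" "\<alpha> (i ` K) \<inter> core \<noteq> {}" "\<alpha>' (i ` K) \<inter> core \<noteq> {}" for \<alpha> \<alpha>'
      using CL[OF that(1,3)] CL[OF that(2,4)] by (intro end_eq_if_overlap[OF that(1,2) L]) blast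
    then show ?thesis using K(1) by blast
  qed
  have inj: "inj_on h (ends N)"
  proof (rule inj_onI)
    fix \<alpha> \<alpha>' assume \<alpha>: "\<alpha> \<in> ends N" and \<alpha>': "\<alpha>' \<in> ends N" and eq: "h \<alpha> = h \<alpha>'"
    let ?o = "\<lambda>\<alpha>. \<exists>K. compactin M K \<and> \<alpha> (i ` K) \<inter> core = {}"
    have no: False if a: "a \<in> ends N" "a' \<in> ends N" "?o a" "\<not> ?o a'" "h a = h a'" for a a'
    proof -
      obtain K where "compactin M K" "a (i ` K) \<inter> core = {}" using \<open>?o a\<close> by blast
      then obtain \<beta> where "h a = {\<beta>}" "\<beta> \<noteq> \<eta>" by (rule h_ordinary[OF a(1)]) (use that in blast)
      moreover have "h a' = {\<eta>, \<eta>'}" using h_extraordinary[OF a(2)] a(4) by blast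
      ultimately show False using a(5) by auto
    qed
    show "\<alpha> = \<alpha>'"
    proof (cases "?o \<alpha>")
      case True
      then have "?o \<alpha>'" using no[OF \<alpha> \<alpha>'] eq by blast
      then obtain K1 K2 where K12: "compactin M K1" "\<alpha> (i ` K1) \<inter> core = {}" "compactin M K2" "\<alpha>' (i ` K2) \<inter> core = {}"
        using True by blast
      define K where "K = K1 \<union> K2"
      have K: "compactin M K" unfolding K_def using K12(1,3) by (rule compactin_Un)
      have o: "\<alpha> (i ` K) \<inter> core = {}" "\<alpha>' (i ` K) \<inter> core = {}"
        using end_mono[OF \<alpha> compactin_i[OF K12(1)] compactin_i[OF K]]
          end_mono[OF \<alpha>' compactin_i[OF K12(3)] compactin_i[OF K]] K12(2,4) by (auto simp: K_def)
      obtain \<beta> where \<beta>: "\<beta> \<in> ends M" "h \<alpha> = {\<beta>}" by (rule h_ordinary[OF \<alpha> K o(1)]) (use that in blast)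
      have \<beta>': "h \<alpha>' = {\<beta>}" using eq \<beta>(2) by simp
      show ?thesis
      proof (rule end_eqI[OF \<alpha> \<alpha>'])
        fix L assume L: "compactin N L"
        note 1 = trace_subset_end[OF \<alpha> K o(1) L \<beta>]
        note 2 = trace_subset_end[OF \<alpha>' K o(2) L \<beta>(1) \<beta>']
        show "\<alpha> L = \<alpha>' L"
          using 1(1) 2(1) end_nonempty[OF \<beta>(1) 1(2)] by (intro end_eq_if_overlap[OF \<alpha> \<alpha>' L]) blast
      qed
    next
      case False
      then have no': "\<not> ?o \<alpha>'" using no[OF \<alpha>' \<alpha>] eq by auto
      show ?thesis
      proof (rule end_eqI[OF \<alpha> \<alpha>'])
        fix L assume L: "compactin N L"
        obtain K where K: "compactin M K" "\<forall>\<alpha>\<in>ends N. \<forall>\<alpha>'\<in>ends N.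
          \<alpha> (i ` K) \<inter> core \<noteq> {} \<longrightarrow> \<alpha>' (i ` K) \<inter> core \<noteq> {} \<longrightarrow> \<alpha> L = \<alpha>' L" using unique[OF L] by (elim exE conjE) (rule that; assumption)
        have "\<alpha> (i ` K) \<inter> core \<noteq> {}" using False K(1) by metis
        moreover have "\<alpha>' (i ` K) \<inter> core \<noteq> {}" using no' K(1) by metis
        ultimately show "\<alpha> L = \<alpha>' L" using K(2) \<alpha> \<alpha>' by simp
      qed
    qed
  qed
  have "open_map (ends_topology N) (ends_quotient M \<eta> \<eta>') h"
    unfolding open_map_def
  proof (intro allI impI)
    fix U assume "openin (ends_topology N) U"
    then have U: "U \<subseteq> ends N" "\<And>\<alpha>. \<alpha> \<in> U \<Longrightarrow> \<exists>L. compactin N L \<and> basic_end_nbhd N \<alpha> L \<subseteq> U"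
      unfolding openin_ends_topology by auto
    have hU: "h ` U \<subseteq> ends M // R" using U(1) h_in_quotient by blast
    have sub: "\<Union>(h ` U) \<subseteq> ends M"
      using hU Union_quotient[OF equiv_ends_relation] by blast
    have "openin (ends_topology M) (\<Union>(h ` U))"
      unfolding openin_ends_topology
    proof (intro conjI ballI)
      show "\<Union>(h ` U) \<subseteq> ends M" by (rule sub)
      fix \<beta> assume "\<beta> \<in> \<Union>(h ` U)"
      then obtain \<alpha> where \<alpha>: "\<alpha> \<in> U" "\<beta> \<in> h \<alpha>" by blast
      have \<alpha>N: "\<alpha> \<in> ends N" using \<alpha>(1) U(1) by blast
      have \<beta>M: "\<beta> \<in> ends M" using sub \<alpha> by blast
      obtain L where L: "compactin N L" "basic_end_nbhd N \<alpha> L \<subseteq> U" using U(2)[OF \<alpha>(1)] by blast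
      show "\<exists>K. compactin M K \<and> basic_end_nbhd M \<beta> K \<subseteq> \<Union>(h ` U)"
      proof (cases "\<exists>K. compactin M K \<and> \<alpha> (i ` K) \<inter> core = {}")
        case True
        then obtain K where K: "compactin M K" "\<alpha> (i ` K) \<inter> core = {}" by blast
        obtain \<beta>1 where "h \<alpha> = {\<beta>1}" "\<And>K'. compactin M K' \<Longrightarrow> K \<subseteq> K' \<Longrightarrow> i ` \<beta>1 K' = \<alpha> (i ` K')"
          by (rule h_ordinary[OF \<alpha>N K]) (use that in blast)
        then have h\<alpha>: "h \<alpha> = {\<beta>}" and bK: "i ` \<beta> K = \<alpha> (i ` K)" using \<alpha>(2) K(1) by auto
        note 1 = trace_subset_end[OF \<alpha>N K L(1) \<beta>M h\<alpha>]
        let ?T = "trace K (\<beta> K) L"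
        have "\<beta>' \<in> \<Union>(h ` U)" if \<beta>': "\<beta>' \<in> ends M" "\<beta>' ?T = \<beta> ?T" for \<beta>'
        proof -
          \<comment> \<open>The trace contains \<open>K\<close>, so \<open>K\<close> separates
            \<beta>' from \<eta> and \<eta>' just as it separates \<beta>, and both ends yield the
            same trace of \<open>L\<close>.\<close>
          have eqK: "\<beta>' K = \<beta> K"
            by (rule end_eq_mono[OF \<beta>'(1) \<beta>M K(1) 1(2) _ \<beta>'(2)]) (auto simp: trace_def)
          then have ne: "\<beta>' \<noteq> \<eta>" "\<beta>' \<noteq> \<eta>'" using 1(3,4) by auto
          obtain \<alpha>' where \<alpha>': "\<alpha>' \<in> ends N" "h \<alpha>' = {\<beta>'}" "\<And>K. compactin M K \<Longrightarrow> i ` \<beta>' K \<subseteq> \<alpha>' (i ` K)"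
            by (rule end_above[OF \<beta>'(1) ne]) (use that in blast)
          have "\<alpha> (i ` K) \<inter> \<alpha>' (i ` K) \<noteq> {}"
            using \<alpha>'(3)[OF K(1)] bK eqK end_nonempty[OF \<beta>M K(1)] by blast
          then have "\<alpha> (i ` K) = \<alpha>' (i ` K)" by (rule end_eq_if_overlap[OF \<alpha>N \<alpha>'(1) compactin_i[OF K(1)]])
          then have o: "\<alpha>' (i ` K) \<inter> core = {}" using K(2) by simp
          note 2 = trace_subset_end[OF \<alpha>'(1) K(1) o L(1) \<beta>'(1) \<alpha>'(2)]
          have "i ` \<beta> ?T \<subseteq> \<alpha>' L" using 2(1) unfolding eqK \<beta>'(2) .
          then have "\<alpha>' L \<inter> \<alpha> L \<noteq> {}" using 1(1) end_nonempty[OF \<beta>M 1(2)] by blast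
          then have "\<alpha>' L = \<alpha> L" by (rule end_eq_if_overlap[OF \<alpha>'(1) \<alpha>N L(1)])
          then have "\<alpha>' \<in> U" using L(2) \<alpha>'(1) by (auto simp: basic_end_nbhd_def)
          then show ?thesis using \<alpha>'(2) by blast
        qed
        then show ?thesis using 1(2) by (intro exI[of _ ?T]) (auto simp: basic_end_nbhd_def)
      next
        case False
        then have h\<alpha>: "h \<alpha> = {\<eta>, \<eta>'}" using h_extraordinary[OF \<alpha>N] by blast
        obtain K where K: "compactin M K" "\<forall>\<alpha>\<in>ends N. \<forall>\<alpha>'\<in>ends N.
          \<alpha> (i ` K) \<inter> core \<noteq> {} \<longrightarrow> \<alpha>' (i ` K) \<inter> core \<noteq> {} \<longrightarrow> \<alpha> L = \<alpha>' L" using unique[OF L(1)] by (elim exE conjE) (rule that; assumption)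
        have "\<beta>' \<in> \<Union>(h ` U)" if \<beta>': "\<beta>' \<in> ends M" "\<beta>' K = \<beta> K" for \<beta>'
        proof (cases "\<beta>' = \<eta> \<or> \<beta>' = \<eta>'")
          case True
          then show ?thesis using h\<alpha> \<alpha>(1) by blast
        next
          case ne: False
          obtain \<alpha>' where \<alpha>': "\<alpha>' \<in> ends N" "h \<alpha>' = {\<beta>'}" "\<And>K. compactin M K \<Longrightarrow> i ` \<beta>' K \<subseteq> \<alpha>' (i ` K)"
            by (rule end_above[OF \<beta>'(1)]) (use ne that in blast)+
          have "\<beta> = \<eta> \<or> \<beta> = \<eta>'" using \<alpha>(2) h\<alpha> by blast
          \<comment> \<open>An ordinary end over a \<beta>' close to \<eta> or \<eta>' has a
            component that reaches \<eta> K or \<eta>' K and therefore contains the core. This makes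
            \<open>unique\<close> applicable.\<close>
          then have "\<alpha>' (i ` K) \<inter> (core \<union> i ` \<eta> K \<union> i ` \<eta>' K) \<noteq> {}"
            using \<alpha>'(3)[OF K(1)] \<beta>' end_nonempty[OF \<beta>'(1) K(1)] by blast
          then have "core \<subseteq> \<alpha>' (i ` K)" by (rule core_subset_end(1)[OF \<alpha>'(1) K(1)])
          then have "\<alpha>' (i ` K) \<inter> core \<noteq> {}" using core_nonempty by blast
          moreover have "\<alpha> (i ` K) \<inter> core \<noteq> {}" using False K(1) by blast
          ultimately have "\<alpha>' L = \<alpha> L" using K(2) \<alpha>N \<alpha>'(1) by blast
          then have "\<alpha>' \<in> U" using L(2) \<alpha>'(1) by (auto simp: basic_end_nbhd_def)
          then show ?thesis using \<alpha>'(2) by blast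
        qed
        then show ?thesis using K(1) by (intro exI[of _ K]) (auto simp: basic_end_nbhd_def)
      qed
    qed
    then show "openin (ends_quotient M \<eta> \<eta>') (h ` U)" unfolding openin_ends_quotient using hU by blast
  qed
  then show ?thesis
    using continuous_h surj_h[OF m] inj
    by (intro bijective_open_imp_homeomorphic_map) (auto simp: topspace_ends_topology)
qed

end

section \<open>Points without a local square root\<close>

text \<open>For \<open>G\<close> nonzero near \<open>k\<close>, the local degree of \<open>G\<close> around \<open>k\<close> is odd; unlike the degree itself,
  this makes sense without orientations.\<close>

definition odd_point :: "'a topology \<Rightarrow> ('a \<Rightarrow> complex) \<Rightarrow> 'a \<Rightarrow> bool" where
  "odd_point X G k \<longleftrightarrow> \<not> (\<exists>U s. openin X U \<and> k \<in> U \<and>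
     continuous_map (subtopology X (U - {k})) euclidean s \<and> (\<forall>x\<in>U - {k}. (s x)\<^sup>2 = G x))"

lemma odd_point_complex_iff:
  fixes k :: complex
  shows "odd_point euclidean G k \<longleftrightarrow> \<not> (\<exists>r>0. \<exists>s. continuous_on (ball k r - {k}) s \<and> (\<forall>x\<in>ball k r - {k}. (s x)\<^sup>2 = G x))"
    (is "_ \<longleftrightarrow> \<not> ?R")
proof -
  have "(\<exists>U s. open U \<and> k \<in> U \<and> continuous_on (U - {k}) s \<and> (\<forall>x\<in>U - {k}. (s x)\<^sup>2 = G x)) \<longleftrightarrow> ?R"
  proof
    assume "\<exists>U s. open U \<and> k \<in> U \<and> continuous_on (U - {k}) s \<and> (\<forall>x\<in>U - {k}. (s x)\<^sup>2 = G x)"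
    then obtain U s where U: "open U" "k \<in> U" "continuous_on (U - {k}) s" "\<forall>x\<in>U - {k}. (s x)\<^sup>2 = G x" by blast
    then obtain r where "r > 0" "ball k r \<subseteq> U" by (meson openE)
    then show ?R using U by (meson Diff_mono continuous_on_subset subset_iff order_refl)
  next
    assume ?R then show "\<exists>U s. open U \<and> k \<in> U \<and> continuous_on (U - {k}) s \<and> (\<forall>x\<in>U - {k}. (s x)\<^sup>2 = G x)"
      using centre_in_ball open_ball by blast
  qed
  then show ?thesis by (simp add: odd_point_def)
qed

section \<open>Local degrees in the punctured plane\<close>

lemma exp_eq_1_constant:
  fixes f :: "'a::topological_space \<Rightarrow> complex"
  assumes "connected S" "continuous_on S f" "\<And>x. x \<in> S \<Longrightarrow> exp (f x) = 1"
  shows "\<exists>n::int. \<forall>x\<in>S. f x = of_int (2 * n) * pi * \<i>"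
proof (cases "S = {}")
  case False
  have int: "\<exists>n::int. f x = of_int (2 * n) * pi * \<i>" if "x \<in> S" for x
  proof -
    from assms(3)[OF that] obtain n :: int where "Im (f x) = of_int (2 * n) * pi" "Re (f x) = 0"
      unfolding exp_eq_1 by blast
    then show ?thesis by (intro exI[of _ n]) (simp add: complex_eq_iff)
  qed
  have "f constant_on S"
  proof (rule continuous_discrete_range_constant[OF assms(1,2)])
    fix x assume x: "x \<in> S"
    show "\<exists>e>0. \<forall>y. y \<in> S \<and> f y \<noteq> f x \<longrightarrow> e \<le> norm (f y - f x)"
    proof (intro exI[of _ "2 * pi"] conjI allI impI)
      fix y assume y: "y \<in> S \<and> f y \<noteq> f x"
      obtain n m :: int where nm: "f x = of_int (2 * n) * pi * \<i>" "f y = of_int (2 * m) * pi * \<i>"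
        using int x y by meson
      have "f y - f x = of_int (2 * (m - n)) * pi * \<i>" using nm by (simp add: algebra_simps)
      then have e: "norm (f y - f x) = 2 * pi * real_of_int \<bar>m - n\<bar>" 
        by (simp only: norm_mult norm_of_int norm_of_real norm_ii of_int_mult abs_mult of_int_abs) simp
      have "m \<noteq> n" using nm y by auto
      then have "1 \<le> real_of_int \<bar>m - n\<bar>" by linarith
      then show "2 * pi \<le> norm (f y - f x)" unfolding e by simp
    qed simp
  qed
  then obtain c where c: "\<And>x. x \<in> S \<Longrightarrow> f x = c" unfolding constant_on_def by blast
  then show ?thesis using int False by (metis ex_in_conv)
qed auto

text \<open>The map \<open>k + exp w\<close> on a half-plane is the universal cover of the punctured
  disc, and the pullback of \<open>F\<close> has a logarithm \<open>g\<close> there. One full turn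
  changes \<open>g\<close> by a constant 2 pi i d. Subtracting \<open>d\<close> times
  \<open>w\<close> leaves a periodic function, which descends to the disc.\<close>

lemma punctured_ball_log:
  fixes k :: complex
  assumes "r > 0" "continuous_on (ball k r - {k}) F" "\<And>z. z \<in> ball k r - {k} \<Longrightarrow> F z \<noteq> 0"
  obtains d :: int and h where "continuous_on (ball k r - {k}) h"
    "\<And>z. z \<in> ball k r - {k} \<Longrightarrow> F z = (z - k) powi d * exp (h z)"
proof -
  define S where "S = {w. Re w < ln r}"
  have inS: "k + exp w \<in> ball k r - {k}" if "w \<in> S" for w
  proof -
    have "exp (Re w) < r" using that \<open>r > 0\<close> by (metis S_def exp_less_mono exp_ln mem_Collect_eq)
    then show ?thesis by (simp add: dist_norm norm_exp_eq_Re)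
  qed
  have "convex S" unfolding S_def by (rule convex_halfspace_Re_lt)
  have cont: "continuous_on S (\<lambda>w. F (k + exp w))"
    by (rule continuous_on_compose2[OF assms(2)]) (auto intro!: continuous_intros dest: inS)
  obtain g where g: "continuous_on S g" "\<And>w. w \<in> S \<Longrightarrow> F (k + exp w) = exp (g w)"
  proof (rule continuous_logarithm_on_contractible[OF cont convex_imp_contractible[OF \<open>convex S\<close>]])
    show "F (k + exp w) \<noteq> 0" if "w \<in> S" for w using inS[OF that] assms(3) by blast
  qed (use that in blast)
  define T :: complex where "T = of_real (2 * pi) * \<i>"
  have expT: "exp T = 1" unfolding T_def by simp
  have TS: "w + T \<in> S" if "w \<in> S" for w using that by (simp add: S_def T_def)
  have "continuous_on S (\<lambda>w. g (w + T) - g w)"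
    by (intro continuous_intros g continuous_on_compose2[OF g(1)]) (auto intro: TS)
  moreover have "exp (g (w + T) - g w) = 1" if "w \<in> S" for w
  proof -
    have "exp (g (w + T)) = exp (g w)" using g(2)[OF that] g(2)[OF TS[OF that]] expT by (simp add: exp_add)
    then show ?thesis by (simp add: exp_diff)
  qed
  ultimately have "\<exists>n::int. \<forall>w\<in>S. g (w + T) - g w = of_int (2 * n) * pi * \<i>"
    by (rule exp_eq_1_constant[OF convex_connected[OF \<open>convex S\<close>]])
  then obtain d :: int where d: "\<And>w. w \<in> S \<Longrightarrow> g (w + T) - g w = of_int (2 * d) * pi * \<i>"
    by blast
  define q where "q w = g w - of_int d * w" for w
  have q1: "q (w + T) = q w" if "w \<in> S" for w
    using d[OF that] by (simp add: q_def T_def algebra_simps)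
  have qcont: "continuous_on S q" unfolding q_def by (intro continuous_intros g)
  define h where "h z = q (Ln (z - k))" for z
  have LnS: "Ln (z - k) \<in> S" if "z \<in> ball k r - {k}" for z
    using that \<open>r > 0\<close> by (auto simp: S_def dist_norm norm_minus_commute)
  have LnS': "Ln (- (z - k)) + pi * \<i> \<in> S" if "z \<in> ball k r - {k}" for z
  proof -
    have "- (z - k) \<noteq> 0" "norm (-(z-k)) < r" using that by (auto simp: dist_norm norm_minus_commute)
    then show ?thesis using \<open>r > 0\<close> by (auto simp: S_def)
  qed
  \<comment> \<open>The same \<open>h\<close> through a branch of the logarithm cut along the
    opposite ray. Hence \<open>h\<close> is continuous across the cut of \<open>Ln\<close>, where
    the defining formula does not show it.\<close>
  have alt: "h z = q (Ln (- (z - k)) + pi * \<i>)" if z: "z \<in> ball k r - {k}" for z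
  proof -
    have nz: "z - k \<noteq> 0" using z by auto
    have "exp (Ln (- (z - k)) + pi * \<i>) = exp (Ln (z - k))"
      using nz by (simp add: exp_add)
    then obtain n :: int where n: "Ln (- (z - k)) + pi * \<i> = Ln (z - k) + (of_int (2 * n) * pi) * \<i>"
      unfolding exp_eq by blast
    have shift: "q (w + of_nat m * T) = q w" if "w \<in> S" for w m
    proof (induction m)
      case (Suc m)
      have "w + of_nat m * T \<in> S" using \<open>w \<in> S\<close> by (simp add: S_def T_def)
      then have "q (w + of_nat m * T + T) = q w" using q1 Suc by simp
      then show ?case by (simp add: algebra_simps)
    qed simp
    show ?thesis
    proof (cases "n \<ge> 0")
      case True
      have "Ln (- (z - k)) + pi * \<i> = Ln (z - k) + of_nat (nat n) * T"
        using n True by (simp add: T_def)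
      then show ?thesis using shift[OF LnS[OF z]] by (simp add: h_def)
    next
      case False
      have "Ln (z - k) = Ln (- (z - k)) + pi * \<i> + of_nat (nat (-n)) * T"
        using n False by (simp add: T_def)
      then show ?thesis using shift[OF LnS'[OF z]] by (simp add: h_def)
    qed
  qed
  have "continuous_on (ball k r - {k}) h"
  proof -
    define A where "A = (ball k r - {k}) - {z. z - k \<in> \<real>\<^sub>\<le>\<^sub>0}"
    define B where "B = (ball k r - {k}) - {z. -(z - k) \<in> \<real>\<^sub>\<le>\<^sub>0}"
    have "closed {z. z - k \<in> \<real>\<^sub>\<le>\<^sub>0}" "closed {z. -(z - k) \<in> \<real>\<^sub>\<le>\<^sub>0}"
      using continuous_closed_vimage[OF closed_nonpos_Reals_complex, of "\<lambda>z. z - k"]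
        continuous_closed_vimage[OF closed_nonpos_Reals_complex, of "\<lambda>z. -(z - k)"]
      by (auto simp: vimage_def)
    then have op: "open A" "open B" unfolding A_def B_def by (auto intro!: open_Diff)
    have "continuous_on A h"
      unfolding h_def by (rule continuous_on_compose2[OF qcont]) (auto simp: A_def intro!: continuous_intros LnS)
    moreover have "continuous_on B (\<lambda>z. q (Ln (- (z - k)) + pi * \<i>))"
    proof (rule continuous_on_compose2[OF qcont])
      show "continuous_on B (\<lambda>z. Ln (- (z - k)) + pi * \<i>)"
        by (intro continuous_intros) (auto simp: B_def)
      show "(\<lambda>z. Ln (- (z - k)) + pi * \<i>) ` B \<subseteq> S" using LnS' by (auto simp: B_def)
    qed
    then have "continuous_on B h"
      by (rule continuous_on_eq) (use alt in \<open>auto simp: B_def\<close>)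
    ultimately have "continuous_on (A \<union> B) h" using op by (rule continuous_on_open_Un[rotated 2])
    moreover have "A \<union> B = ball k r - {k}"
    proof -
      have "z - k \<notin> \<real>\<^sub>\<le>\<^sub>0 \<or> -(z - k) \<notin> \<real>\<^sub>\<le>\<^sub>0" if "z \<noteq> k" for z
      proof (rule ccontr)
        assume "\<not> ?thesis"
        then have "Re z = Re k" "Im z = Im k" by (auto simp: complex_nonpos_Reals_iff)
        then show False using that by (simp add: complex_eqI)
      qed
      then show ?thesis unfolding A_def B_def by blast
    qed
    ultimately show ?thesis by simp
  qed
  moreover have "F z = (z - k) powi d * exp (h z)" if z: "z \<in> ball k r - {k}" for z
  proof -
    have nz: "z - k \<noteq> 0" using z by auto
    have "F z = F (k + exp (Ln (z - k)))" using nz by simp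
    also have "\<dots> = exp (g (Ln (z - k)))" using g(2)[OF LnS[OF z]] .
    also have "\<dots> = exp (of_int d * Ln (z - k)) * exp (h z)" by (simp add: h_def q_def exp_add[symmetric])
    also have "exp (of_int d * Ln (z - k)) = (z - k) powi d"
    proof -
      have "exp (of_int d * Ln (z - k)) = exp (Ln (z - k)) powi d" by (simp only: exp_power_int mult.commute)
      then show ?thesis using nz by simp
    qed
    finally show ?thesis .
  qed
  ultimately show thesis using that by blast
qed

text \<open>On the circle of radius \<open>r / 2\<close>, the root divided by the half-angle root is
  a continuous choice of sign, hence constant. A full turn returns to the same point but negates the
  half-angle root.\<close>

lemma no_square_root_punctured:
  fixes k :: complex
  assumes "r > 0" "continuous_on (ball k r - {k}) s"
  shows "\<not> (\<forall>z\<in>ball k r - {k}. (s z)\<^sup>2 = z - k)"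
proof
  assume sq: "\<forall>z\<in>ball k r - {k}. (s z)\<^sup>2 = z - k"
  define p where "p t = k + of_real (r / 2) * exp (\<i> * of_real t)" for t :: real
  define v where "v t = s (p t) / (of_real (sqrt (r / 2)) * exp (\<i> * of_real (t / 2)))" for t :: real
  have p: "p t \<in> ball k r - {k}" for t
    using \<open>r > 0\<close> by (auto simp: p_def dist_norm norm_mult)
  have "continuous_on UNIV (\<lambda>t. s (p t))"
    by (rule continuous_on_compose2[OF assms(2)]) (use p in \<open>auto simp: p_def[abs_def] intro!: continuous_intros\<close>)
  then have cv: "continuous_on UNIV v"
    unfolding v_def using \<open>r > 0\<close> by (intro continuous_intros) auto
  have v2: "(v t)\<^sup>2 = 1" for t
  proof -
    have "(of_real (sqrt (r / 2)) :: complex)\<^sup>2 = of_real (r / 2)"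
      using \<open>r > 0\<close> by (metis less_eq_real_def of_real_power real_sqrt_pow2 half_gt_zero)
    moreover have "(exp (\<i> * of_real (t / 2)))\<^sup>2 = exp (\<i> * of_real t)"
      by (simp add: exp_double[symmetric])
    moreover have "(s (p t))\<^sup>2 = of_real (r / 2) * exp (\<i> * of_real t)"
      using sq p[of t] by (simp add: p_def)
    moreover have "(v t)\<^sup>2 = (s (p t))\<^sup>2 / ((of_real (sqrt (r / 2)))\<^sup>2 * (exp (\<i> * of_real (t / 2)))\<^sup>2)"
      by (simp add: v_def power_divide power_mult_distrib)
    ultimately have "(v t)\<^sup>2 = (of_real (r / 2) * exp (\<i> * of_real t)) / (of_real (r / 2) * exp (\<i> * of_real t))"
      by (simp only:)
    then show ?thesis using \<open>r > 0\<close> by simp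
  qed
  have "v ` UNIV \<subseteq> {1, -1}" using v2 by (auto simp: power2_eq_1_iff)
  then have "finite (range v)" by (meson finite.emptyI finite_insert finite_subset)
  moreover have "connected (range v)" using cv by (simp add: connected_continuous_image)
  ultimately obtain c where "range v = {c}" using connected_finite_iff_sing by blast
  then have "v 0 = v (2 * pi)" by (metis rangeI singletonD)
  moreover have "p (2 * pi) = p 0" by (simp add: p_def mult.commute)
  ultimately have "v 0 = - v 0" by (simp add: v_def mult.commute exp_pi_i)
  then show False using v2[of 0] by simp
qed

text \<open>The factor \<open>exp (h z)\<close> has the root \<open>exp (h z / 2)\<close>, and an
  even power has a root as well. Dividing these out, a root for an odd power would yield one of
  \<open>z - k\<close>.\<close>

lemma odd_point_powi_exp:
  fixes k :: complex
  assumes "r > 0" "continuous_on (ball k r - {k}) h"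
    "\<And>z. z \<in> ball k r - {k} \<Longrightarrow> F z = (z - k) powi d * exp (h z)"
  shows "odd_point euclidean F k \<longleftrightarrow> odd d"
proof (cases "even d")
  case True
  then obtain e where e: "d = 2 * e" by blast
  have "continuous_on (ball k r - {k}) (\<lambda>z. (z - k) powi e * exp (h z / 2))"
    by (intro continuous_intros assms(2)) auto
  moreover have "((z - k) powi e * exp (h z / 2))\<^sup>2 = F z" if "z \<in> ball k r - {k}" for z
  proof -
    have "((z - k) powi e)\<^sup>2 = (z - k) powi d"
      unfolding e by (metis mult.commute power_int_mult power_int_numeral)
    moreover have "(exp (h z / 2))\<^sup>2 = exp (h z)" by (simp add: exp_double[symmetric])
    ultimately show ?thesis using assms(3)[OF that] by (simp add: power_mult_distrib)
  qed
  ultimately show ?thesis using True \<open>r > 0\<close> unfolding odd_point_complex_iff by blast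
next
  case False
  then obtain e where e: "d = 2 * e + 1" using oddE by blast
  have False if "r' > 0" "continuous_on (ball k r' - {k}) s" "\<forall>x\<in>ball k r' - {k}. (s x)\<^sup>2 = F x" for r' s
  proof -
    define q where "q = min r r'"
    have q: "q > 0" "ball k q \<subseteq> ball k r" "ball k q \<subseteq> ball k r'" using that(1) \<open>r > 0\<close> by (auto simp: q_def)
    have "continuous_on (ball k q - {k}) (\<lambda>z. s z * (z - k) powi (- e) * exp (- h z / 2))"
      by (intro continuous_intros continuous_on_subset[OF that(2)] continuous_on_subset[OF assms(2)])
        (use q in auto)
    moreover have "(s z * (z - k) powi (- e) * exp (- h z / 2))\<^sup>2 = z - k" if z: "z \<in> ball k q - {k}" for z
    proof -
      have nz: "z - k \<noteq> 0" using z by auto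
      have 1: "(s z)\<^sup>2 = (z - k) powi d * exp (h z)" using z q that assms(3) \<open>\<forall>x\<in>ball k r' - {k}. _\<close>
        by (metis Diff_iff subsetD)
      have 2: "(exp (- h z / 2))\<^sup>2 = exp (- h z)" by (simp add: exp_double[symmetric])
      have 3: "((z - k) powi (- e))\<^sup>2 = (z - k) powi (- 2 * e)"
        by (metis mult.commute power_int_mult power_int_numeral mult_minus_left mult_minus_right)
      have "(z - k) powi d * (z - k) powi (- 2 * e) = (z - k) powi (d + - 2 * e)"
        using nz by (subst power_int_add) auto
      also have "\<dots> = z - k" by (simp add: e)
      finally have 4: "(z - k) powi d * (z - k) powi (- 2 * e) = z - k" .
      have "(s z * (z - k) powi (- e) * exp (- h z / 2))\<^sup>2 = (z - k) powi d * exp (h z) * (z - k) powi (- 2 * e) * exp (- h z)"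
        by (simp only: power_mult_distrib 1 2 3)
      also have "\<dots> = ((z - k) powi d * (z - k) powi (- 2 * e)) * (exp (h z) * exp (- h z))"
        by (simp only: mult_ac)
      also have "\<dots> = z - k" by (simp only: 4 exp_minus_inverse mult_1_right)
      finally show ?thesis .
    qed
    ultimately show False using no_square_root_punctured[OF q(1)] by blast
  qed
  then show ?thesis using False unfolding odd_point_complex_iff by blast
qed

text \<open>Local degrees add under multiplication; the inequality of truth values is addition
  modulo 2.\<close>

lemma odd_point_mult:
  fixes k :: complex
  assumes "r > 0" "continuous_on (ball k r - {k}) F" "continuous_on (ball k r - {k}) E"
    "\<And>z. z \<in> ball k r - {k} \<Longrightarrow> F z \<noteq> 0 \<and> E z \<noteq> 0"
  shows "odd_point euclidean (\<lambda>z. F z * E z) k \<longleftrightarrow> (odd_point euclidean F k \<noteq> odd_point euclidean E k)"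
proof -
  obtain d h where F: "continuous_on (ball k r - {k}) h"
    "\<And>z. z \<in> ball k r - {k} \<Longrightarrow> F z = (z - k) powi d * exp (h z)"
    using punctured_ball_log[OF assms(1,2)] assms(4) by metis
  obtain d' h' where E: "continuous_on (ball k r - {k}) h'"
    "\<And>z. z \<in> ball k r - {k} \<Longrightarrow> E z = (z - k) powi d' * exp (h' z)"
    using punctured_ball_log[OF assms(1,3)] assms(4) by metis
  have "F z * E z = (z - k) powi (d + d') * exp (h z + h' z)" if "z \<in> ball k r - {k}" for z
  proof -
    have "z - k \<noteq> 0" using that by auto
    then show ?thesis using F(2) E(2) that by (simp add: power_int_add exp_add)
  qed
  then have "odd_point euclidean (\<lambda>z. F z * E z) k \<longleftrightarrow> odd (d + d')"
    by (intro odd_point_powi_exp[OF assms(1), where h="\<lambda>z. h z + h' z"] continuous_intros F E)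
  then show ?thesis
    using odd_point_powi_exp[OF assms(1) F] odd_point_powi_exp[OF assms(1) E] by simp
qed

lemma not_odd_point_continuous:
  fixes k :: complex
  assumes "r > 0" "continuous_on (ball k r) E" "\<And>z. z \<in> ball k r \<Longrightarrow> E z \<noteq> 0"
  shows "\<not> odd_point euclidean E k"
proof -
  obtain g where g: "continuous_on (ball k r) g" "\<And>z. z \<in> ball k r \<Longrightarrow> E z = exp (g z)"
    using continuous_logarithm_on_ball[OF assms(2,3)] by metis
  have "odd_point euclidean E k \<longleftrightarrow> odd (0::int)"
    by (rule odd_point_powi_exp[OF assms(1), where h=g]) (use g in \<open>auto intro: continuous_on_subset\<close>)
  then show ?thesis by simp
qed

lemma odd_point_cong:
  fixes k :: complex
  assumes "r > 0" "\<And>z. z \<in> ball k r - {k} \<Longrightarrow> F z = G z"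
  shows "odd_point euclidean F k \<longleftrightarrow> odd_point euclidean G k"
proof -
  have *: "(\<exists>r>0. \<exists>s. continuous_on (ball k r - {k}) s \<and> (\<forall>x\<in>ball k r - {k}. (s x)\<^sup>2 = G x))"
    if "r > 0" "\<And>z. z \<in> ball k r - {k} \<Longrightarrow> F z = G z"
     "r' > 0" "continuous_on (ball k r' - {k}) s" "\<forall>x\<in>ball k r' - {k}. (s x)\<^sup>2 = F x"
    for F G :: "complex \<Rightarrow> complex" and s r r'
  proof (intro exI conjI)
    show "min r r' > 0" using that by simp
    show "continuous_on (ball k (min r r') - {k}) s"
      by (rule continuous_on_subset[OF that(4)]) auto
    show "\<forall>x\<in>ball k (min r r') - {k}. (s x)\<^sup>2 = G x" using that(2,5) by auto
  qed
  show ?thesis unfolding odd_point_complex_iff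
  proof (intro arg_cong[where f=Not] iffI; elim exE conjE)
    show "\<exists>r>0. \<exists>s. continuous_on (ball k r - {k}) s \<and> (\<forall>x\<in>ball k r - {k}. (s x)\<^sup>2 = G x)"
      if "r' > 0" "continuous_on (ball k r' - {k}) s" "\<forall>x\<in>ball k r' - {k}. (s x)\<^sup>2 = F x" for r' s
      by (rule *[of r F G r' s]) (use assms that in auto)
    show "\<exists>r>0. \<exists>s. continuous_on (ball k r - {k}) s \<and> (\<forall>x\<in>ball k r - {k}. (s x)\<^sup>2 = F x)"
      if "r' > 0" "continuous_on (ball k r' - {k}) s" "\<forall>x\<in>ball k r' - {k}. (s x)\<^sup>2 = G x" for r' s
      by (rule *[of r G F r' s]) (use assms that in auto)
  qed
qed

text \<open>Induction on the punctures. Dividing by \<open>z - k\<close> to the power of the local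
  degree unwinds \<open>F\<close> around \<open>k\<close>, so that this puncture can be filled in.
  Near infinity \<open>z - k\<close> is \<open>z\<close> times a factor with a logarithm, so the
  local degrees add up to \<open>D\<close>.\<close>

lemma winding_near_infinity:
  fixes K :: "complex set"
  assumes "finite K" "continuous_on (- K) F" "\<And>z. z \<notin> K \<Longrightarrow> F z \<noteq> 0"
  shows "\<exists>R>0. \<exists>H. \<exists>D::int. continuous_on {z. R \<le> cmod z} H \<and>
    (\<forall>z. R \<le> cmod z \<longrightarrow> F z = z powi D * exp (H z)) \<and>
    (even D \<longleftrightarrow> even (card {k\<in>K. odd_point euclidean F k}))"
  using assms
proof (induction K arbitrary: F rule: finite_induct)
  case empty
  then have "continuous_on UNIV F" "\<And>z. z \<in> UNIV \<Longrightarrow> F z \<noteq> 0" by auto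
  then obtain g where "continuous_on UNIV g" "\<And>z. z \<in> UNIV \<Longrightarrow> F z = exp (g z)"
    by (rule continuous_logarithm_on_contractible[OF _ contractible_UNIV]) (use that in blast)+
  then show ?case
    by (intro exI[of _ 1] conjI exI[of _ g] exI[of _ 0]) (auto intro: continuous_on_subset)
next
  case (insert k K)
  have "open (- K)" using insert.hyps(1) by (simp add: finite_imp_closed open_Compl)
  then obtain r where r: "r > 0" "ball k r \<inter> K = {}"
    using insert.hyps(2) by (meson ComplI openE disjoint_eq_subset_Compl)
  have cF: "continuous_on (ball k r - {k}) F" "\<And>z. z \<in> ball k r - {k} \<Longrightarrow> F z \<noteq> 0"
    using r insert.prems(1) by (blast intro: continuous_on_subset) (use r insert.prems(2) in blast)
  then obtain d h where h: "continuous_on (ball k r - {k}) h"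
    "\<And>z. z \<in> ball k r - {k} \<Longrightarrow> F z = (z - k) powi d * exp (h z)"
    using punctured_ball_log[OF r(1)] by metis
  \<comment> \<open>It is 0 up to radius \<open>r / 4\<close> and 1 from radius \<open>r / 2\<close>
    on. So \<open>F1\<close> is 1 near \<open>k\<close>, whatever the value of \<open>h\<close> at
    \<open>k\<close>, and equals the quotient near the rim of the disc.\<close>
  define \<theta> where "\<theta> z = max 0 (min 1 (4 * dist k z / r - 1))" for z
  define F1 where "F1 z = (if z \<in> ball k r then exp (of_real (\<theta> z) * h z) else F z * (z - k) powi (- d))" for z
  have F1b: "F1 z = F z * (z - k) powi (- d)" if "z \<notin> cball k (r / 2)" for z
  proof (cases "z \<in> ball k r")
    case True
    then have z: "z \<in> ball k r - {k}" "z - k \<noteq> 0" using that r(1) by auto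
    have "4 * dist k z / r - 1 \<ge> 1" using that r(1) by (simp add: field_simps)
    then have "\<theta> z = 1" by (simp add: \<theta>_def)
    moreover have "(z - k) powi d * (z - k) powi - d = 1" using z(2) by (simp add: power_int_minus)
    ultimately show ?thesis using True h(2)[OF z(1)] by (simp add: F1_def mult.assoc mult.left_commute)
  qed (simp add: F1_def)
  have F1nz: "F1 z \<noteq> 0" if "z \<notin> K" for z
  proof (cases "z \<in> ball k r")
    case False
    then have "z \<noteq> k" using r(1) by auto
    then show ?thesis using False that insert.prems(2)[of z] by (simp add: F1_def power_int_not_zero)
  qed (simp add: F1_def)
  have cF1: "continuous_on (- K) F1"
  proof -
    have 1: "continuous_on (ball k r) F1"
    proof -
      have "continuous_on (ball k (r / 4)) (\<lambda>z. 1::complex)" by simp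
      then have a: "continuous_on (ball k (r / 4)) F1"
        by (rule continuous_on_eq) (use r(1) in \<open>auto simp: F1_def \<theta>_def field_simps\<close>)
      have "continuous_on (ball k r - {k}) (\<lambda>z. exp (of_real (\<theta> z) * h z))"
        unfolding \<theta>_def using r(1) by (intro continuous_intros h) auto
      then have b: "continuous_on (ball k r - {k}) F1"
        by (rule continuous_on_eq) (auto simp: F1_def)
      have "continuous_on (ball k (r / 4) \<union> (ball k r - {k})) F1"
        by (rule continuous_on_open_Un[OF _ _ a b]) auto
      moreover have "ball k (r / 4) \<union> (ball k r - {k}) = ball k r" using r(1) by auto
      ultimately show ?thesis by simp
    qed
    have "continuous_on (- (K \<union> cball k (r / 2))) (\<lambda>z. F z * (z - k) powi (- d))"
      by (intro continuous_intros continuous_on_subset[OF insert.prems(1)]) (use r(1) in auto)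
    then have 2: "continuous_on (- (K \<union> cball k (r / 2))) F1"
      by (rule continuous_on_eq) (use F1b in auto)
    have "continuous_on (ball k r \<union> - (K \<union> cball k (r / 2))) F1"
      by (rule continuous_on_open_Un[OF _ _ 1 2])
        (use insert.hyps(1) in \<open>auto simp: finite_imp_closed intro!: open_Compl closed_Un\<close>)
    moreover have "ball k r \<union> - (K \<union> cball k (r / 2)) = - K" using r by auto
    ultimately show ?thesis by simp
  qed
  have "\<exists>R>0. \<exists>H. \<exists>D::int. continuous_on {z. R \<le> cmod z} H \<and>
      (\<forall>z. R \<le> cmod z \<longrightarrow> F1 z = z powi D * exp (H z)) \<and>
      (even D \<longleftrightarrow> even (card {k\<in>K. odd_point euclidean F1 k}))"
    by (rule insert.IH) (use cF1 F1nz in auto)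
  then obtain R H D where R: "R > 0" "continuous_on {z. R \<le> cmod z} H"
    "\<forall>z. R \<le> cmod z \<longrightarrow> F1 z = z powi D * exp (H z)"
    "even D \<longleftrightarrow> even (card {k\<in>K. odd_point euclidean F1 k})" by (elim exE conjE) (rule that; assumption)
  \<comment> \<open>Near another puncture the division changes \<open>F\<close> only by a continuous
    factor without zeros.\<close>
  have same: "odd_point euclidean F1 k' \<longleftrightarrow> odd_point euclidean F k'" if k': "k' \<in> K" for k'
  proof -
    have "open (- ((insert k K - {k'}) \<union> cball k (r / 2)))"
      by (intro open_Compl closed_Un closed_cball finite_imp_closed) (use insert.hyps(1) in auto)
    moreover have k'b: "k' \<notin> cball k (r / 2)"
      using k' r by (auto simp: disjoint_iff)
    then have "k' \<in> - ((insert k K - {k'}) \<union> cball k (r / 2))" by simp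
    ultimately obtain q where q: "q > 0" "ball k' q \<subseteq> - ((insert k K - {k'}) \<union> cball k (r / 2))"
      by (meson openE)
    have kq: "k \<notin> ball k' q" using q(2) k' insert.hyps(2) by auto
    have E: "continuous_on (ball k' q) (\<lambda>z. (z - k) powi (- d))" "\<And>z. z \<in> ball k' q \<Longrightarrow> (z - k) powi (- d) \<noteq> 0"
      using kq by (auto intro!: continuous_intros simp: power_int_not_zero)
    have "odd_point euclidean F1 k' \<longleftrightarrow> odd_point euclidean (\<lambda>z. F z * (z - k) powi (- d)) k'"
      by (rule odd_point_cong[OF q(1)]) (use F1b q(2) in auto)
    also have "\<dots> \<longleftrightarrow> (odd_point euclidean F k' \<noteq> odd_point euclidean (\<lambda>z. (z - k) powi (- d)) k')"
    proof (rule odd_point_mult[OF q(1)])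
      show "continuous_on (ball k' q - {k'}) F"
        by (rule continuous_on_subset[OF insert.prems(1)]) (use q(2) in auto)
      show "F z \<noteq> 0 \<and> (z - k) powi - d \<noteq> 0" if "z \<in> ball k' q - {k'}" for z
      proof -
        have "z \<in> - ((insert k K - {k'}) \<union> cball k (r / 2))" "z \<noteq> k'" using that q(2) by blast+
        then show ?thesis using insert.prems(2)[of z] E(2)[of z] that by auto
      qed
    qed (use E in \<open>auto intro: continuous_on_subset\<close>)
    also have "\<dots> \<longleftrightarrow> odd_point euclidean F k'"
      using not_odd_point_continuous[OF q(1) E] by simp
    finally show ?thesis .
  qed
  have oddk: "odd_point euclidean F k \<longleftrightarrow> odd d" by (rule odd_point_powi_exp[OF r(1) h])
  have "{k'\<in>insert k K. odd_point euclidean F k'} =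
      {k'\<in>K. odd_point euclidean F1 k'} \<union> (if odd d then {k} else {})"
    using same oddk by auto
  then have "card {k'\<in>insert k K. odd_point euclidean F k'} =
      card {k'\<in>K. odd_point euclidean F1 k'} + (if odd d then 1 else 0)"
    using insert.hyps by simp
  then have par: "even (D + d) \<longleftrightarrow> even (card {k'\<in>insert k K. odd_point euclidean F k'})"
    using R(4) by auto
  \<comment> \<open>Beyond this radius \<open>k / z\<close> has modulus below 1, so
    \<open>1 - k / z\<close> stays in the right half-plane, where \<open>Ln\<close> is continuous.
    The margin \<open>r + 1\<close> also keeps \<open>z\<close> outside the altered disc.\<close>
  define R' where "R' = max R (cmod k + r + 1)"
  have R': "R' \<ge> R" "R' > 0" "\<And>z. R' \<le> cmod z \<Longrightarrow> cmod z > cmod k \<and> z \<noteq> 0 \<and> z \<notin> cball k (r / 2)"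
  proof -
    show "R' \<ge> R" "R' > 0" using R(1) by (auto simp: R'_def)
    fix z assume z: "R' \<le> cmod z"
    have "dist k z \<ge> cmod z - cmod k" by (metis dist_norm norm_minus_commute norm_triangle_ineq2)
    moreover have "cmod z \<ge> cmod k + r + 1" using z by (simp add: R'_def)
    ultimately show "cmod z > cmod k \<and> z \<noteq> 0 \<and> z \<notin> cball k (r / 2)"
      using r(1) by auto (smt (verit) norm_ge_zero)
  qed
  have Re: "Re (1 - k / z) > 0" if "R' \<le> cmod z" for z
  proof -
    have "cmod (k / z) < 1" using R'(3)[OF that] by (simp add: norm_divide)
    then show ?thesis using complex_Re_le_cmod[of "k / z"] by simp
  qed
  show ?case
  proof (intro exI conjI allI impI)
    show "R' > 0" by fact
    show "continuous_on {z. R' \<le> cmod z} (\<lambda>z. H z + of_int d * Ln (1 - k / z))"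
    proof (intro continuous_intros continuous_on_subset[OF R(2)])
      show "1 - k / z \<notin> \<real>\<^sub>\<le>\<^sub>0" if "z \<in> {z. R' \<le> cmod z}" for z
        using Re[of z] that by (auto simp: complex_nonpos_Reals_iff)
    qed (use R' in auto)
    show "even (D + d) \<longleftrightarrow> even (card {k'\<in>insert k K. odd_point euclidean F k'})" by (rule par)
    fix z assume z: "R' \<le> cmod z"
    have nz: "z \<noteq> 0" "z - k \<noteq> 0" "1 - k / z \<noteq> 0" using R'(3)[OF z] Re[OF z] by auto
    have "F z = F1 z * (z - k) powi d"
      using F1b[of z] R'(3)[OF z] nz by (simp add: power_int_minus)
    also have "F1 z = z powi D * exp (H z)" using R(3) z R'(1) by simp
    also have "(z - k) = z * (1 - k / z)" using nz by (simp add: field_simps)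
    also have "(z * (1 - k / z)) powi d = z powi d * exp (of_int d * Ln (1 - k / z))"
    proof -
      have "exp (of_int d * Ln (1 - k / z)) = exp (Ln (1 - k / z)) powi d" by (simp only: exp_power_int mult.commute)
      then show ?thesis using nz by (simp add: power_int_mult_distrib)
    qed
    finally show "F z = z powi (D + d) * exp (H z + of_int d * Ln (1 - k / z))"
      using nz by (simp add: power_int_add exp_add mult_ac)
  qed
qed

text \<open>On a large circle \<open>F\<close> is 1, so its logarithm obtained from \<open>D\<close>
  and \<open>H\<close> is constant. A full turn would change it by 2 pi i D; hence
  \<open>D = 0\<close>.\<close>

lemma even_odd_points_plane:
  fixes K :: "complex set"
  assumes "finite K" "continuous_on (- K) F" "\<And>z. z \<notin> K \<Longrightarrow> F z \<noteq> 0"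
    and one: "\<And>z. R \<le> cmod z \<Longrightarrow> F z = 1"
  shows "even (card {k\<in>K. odd_point euclidean F k})"
proof -
  obtain R' H D where R': "R' > 0" "continuous_on {z. R' \<le> cmod z} H"
    "\<forall>z. R' \<le> cmod z \<longrightarrow> F z = z powi D * exp (H z)"
    "even D \<longleftrightarrow> even (card {k\<in>K. odd_point euclidean F k})"
  proof -
    have "\<exists>R>0. \<exists>H. \<exists>D::int. continuous_on {z. R \<le> cmod z} H \<and>
      (\<forall>z. R \<le> cmod z \<longrightarrow> F z = z powi D * exp (H z)) \<and>
      (even D \<longleftrightarrow> even (card {k\<in>K. odd_point euclidean F k}))"
      by (rule winding_near_infinity) (use assms(1-3) in auto)
    then show ?thesis by (elim exE conjE) (rule that; assumption)
  qed
  define q where "q = max R R'"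
  have q: "q > 0" "q \<ge> R" "q \<ge> R'" using R'(1) by (auto simp: q_def)
  define p where "p t = of_real q * exp (\<i> * of_real t)" for t :: real
  have np: "cmod (p t) = q" for t using q(1) by (simp add: p_def norm_mult)
  define f where "f t = of_int D * (of_real (ln q) + \<i> * of_real t) + H (p t)" for t :: real
  have "continuous_on UNIV (\<lambda>t. H (p t))"
    by (rule continuous_on_compose2[OF R'(2)]) (use np q in \<open>auto simp: p_def[abs_def] intro!: continuous_intros\<close>)
  then have "continuous_on UNIV f" unfolding f_def by (intro continuous_intros)
  moreover have "exp (f t) = 1" for t
  proof -
    have "exp (of_real (ln q) + \<i> * of_real t) = p t"
      using q(1) by (simp add: p_def exp_add exp_of_real)
    then have "exp (of_int D * (of_real (ln q) + \<i> * of_real t)) = p t powi D"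
      by (metis exp_power_int mult.commute)
    then have "exp (f t) = p t powi D * exp (H (p t))" by (simp add: f_def exp_add)
    also have "\<dots> = F (p t)" using R'(3) np q by simp
    finally show ?thesis using one np q by simp
  qed
  ultimately obtain c where "\<And>t. f t = c"
    using exp_eq_1_constant[OF connected_UNIV, of f] by auto
  then have "f 0 = f (2 * pi)" by metis
  moreover have "p (2 * pi) = p 0" by (simp add: p_def mult.commute)
  ultimately have "D = 0" by (simp add: f_def)
  then show ?thesis using R'(4) by simp
qed

section \<open>Parity of odd points on a surface\<close>

lemma continuous_map_closed_Un:
  assumes "closedin X A" "closedin X B" "topspace X \<subseteq> A \<union> B"
    "continuous_map (subtopology X A) Y f" "continuous_map (subtopology X B) Y f"
  shows "continuous_map X Y f"
proof (rule pasting_lemma_closed[where I="{A, B}" and T="\<lambda>A. A" and f="\<lambda>_. f"])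
  show "\<exists>j. j \<in> {A, B} \<and> x \<in> j \<and> f x = f x" if "x \<in> topspace X" for x using that assms(3) by auto
qed (use assms in auto)

lemma continuous_map_open_Un:
  assumes "openin X A" "openin X B" "topspace X \<subseteq> A \<union> B"
    "continuous_map (subtopology X A) Y f" "continuous_map (subtopology X B) Y f"
  shows "continuous_map X Y f"
proof (rule pasting_lemma[where I="{A, B}" and T="\<lambda>A. A" and f="\<lambda>_. f"])
  show "\<exists>j. j \<in> {A, B} \<and> x \<in> j \<and> f x = f x" if "x \<in> topspace X" for x using that assms(3) by auto
qed (use assms in auto)

section \<open>Open discs in a surface and the passage from the plane to the surface\<close>

definition plane_patch :: "'a topology \<Rightarrow> (complex \<Rightarrow> 'a) \<Rightarrow> bool" where
  "plane_patch X p \<longleftrightarrow> continuous_map euclidean X p \<and> open_map euclidean X p \<and> inj p"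

lemma plane_patch_open: "plane_patch X p \<Longrightarrow> open U \<Longrightarrow> openin X (p ` U)"
  unfolding plane_patch_def open_map_def by simp

lemma plane_patch_vimage_open: "plane_patch X p \<Longrightarrow> openin X U \<Longrightarrow> open (p -` U)"
  unfolding plane_patch_def using openin_continuous_map_preimage[of euclidean X p U] by (simp add: vimage_def)

lemma plane_patch_vimage_closed: "plane_patch X p \<Longrightarrow> closedin X U \<Longrightarrow> closed (p -` U)"
  unfolding plane_patch_def using closedin_continuous_map_preimage[of euclidean X p U] by (simp add: vimage_def)

lemma plane_patch_topspace: "plane_patch X p \<Longrightarrow> p z \<in> topspace X"
  unfolding plane_patch_def continuous_map_def by auto

lemma plane_patch_compact: "plane_patch X p \<Longrightarrow> compact C \<Longrightarrow> compactin X (p ` C)"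
  unfolding plane_patch_def using image_compactin[of euclidean C X p] by simp

lemma plane_patch_homeomorphic: 
  assumes "plane_patch X p"
  shows "homeomorphic_map euclidean (subtopology X (range p)) p"
proof -
  have "embedding_map euclidean X p"
    using assms unfolding plane_patch_def by (simp add: injective_open_imp_embedding_map)
  then show ?thesis by (simp add: embedding_map_def)
qed

lemma plane_patch_inverse: 
  assumes "plane_patch X p"
  shows "continuous_map (subtopology X (range p)) euclidean (inv_into UNIV p)"
proof -
  obtain g where g: "homeomorphic_maps euclidean (subtopology X (range p)) p g"
    using plane_patch_homeomorphic[OF assms] homeomorphic_map_maps by blast
  then have cg: "continuous_map (subtopology X (range p)) euclidean g" and gp: "\<And>z. g (p z) = z"
    by (auto simp: homeomorphic_maps_def)
  have "inj p" using assms by (simp add: plane_patch_def)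
  show ?thesis
    by (rule continuous_map_eq[OF cg]) (use gp \<open>inj p\<close> in auto)
qed

lemma plane_patch_vimage_compact: 
  assumes "plane_patch X p" "compactin X C" "C \<subseteq> range p"
  shows "compact (p -` C)"
proof -
  have "compactin euclidean (inv_into UNIV p ` C)"
    by (rule image_compactin[OF _ plane_patch_inverse[OF assms(1)]]) (use assms in \<open>simp add: compactin_subtopology\<close>)
  moreover have "inv_into UNIV p ` C = p -` C"
  proof -
    have "inj p" using assms(1) by (simp add: plane_patch_def)
    then show ?thesis using assms(3) by (auto simp: image_iff subset_iff) (metis rangeE inv_f_f)+
  qed
  ultimately show ?thesis by simp
qed

lemma odd_point_plane_patch:
  assumes p: "plane_patch X p"
  shows "odd_point X G (p z) \<longleftrightarrow> odd_point euclidean (\<lambda>z. G (p z)) z"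
proof -
  have inj: "inj p" using p by (simp add: plane_patch_def)
  have "(\<exists>U s. openin X U \<and> p z \<in> U \<and> continuous_map (subtopology X (U - {p z})) euclidean s \<and> (\<forall>x\<in>U - {p z}. (s x)\<^sup>2 = G x))
    \<longleftrightarrow> (\<exists>U s. open U \<and> z \<in> U \<and> continuous_on (U - {z}) s \<and> (\<forall>x\<in>U - {z}. (s x)\<^sup>2 = G (p x)))" (is "?L \<longleftrightarrow> ?R")
  proof
    assume ?L
    then obtain U s where U: "openin X U" "p z \<in> U" "continuous_map (subtopology X (U - {p z})) euclidean s"
      "\<forall>x\<in>U - {p z}. (s x)\<^sup>2 = G x" by blast
    have "continuous_map (top_of_set (p -` U - {z})) euclidean (s \<circ> p)"
    proof (rule continuous_map_compose[OF _ U(3)])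
      show "continuous_map (top_of_set (p -` U - {z})) (subtopology X (U - {p z})) p"
        using p inj unfolding plane_patch_def
        by (auto simp: continuous_map_in_subtopology continuous_map_from_subtopology inj_eq)
    qed
    then have "continuous_on (p -` U - {z}) (\<lambda>z. s (p z))" by (simp add: o_def)
    then show ?R
      using U plane_patch_vimage_open[OF p U(1)] inj
      by (intro exI[of _ "p -` U"] exI[of _ "\<lambda>z. s (p z)"]) (auto simp: inj_eq)
  next
    assume ?R
    then obtain U s where U: "open U" "z \<in> U" "continuous_on (U - {z}) s" "\<forall>x\<in>U - {z}. (s x)\<^sup>2 = G (p x)" by blast
    have "continuous_map (subtopology X (p ` U - {p z})) euclidean (s \<circ> inv_into UNIV p)"
    proof (rule continuous_map_compose)
      show "continuous_map (top_of_set (U - {z})) euclidean s" using U(3) by simp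
      have "continuous_map (subtopology X (p ` U - {p z})) euclidean (inv_into UNIV p)"
        by (rule continuous_map_from_subtopology_mono[OF plane_patch_inverse[OF p]]) auto
      moreover have "inv_into UNIV p \<in> topspace (subtopology X (p ` U - {p z})) \<rightarrow> U - {z}"
        using inj by auto
      ultimately show "continuous_map (subtopology X (p ` U - {p z})) (top_of_set (U - {z})) (inv_into UNIV p)"
        by (simp add: continuous_map_in_subtopology)
    qed
    then have "continuous_map (subtopology X (p ` U - {p z})) euclidean (\<lambda>x. s (inv_into UNIV p x))" by (simp add: o_def)
    then show ?L
      using U plane_patch_open[OF p U(1)] inj
      by (intro exI[of _ "p ` U"] exI[of _ "\<lambda>x. s (inv_into UNIV p x)"]) auto
  qed
  then show ?thesis by (simp add: odd_point_def)
qed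

lemma odd_point_local_cong:
  assumes "openin X V" "k \<in> V" "\<And>x. x \<in> V - {k} \<Longrightarrow> F x = G x" "odd_point X F k"
  shows "odd_point X G k"
  unfolding odd_point_def
proof (intro notI; elim exE conjE)
  fix U s assume U: "openin X U" "k \<in> U" "continuous_map (subtopology X (U - {k})) euclidean s" "\<forall>x\<in>U - {k}. (s x)\<^sup>2 = G x"
  have "openin X (U \<inter> V)" "k \<in> U \<inter> V" using U assms by auto
  moreover have "continuous_map (subtopology X (U \<inter> V - {k})) euclidean s"
    by (rule continuous_map_from_subtopology_mono[OF U(3)]) auto
  moreover have "\<forall>x\<in>U \<inter> V - {k}. (s x)\<^sup>2 = F x" using U(4) assms(3) by auto
  ultimately show False using assms(4) unfolding odd_point_def by blast
qed

text \<open>The sum of the two cardinalities exceeds that of the symmetric difference by twice that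
  of the intersection.\<close>

lemma even_card_sym_diff:
  assumes "finite A" "finite B" "even (card ((A - B) \<union> (B - A)))"
  shows "even (card A) \<longleftrightarrow> even (card B)"
proof -
  have "card ((A - B) \<union> (B - A)) = card (A - B) + card (B - A)"
    using assms by (intro card_Un_disjoint) auto
  moreover have "card A = card (A - B) + card (A \<inter> B)"
    using assms by (metis card_Diff_subset_Int card_mono Int_lower1 finite_Int le_add_diff_inverse2)
  moreover have "card B = card (B - A) + card (A \<inter> B)"
    using assms by (metis card_Diff_subset_Int card_mono Int_lower2 finite_Int le_add_diff_inverse2 inf_commute)
  ultimately show ?thesis using assms(3) by auto
qed

text \<open>The quotient of the two functions, read in the patch, is 1 far out and so has an even
  number of odd points in the plane. Since parity is additive, these are exactly the points that are
  odd for only one of the functions. Off the patch nothing changes.\<close>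

lemma odd_point_change_in_patch:
  fixes G G' :: "'a \<Rightarrow> complex"
  assumes X: "Hausdorff_space X" and p: "plane_patch X p"
    and K: "finite K" "finite K'"
    and G: "continuous_map (subtopology X (topspace X - K)) euclidean G" "\<And>x. x \<in> topspace X - K \<Longrightarrow> G x \<noteq> 0"
    and G': "continuous_map (subtopology X (topspace X - K')) euclidean G'" "\<And>x. x \<in> topspace X - K' \<Longrightarrow> G' x \<noteq> 0"
    and KX: "K \<subseteq> topspace X" "K' \<subseteq> topspace X"
    and same: "\<And>x. x \<in> topspace X - p ` cball 0 r \<Longrightarrow> G' x = G x" "K - p ` cball 0 r = K' - p ` cball 0 r"
  shows "even (card {k\<in>K. odd_point X G k}) \<longleftrightarrow> even (card {k\<in>K'. odd_point X G' k})"
proof -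
  have inj: "inj p" using p by (simp add: plane_patch_def)
  have pull: "continuous_on (- p -` C) (\<lambda>z. H (p z))" 
    if "continuous_map (subtopology X (topspace X - C)) euclidean H" for C and H :: "'a \<Rightarrow> complex"
  proof -
    have "continuous_map (top_of_set (- p -` C)) (subtopology X (topspace X - C)) p"
      using p plane_patch_topspace[OF p] unfolding plane_patch_def
      by (auto simp: continuous_map_in_subtopology continuous_map_from_subtopology)
    from continuous_map_compose[OF this that] show ?thesis by (simp add: o_def)
  qed
  define Z where "Z = p -` (K \<union> K')"
  have finZ: "finite Z" unfolding Z_def using K inj by (simp add: finite_vimageI)
  define F where "F z = G (p z)" for z
  define F' where "F' z = G' (p z)" for z
  have cF: "continuous_on (- p -` K) F" "\<And>z. z \<notin> p -` K \<Longrightarrow> F z \<noteq> 0"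
    using pull[OF G(1)] G(2) plane_patch_topspace[OF p] by (auto simp: F_def[abs_def])
  have cF': "continuous_on (- p -` K') F'" "\<And>z. z \<notin> p -` K' \<Longrightarrow> F' z \<noteq> 0"
    using pull[OF G'(1)] G'(2) plane_patch_topspace[OF p] by (auto simp: F'_def[abs_def])
  have fin: "finite (p -` K)" "finite (p -` K')" using K inj by (auto simp: finite_vimageI)
  have nodd: "\<not> odd_point euclidean H z" if C: "finite C" "continuous_on (- C) H" "\<And>z. z \<notin> C \<Longrightarrow> H z \<noteq> 0" "z \<notin> C" for H and z :: complex and C
  proof -
    have "open (- C)" using C(1) by (simp add: finite_imp_closed open_Compl)
    then obtain q where "q > 0" "ball z q \<subseteq> - C" using C(4) by (meson ComplI openE)
    then show ?thesis using C by (intro not_odd_point_continuous[of q]) (auto intro: continuous_on_subset)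
  qed
  have noddF: "z \<in> p -` K" if "odd_point euclidean F z" for z
    using nodd[OF fin(1) cF, of z] that by auto
  have noddF': "z \<in> p -` K'" if "odd_point euclidean F' z" for z
    using nodd[OF fin(2) cF', of z] that by auto
  have ZC: "- Z \<subseteq> - p -` K" "- Z \<subseteq> - p -` K'" by (auto simp: Z_def)
  have ZF: "F z \<noteq> 0" "F' z \<noteq> 0" if "z \<notin> Z" for z
    using that cF(2)[of z] cF'(2)[of z] by (auto simp: Z_def)
  define E where "E z = F' z * inverse (F z)" for z
  have cE: "continuous_on (- Z) E" "\<And>z. z \<notin> Z \<Longrightarrow> E z \<noteq> 0"
  proof -
    show "continuous_on (- Z) E" unfolding E_def
      by (intro continuous_intros continuous_on_subset[OF cF(1)] continuous_on_subset[OF cF'(1)] ZC)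
        (use ZF in auto)
    show "E z \<noteq> 0" if "z \<notin> Z" for z
      using ZF[OF that] by (simp add: E_def)
  qed
  have Eodd: "odd_point euclidean E z \<longleftrightarrow> (odd_point euclidean F' z \<noteq> odd_point euclidean F z)" for z
  proof -
    have "open (- (Z - {z}))" by (intro open_Compl finite_imp_closed) (use finZ in auto)
    then obtain q where q: "q > 0" "ball z q \<subseteq> - (Z - {z})" by (meson ComplI DiffE insertI1 openE)
    then have qZ: "ball z q - {z} \<subseteq> - Z" by auto
    have c: "continuous_on (ball z q - {z}) F" "continuous_on (ball z q - {z}) F'"
      using qZ ZC by (meson cF(1) cF'(1) continuous_on_subset order_trans)+
    have nz: "F w \<noteq> 0 \<and> F' w \<noteq> 0" if "w \<in> ball z q - {z}" for w
      using ZF[of w] that qZ by blast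
    have ci: "continuous_on (ball z q - {z}) (\<lambda>z. inverse (F z))"
      using c(1) nz by (intro continuous_intros) auto
    have 1: "odd_point euclidean E z \<longleftrightarrow> (odd_point euclidean F' z \<noteq> odd_point euclidean (\<lambda>z. inverse (F z)) z)"
      unfolding E_def by (rule odd_point_mult[OF q(1) c(2) ci]) (use nz in auto)
    \<comment> \<open>The product is 1 near \<open>z\<close>, off \<open>z\<close> itself, so
      \<open>inverse (F z)\<close> is odd exactly where \<open>F\<close> is. This turns the parity
      of the quotient into that of a product.\<close>
    have 2: "odd_point euclidean (\<lambda>z. F z * inverse (F z)) z \<longleftrightarrow> (odd_point euclidean F z \<noteq> odd_point euclidean (\<lambda>z. inverse (F z)) z)"
      by (rule odd_point_mult[OF q(1) c(1) ci]) (use nz in auto)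
    have "odd_point euclidean (\<lambda>z. F z * inverse (F z)) z \<longleftrightarrow> odd_point euclidean (\<lambda>z. 1) z"
      by (rule odd_point_cong[OF q(1)]) (use nz in auto)
    also have "\<dots> \<longleftrightarrow> False" using not_odd_point_continuous[of 1 z "\<lambda>_. 1"] by simp
    finally show ?thesis using 1 2 by simp
  qed
  obtain q where q: "\<And>z. z \<in> Z \<Longrightarrow> cmod z < q"
    using finite_imp_bounded[OF finZ] by (metis bounded_pos gt_ex le_less_trans)
  \<comment> \<open>Besides leaving the disc of radius \<open>r\<close>, the set \<open>Z\<close>
    has to be avoided: \<open>F\<close> may vanish there, and then the quotient is 0 instead of
    1.\<close>
  have E1: "E z = 1" if "max q (r + 1) \<le> cmod z" for z
  proof -
    have "z \<notin> Z" using q[of z] that by auto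
    then have "F z \<noteq> 0" by (rule ZF)
    moreover have "p z \<notin> p ` cball 0 r" using inj that by (auto simp: inj_eq)
    then have "F' z = F z" using same(1)[of "p z"] plane_patch_topspace[OF p] by (auto simp: F_def F'_def)
    ultimately show ?thesis by (simp add: E_def)
  qed
  have even: "even (card {z\<in>Z. odd_point euclidean E z})"
    by (rule even_odd_points_plane[OF finZ cE(1) cE(2) E1])
  define A where "A = {k\<in>K. odd_point X G k}"
  define B where "B = {k\<in>K'. odd_point X G' k}"
  have out: "x \<in> A \<longleftrightarrow> x \<in> B" if x: "x \<notin> range p" for x
  proof -
    have KK: "x \<in> K \<longleftrightarrow> x \<in> K'" using same(2) x by blast
    have op: "openin X (topspace X - p ` cball 0 r)"
      using compactin_imp_closedin[OF X plane_patch_compact[OF p compact_cball]] by blast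
    have "odd_point X G x \<longleftrightarrow> odd_point X G' x" if "x \<in> topspace X"
      using odd_point_local_cong[OF op, of x G G'] odd_point_local_cong[OF op, of x G' G] same(1) x that by auto
    then show ?thesis using KK KX by (auto simp: A_def B_def)
  qed
  have Ap: "p z \<in> A \<longleftrightarrow> odd_point euclidean F z" for z
    using odd_point_plane_patch[OF p, of G z] noddF[of z] unfolding A_def F_def[abs_def] by auto
  have Bp: "p z \<in> B \<longleftrightarrow> odd_point euclidean F' z" for z
    using odd_point_plane_patch[OF p, of G' z] noddF'[of z] unfolding B_def F'_def[abs_def] by auto
  have "(A - B) \<union> (B - A) = p ` {z\<in>Z. odd_point euclidean E z}"
  proof (intro equalityI subsetI)
    fix x assume x: "x \<in> (A - B) \<union> (B - A)"
    then obtain z where z: "x = p z" using out by blast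
    have "z \<in> Z" using x z by (auto simp: A_def B_def Z_def)
    then show "x \<in> p ` {z\<in>Z. odd_point euclidean E z}" using x z Ap Bp Eodd by auto
  qed (use Ap Bp Eodd in auto)
  then have "even (card ((A - B) \<union> (B - A)))"
    using even inj by (simp add: card_image inj_on_subset)
  then have "even (card A) \<longleftrightarrow> even (card B)"
    by (intro even_card_sym_diff) (use K in \<open>auto simp: A_def B_def\<close>)
  then show ?thesis by (simp add: A_def B_def)
qed

text \<open>Induction on the number of patches: on one patch \<open>G\<close> is altered, at the cost of finitely many new
  punctures, so that its support moves into the remaining patches; the number of odd points inside the
  circle where the alteration is glued in changes by an even number, by the planar case.\<close>

lemma even_card_odd_points:
  fixes X :: "'a topology" and P :: "(complex \<Rightarrow> 'a) set"
  assumes X: "Hausdorff_space X" and P: "finite P" "\<And>p. p \<in> P \<Longrightarrow> plane_patch X p"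
    and L: "compactin X L" "L \<subseteq> (\<Union>p\<in>P. range p)" and K: "finite K" "K \<subseteq> L"
    and G: "continuous_map (subtopology X (topspace X - K)) euclidean G"
      "\<And>x. x \<in> topspace X - K \<Longrightarrow> cmod (G x) = 1" "\<And>x. x \<in> topspace X - L \<Longrightarrow> G x = 1"
  shows "even (card {k\<in>K. odd_point X G k})"
  using P L K G
proof (induction P arbitrary: L K G rule: finite_induct)
  case empty
  then have "K = {}" by auto
  then show ?case by simp
next
  case (insert p P)
  have p: "plane_patch X p" using insert.prems(1) by simp
  have inj: "inj p" using p by (simp add: plane_patch_def)
  have LX: "L \<subseteq> topspace X" using insert.prems(2) compactin_subset_topspace by blast
  have KX: "K \<subseteq> topspace X" using insert.prems(5) LX by blast
  have Lc: "closedin X L" using X insert.prems(2) by (simp add: compactin_imp_closedin)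
  define O' where "O' = (\<Union>p\<in>P. range p)"
  have opO: "openin X O'" unfolding O'_def
    by (intro openin_Union ballI) (use insert.prems(1) plane_patch_open[OF _ open_UNIV] in auto)
  have LO: "compactin X (L - O')"
  proof -
    have "closedin X (topspace X - O')" using opO by blast
    moreover have "L - O' = L \<inter> (topspace X - O')" using LX by blast
    ultimately show ?thesis using insert.prems(2) compact_Int_closedin by metis
  qed
  have "compact (p -` (L - O'))"
    by (rule plane_patch_vimage_compact[OF p LO]) (use insert.prems(3) in \<open>auto simp: O'_def\<close>)
  \<comment> \<open>The part of \<open>L\<close> that only \<open>p\<close> covers is compact, hence
    lies in a disc of the patch. This is the part of the support that has to be cleared.\<close>
  then obtain r0 where r0: "\<And>z. p z \<in> L - O' \<Longrightarrow> cmod z \<le> r0" "r0 > 0"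
    using compact_imp_bounded bounded_pos by (metis vimageI)
  have fin: "finite (p -` K)" using insert.prems(4) inj by (simp add: finite_vimageI)
  \<comment> \<open>A circle around that disc which avoids the finitely many punctures:
    \<open>G\<close> is continuous on it, and wherever it meets \<open>L\<close> it lies in the
    other patches.\<close>
  have "infinite ({r0<..} - cmod ` (p -` K))"
    using fin by (intro Diff_infinite_finite) (auto simp: infinite_Ioi)
  then obtain r where r: "r > r0" "r \<notin> cmod ` (p -` K)"
    by (meson Diff_iff finite.emptyI greaterThan_iff finite_subset subsetI)
  define Z0 where "Z0 = sphere 0 r \<inter> p -` L"
  have cZ0: "compact Z0" unfolding Z0_def using plane_patch_vimage_closed[OF p Lc] by (simp add: compact_Int_closed)
  have Z0O: "Z0 \<subseteq> p -` O'" using r0(1) r(1) by (fastforce simp: Z0_def)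
  have opV: "open (p -` O')" by (rule plane_patch_vimage_open[OF p opO])
  obtain e where e: "e > 0" "(\<Union>x\<in>Z0. ball x e) \<subseteq> p -` O'"
    using compact_subset_open_imp_ball_epsilon_subset[OF cZ0 opV Z0O] by blast
  \<comment> \<open>Half of \<open>e\<close> leaves room for a compact neighbourhood
    \<open>Wc\<close> of \<open>Z0\<close> still inside the other patches. The new support in the
    disc will be confined to it.\<close>
  define W where "W = (\<Union>x\<in>Z0. ball x (e / 2))"
  define Wc where "Wc = (\<Union>x\<in>Z0. cball x (e / 2))"
  have W: "open W" "W \<subseteq> Wc" "Z0 \<subseteq> W" using e(1) by (auto simp: W_def Wc_def)
  have Wc: "compact Wc" "Wc \<subseteq> p -` O'"
  proof -
    show "compact Wc" unfolding Wc_def by (rule compact_minkowski_sum_cball[OF cZ0])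
    have "cball x (e / 2) \<subseteq> ball x e" for x :: complex using e(1) by auto
    then show "Wc \<subseteq> p -` O'" unfolding Wc_def using e(2) by blast
  qed
  \<comment> \<open>Values are prescribed to be those of \<open>G\<close> on the circle and 1 on the
    disc away from \<open>W\<close>. They fit together because \<open>G\<close> is 1 on the circle
    outside \<open>L\<close>.\<close>
  define Y where "Y = (cball 0 r - W) \<union> sphere 0 r"
  define f where "f z = (if cmod z = r then G (p z) else 1)" for z
  have cY: "compact Y" unfolding Y_def using W(1) by (simp add: compact_Un compact_diff)
  have sph: "p z \<in> topspace X - K" if "cmod z = r" for z
    using r(2) that plane_patch_topspace[OF p] by auto
  have f1: "f z = 1" if "z \<in> cball 0 r - W" for z
  proof (cases "cmod z = r")
    case True
    then have "p z \<notin> L" using that W(3) by (auto simp: Z0_def)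
    then show ?thesis using True insert.prems(8)[of "p z"] plane_patch_topspace[OF p] by (simp add: f_def)
  qed (simp add: f_def)
  have cf: "continuous_on Y f" unfolding Y_def
  proof (rule continuous_on_closed_Un)
    show "closed (cball 0 r - W)" using W(1) by (simp add: closed_Diff)
    show "continuous_on (cball 0 r - W) f"
      by (rule continuous_on_eq[of _ "\<lambda>_. 1"]) (use f1 in auto)
    have "continuous_map (top_of_set (sphere 0 r)) (subtopology X (topspace X - K)) p"
      using p sph unfolding plane_patch_def
      by (auto simp: continuous_map_in_subtopology continuous_map_from_subtopology)
    from continuous_map_compose[OF this insert.prems(6)] have "continuous_on (sphere 0 r) (\<lambda>z. G (p z))"
      by (simp add: o_def)
    then show "continuous_on (sphere 0 r) f" by (rule continuous_on_eq) (auto simp: f_def)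
  qed auto
  have fim: "f \<in> Y \<rightarrow> sphere 0 1"
  proof
    fix z assume "z \<in> Y"
    then show "f z \<in> sphere 0 1" using f1[of z] insert.prems(7)[OF sph, of z] by (auto simp: Y_def f_def)
  qed
  \<comment> \<open>A map from a compact plane set to the circle extends to the plane minus finitely
    many points. The new punctures miss \<open>Y\<close>, so those in the disc lie in
    \<open>W\<close>; the others are discarded in \<open>K1\<close>.\<close>
  obtain K' g where g: "finite K'" "disjnt K' Y" "continuous_on (- K') g" "g \<in> (- K') \<rightarrow> sphere 0 1"
    "\<And>x. x \<in> Y \<Longrightarrow> g x = f x"
  proof (rule extend_map_UNIV_to_sphere_cofinite[of 1 Y f 0 UNIV])
    show "C \<inter> UNIV \<noteq> {}" if "C \<in> components (- Y)" for C using in_components_nonempty[OF that] by simp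
  qed (use cY cf fim that in auto)
  define K1 where "K1 = K' \<inter> cball 0 r"
  have K1W: "K1 \<subseteq> W \<inter> ball 0 r" using g(2) by (auto simp: K1_def Y_def disjnt_iff)
  define KK where "KK = (K - p ` cball 0 r) \<union> p ` K1"
  define G' where "G' x = (if x \<in> p ` cball 0 r then g (inv_into UNIV p x) else G x)" for x
  \<comment> \<open>Outside the open disc the old set remains, and inside only a neighbourhood of
    part of the circle is kept. Both pieces lie in the other patches, which lets the induction
    continue.\<close>
  define L' where "L' = (L - p ` ball 0 r) \<union> p ` (Wc \<inter> cball 0 r)"
  have G'p: "G' (p z) = g z" if "z \<in> cball 0 r" for z using that inj by (auto simp: G'_def)
  have clA: "closedin X (p ` cball 0 r)"
    using compactin_imp_closedin[OF X plane_patch_compact[OF p compact_cball]] .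
  have opB: "openin X (p ` ball 0 r)" by (rule plane_patch_open[OF p]) auto
  have cL': "compactin X L'"
  proof -
    have "L - p ` ball 0 r = L \<inter> (topspace X - p ` ball 0 r)" using LX by blast
    then have "compactin X (L - p ` ball 0 r)" using insert.prems(2) opB compact_Int_closedin
      by (metis closedin_diff closedin_topspace)
    moreover have "compactin X (p ` (Wc \<inter> cball 0 r))"
      by (rule plane_patch_compact[OF p]) (use Wc(1) in auto)
    ultimately show ?thesis unfolding L'_def by (rule compactin_Un)
  qed
  have L'O: "L' \<subseteq> (\<Union>p\<in>P. range p)"
  proof
    fix x assume x: "x \<in> L'"
    show "x \<in> (\<Union>p\<in>P. range p)"
    proof (cases "x \<in> p ` (Wc \<inter> cball 0 r)")
      case True
      then show ?thesis using Wc(2) by (auto simp: O'_def)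
    next
      case False
      then have xL: "x \<in> L" "x \<notin> p ` ball 0 r" using x by (auto simp: L'_def)
      have "x \<in> O'"
      proof (rule ccontr)
        assume "x \<notin> O'"
        moreover have "x \<in> range p \<union> O'" using xL(1) insert.prems(3) by (auto simp: O'_def)
        ultimately have "x \<in> range p" by blast
        then obtain z where z: "x = p z" by blast
        then have "cmod z \<le> r0" using r0(1)[of z] xL(1) \<open>x \<notin> O'\<close> by simp
        then show False using xL(2) z r(1) by auto
      qed
      then show ?thesis by (simp add: O'_def)
    qed
  qed
  have KK: "finite KK" "KK \<subseteq> L'"
  proof -
    show "finite KK" using insert.prems(4) g(1) by (simp add: KK_def K1_def)
    have "p ` ball 0 r \<subseteq> p ` cball 0 r" by auto
    then have "K - p ` cball 0 r \<subseteq> L - p ` ball 0 r" using insert.prems(5) by blast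
    moreover have "K1 \<subseteq> Wc \<inter> cball 0 r" using K1W W(2) by (auto simp: K1_def)
    ultimately show "KK \<subseteq> L'" unfolding KK_def L'_def by blast
  qed
  have KKX: "KK \<subseteq> topspace X" using KK(2) compactin_subset_topspace[OF cL'] by blast
  have pK: "p z \<in> KK \<longleftrightarrow> z \<in> K1" if "z \<in> cball 0 r" for z
    using that inj by (auto simp: KK_def inj_eq)
  have nG': "cmod (G' x) = 1" if "x \<in> topspace X - KK" for x
  proof (cases "x \<in> p ` cball 0 r")
    case True
    then obtain z where z: "x = p z" "z \<in> cball 0 r" by blast
    then have "z \<notin> K'" using that pK by (auto simp: K1_def)
    then show ?thesis using g(4) z G'p by (auto simp: Pi_iff)
  next
    case False
    then show ?thesis using that insert.prems(7)[of x] by (auto simp: G'_def KK_def)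
  qed
  have G'1: "G' x = 1" if "x \<in> topspace X - L'" for x
  proof (cases "x \<in> p ` cball 0 r")
    case True
    then obtain z where z: "x = p z" "z \<in> cball 0 r" by blast
    then have "z \<in> cball 0 r - W" using that W(2) by (auto simp: L'_def)
    then show ?thesis using f1[of z] g(5)[of z] z G'p by (simp add: Y_def)
  next
    case False
    then have "x \<notin> L" using that by (auto simp: L'_def)
    then show ?thesis using False that insert.prems(8)[of x] by (auto simp: G'_def)
  qed
  have cG': "continuous_map (subtopology X (topspace X - KK)) euclidean G'"
  proof (rule continuous_map_closed_Un)
    let ?X = "subtopology X (topspace X - KK)"
    show "closedin ?X (topspace X \<inter> p ` cball 0 r - KK)"
    proof -
      have "closedin ?X ((topspace X - KK) \<inter> p ` cball 0 r)"
        using clA by (rule closedin_subtopology_Int_closed)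
      moreover have "(topspace X - KK) \<inter> p ` cball 0 r = topspace X \<inter> p ` cball 0 r - KK" by blast
      ultimately show ?thesis by simp
    qed
    show "closedin ?X (topspace X - p ` ball 0 r - KK)"
    proof -
      have "closedin X (topspace X - p ` ball 0 r)" using opB by blast
      then have "closedin ?X ((topspace X - KK) \<inter> (topspace X - p ` ball 0 r))"
        by (rule closedin_subtopology_Int_closed)
      moreover have "(topspace X - KK) \<inter> (topspace X - p ` ball 0 r) = topspace X - p ` ball 0 r - KK" by blast
      ultimately show ?thesis by simp
    qed
    have "p ` ball 0 r \<subseteq> p ` cball 0 r" by auto
    then show "topspace ?X \<subseteq> (topspace X \<inter> p ` cball 0 r - KK) \<union> (topspace X - p ` ball 0 r - KK)" by auto
    have "continuous_map (subtopology X (p ` cball 0 r - KK)) euclidean (g \<circ> inv_into UNIV p)"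
    proof (rule continuous_map_compose)
      show "continuous_map (top_of_set (- K')) euclidean g" using g(3) by simp
      have "continuous_map (subtopology X (p ` cball 0 r - KK)) euclidean (inv_into UNIV p)"
        by (rule continuous_map_from_subtopology_mono[OF plane_patch_inverse[OF p]]) auto
      moreover have "inv_into UNIV p \<in> topspace (subtopology X (p ` cball 0 r - KK)) \<rightarrow> - K'"
        using inj pK by (auto simp: K1_def)
      ultimately show "continuous_map (subtopology X (p ` cball 0 r - KK)) (top_of_set (- K')) (inv_into UNIV p)"
        by (simp add: continuous_map_in_subtopology)
    qed
    then have "continuous_map (subtopology X (p ` cball 0 r - KK)) euclidean G'"
      by (rule continuous_map_eq) (auto simp: G'_def)
    then show "continuous_map (subtopology ?X (topspace X \<inter> p ` cball 0 r - KK)) euclidean G'"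
      unfolding subtopology_subtopology by (rule continuous_map_from_subtopology_mono) blast
    have "continuous_map (subtopology X (topspace X - p ` ball 0 r - KK)) euclidean G"
    proof (rule continuous_map_from_subtopology_mono[OF insert.prems(6)])
      show "topspace X - p ` ball 0 r - KK \<subseteq> topspace X - K"
      proof
        fix x assume x: "x \<in> topspace X - p ` ball 0 r - KK"
        have "x \<notin> K"
        proof
          assume "x \<in> K"
          then obtain z where "x = p z" "z \<in> cball 0 r" using x by (auto simp: KK_def)
          moreover then have "cmod z = r" using x by (auto simp: less_le)
          ultimately show False using sph \<open>x \<in> K\<close> by blast
        qed
        then show "x \<in> topspace X - K" using x by blast
      qed
    qed
    then have "continuous_map (subtopology X (topspace X - p ` ball 0 r - KK)) euclidean G'"
    proof (rule continuous_map_eq)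
      fix x assume x: "x \<in> topspace (subtopology X (topspace X - p ` ball 0 r - KK))"
      show "G x = G' x"
      proof (cases "x \<in> p ` cball 0 r")
        case True
        then obtain z where z: "x = p z" "z \<in> cball 0 r" by blast
        then have "cmod z = r" using x by (auto simp: less_le)
        then show ?thesis using z G'p g(5)[of z] by (simp add: f_def Y_def)
      qed (simp add: G'_def)
    qed
    then show "continuous_map (subtopology ?X (topspace X - p ` ball 0 r - KK)) euclidean G'"
      unfolding subtopology_subtopology by (rule continuous_map_from_subtopology_mono) blast
  qed
  have "even (card {k\<in>KK. odd_point X G' k})"
    by (rule insert.IH[OF _ cL' L'O KK cG' nG' G'1]) (use insert.prems(1) in auto)
  moreover have "even (card {k\<in>K. odd_point X G k}) \<longleftrightarrow> even (card {k\<in>KK. odd_point X G' k})"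
  proof (rule odd_point_change_in_patch[OF X p insert.prems(4) KK(1) insert.prems(6) _ cG' _ KX KKX])
    show "G x \<noteq> 0" if "x \<in> topspace X - K" for x using insert.prems(7)[OF that] by auto
    show "G' x \<noteq> 0" if "x \<in> topspace X - KK" for x using nG'[OF that] by auto
    show "G' x = G x" if "x \<in> topspace X - p ` cball 0 r" for x using that by (simp add: G'_def)
    show "K - p ` cball 0 r = KK - p ` cball 0 r" by (auto simp: KK_def K1_def)
  qed
  ultimately show ?case by simp
qed

section \<open>Connectedness of the core far out in dimension at least 3\<close>

lemma connected_if_segments:
  fixes S :: "(nat \<Rightarrow> real) set"
  assumes "\<And>x y t. x \<in> S \<Longrightarrow> y \<in> S \<Longrightarrow> 0 \<le> t \<Longrightarrow> t \<le> 1 \<Longrightarrow> (\<lambda>j. (1 - t) * x j + t * y j) \<in> S"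
  shows "connected S"
  unfolding connected_iff_connected_component
proof (intro ballI)
  fix x y assume xy: "x \<in> S" "y \<in> S"
  let ?f = "\<lambda>t j. (1 - t) * x j + t * y j"
  have "continuous_on {0..1} ?f"
    by (rule continuous_on_coordinatewise_then_product) (intro continuous_intros)
  then have "connected (?f ` {0..1})" by (intro connected_continuous_image) auto
  moreover have "?f ` {0..1} \<subseteq> S" using assms xy by auto
  moreover have "x \<in> ?f ` {0..1}" by (rule image_eqI[of _ _ 0]) auto
  moreover have "y \<in> ?f ` {0..1}" by (rule image_eqI[of _ _ 1]) auto
  ultimately show "connected_component S x y" unfolding connected_component_def by blast
qed

text \<open>The complement is a union of open half-spaces \<open>H j \<sigma>\<close>, two for each
  coordinate. Half-spaces for different coordinates intersect; two for the same coordinate are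
  linked through another one, which exists because \<open>m \<ge> 2\<close>.\<close>

lemma connected_complement_cube:
  assumes m: "m \<ge> 2" and s: "s \<ge> 0"
  shows "connected (coords m - cube m s)"
proof -
  let ?S = "coords m - cube m s"
  define H where "H j \<sigma> = {y \<in> coords m. s < \<sigma> * y j}" for j :: nat and \<sigma> :: real
  have HS: "H j \<sigma> \<subseteq> ?S" if "j < m" "\<sigma> \<in> {1, -1}" for j \<sigma>
  proof
    fix y assume y: "y \<in> H j \<sigma>"
    then have "\<not> \<bar>y j\<bar> \<le> s" using that(2) by (auto simp: H_def)
    then show "y \<in> ?S" using y that(1) by (auto simp: H_def cube_eq)
  qed
  have SH: "\<exists>j<m. \<exists>\<sigma>\<in>{1, -1}. y \<in> H j \<sigma>" if y: "y \<in> ?S" for y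
  proof -
    obtain j where j: "j < m" "\<bar>y j\<bar> > s" using y by (auto simp: cube_eq not_le)
    then have "y j > s \<or> - y j > s" by linarith
    then have "y \<in> H j 1 \<or> y \<in> H j (-1)" using y by (auto simp: H_def)
    then show ?thesis using j(1) by blast
  qed
  have Hc: "connected (H j \<sigma>)" for j \<sigma>
  proof (rule connected_if_segments)
    fix x y t assume xy: "x \<in> H j \<sigma>" "y \<in> H j \<sigma>" "0 \<le> (t::real)" "t \<le> 1"
    have "(1 - t) * (- (\<sigma> * x j)) + t * (- (\<sigma> * y j)) < - s"
      using xy by (intro convex_bound_lt) (auto simp: H_def)
    then have "s < (1 - t) * (\<sigma> * x j) + t * (\<sigma> * y j)" by simp
    then show "(\<lambda>j. (1 - t) * x j + t * y j) \<in> H j \<sigma>" using xy by (auto simp: H_def algebra_simps)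
  qed
  have link: "connected_component ?S x y" if x: "x \<in> H j \<sigma>" and y: "y \<in> H k \<tau>"
    and jk: "j < m" "k < m" "j \<noteq> k" "\<sigma> \<in> {1, -1}" "\<tau> \<in> {1, -1}" for x y j k \<sigma> \<tau>
  proof -
    define p where "p = (\<lambda>i. if i = j then \<sigma> * (s + 1) else if i = k then \<tau> * (s + 1) else 0)"
    have "p \<in> H j \<sigma> \<inter> H k \<tau>" using jk by (auto simp: H_def p_def)
    then have "connected (H j \<sigma> \<union> H k \<tau>)" by (intro connected_Un Hc) blast
    then show ?thesis unfolding connected_component_def
      using x y HS[OF jk(1,4)] HS[OF jk(2,5)] by (intro exI[of _ "H j \<sigma> \<union> H k \<tau>"]) auto
  qed
  show ?thesis
    unfolding connected_iff_connected_component
  proof (intro ballI)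
    fix x y assume "x \<in> ?S" "y \<in> ?S"
    then obtain j \<sigma> k \<tau> where x: "j < m" "\<sigma> \<in> {1, -1}" "x \<in> H j \<sigma>" and y: "k < m" "\<tau> \<in> {1, -1}" "y \<in> H k \<tau>"
      using SH by meson
    show "connected_component ?S x y"
    proof (cases "j = k")
      case False
      then show ?thesis using link x y by blast
    next
      case True
      define l where "l = (if j = 0 then 1 else 0 :: nat)"
      have l: "l < m" "l \<noteq> j" "l \<noteq> k" using m True by (auto simp: l_def)
      define p where "p = (\<lambda>i. if i = l then s + 1 else 0)"
      have p: "p \<in> H l 1" using l by (auto simp: H_def p_def)
      have "connected_component ?S x p" using link[OF x(3) p] x l by auto
      moreover have "connected_component ?S p y" using link[OF p y(3)] y l by auto
      ultimately show ?thesis by (rule connected_component_trans)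
    qed
  qed
qed

section \<open>Cutoff functions and a planar model of odd degree\<close>

lemma bump_function:
  assumes X: "locally_compact_space X" "Hausdorff_space X" and K: "compactin X K"
  obtains U C and f :: "'a \<Rightarrow> real" where "openin X U" "K \<subseteq> U" "compactin X C"
    "continuous_map X euclideanreal f" "\<And>x. x \<in> topspace X \<Longrightarrow> 0 \<le> f x \<and> f x \<le> 1"
    "\<And>x. x \<in> U \<Longrightarrow> f x = 1" "\<And>x. x \<in> topspace X - C \<Longrightarrow> f x = 0"
proof -
  have cr: "completely_regular_space X"
    using X locally_compact_regular_imp_completely_regular_space by blast
  have nb: "\<And>K. compactin X K \<Longrightarrow> \<exists>U L. openin X U \<and> compactin X L \<and> closedin X L \<and> K \<subseteq> U \<and> U \<subseteq> L"
    using X locally_compact_space_compact_closed_compact by blast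
  \<comment> \<open>Two successive compact neighbourhoods are taken, so that \<open>f\<close> is 1
    on an open set around \<open>K\<close> and not only on \<open>K\<close>.\<close>
  obtain U L where U: "openin X U" "compactin X L" "K \<subseteq> U" "U \<subseteq> L" using nb[OF K] by blast
  obtain U' C where U': "openin X U'" "compactin X C" "L \<subseteq> U'" "U' \<subseteq> C" using nb[OF U(2)] by blast
  have "closedin X (topspace X - U')" using U'(1) by blast
  moreover have "disjnt L (topspace X - U')" using U'(3) by (auto simp: disjnt_def)
  ultimately obtain f where f: "continuous_map X (top_of_set {0..1::real}) f" "f ` (topspace X - U') \<subseteq> {0}" "f ` L \<subseteq> {1}"
    using Urysohn_completely_regular_compact_closed[OF _ cr U(2), of 0 1] by (metis zero_le_one)
  show thesis
  proof (rule that[OF U(1,3) U'(2)])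
    show "continuous_map X euclideanreal f" using f(1) by (simp add: continuous_map_in_subtopology)
    show "0 \<le> f x \<and> f x \<le> 1" if "x \<in> topspace X" for x
      using f(1) that by (auto simp: continuous_map_in_subtopology)
    show "f x = 1" if "x \<in> U" for x using f(3) U(4) that by auto
    show "f x = 0" if "x \<in> topspace X - C" for x using f(2) U'(4) that by blast
  qed
qed

text \<open>The set is star-shaped about a point \<open>a\<close> strictly inside the half-disc.
  Along a segment from \<open>a\<close> the height above the diameter is positive before the
  endpoint, so only the endpoint could be \<open>k\<close>.\<close>

lemma connected_half_punctured_ball:
  fixes k :: complex
  assumes "r > 0" "\<sigma> \<in> {1, -1 :: real}"
  shows "connected ({z \<in> ball k r. 0 \<le> \<sigma> * Im (z - k)} - {k})"
proof (rule starlike_imp_connected)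
  let ?H = "{z \<in> ball k r. 0 \<le> \<sigma> * Im (z - k)}"
  define a where "a = k + Complex 0 (\<sigma> * r / 2)"
  have nrm: "cmod (Complex 0 (\<sigma> * r / 2)) = r / 2" using assms by (auto simp: complex_norm)
  have a: "a \<in> ?H - {k}" "\<sigma> * Im (a - k) > 0"
    using assms nrm by (auto simp: a_def dist_norm complex_eq_iff)
  have "?H = ball k r \<inter> {z. \<sigma> * Im k \<le> \<sigma> * Im z}" by (auto simp: algebra_simps)
  moreover have "convex {z. \<sigma> * Im k \<le> \<sigma> * Im z}"
    using assms(2) convex_halfspace_Im_ge[of "Im k"] convex_halfspace_Im_le[of "Im k"] by auto
  ultimately have cH: "convex ?H" by (simp add: convex_Int)
  show "starlike (?H - {k})"
    unfolding starlike_def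
  proof (intro bexI[of _ a] ballI)
    fix z assume z: "z \<in> ?H - {k}"
    have "closed_segment a z \<subseteq> ?H" using cH a z by (intro closed_segment_subset) auto
    moreover have "k \<notin> closed_segment a z"
    proof
      assume "k \<in> closed_segment a z"
      then obtain u where u: "0 \<le> u" "u \<le> 1" "k = (1 - u) *\<^sub>R a + u *\<^sub>R z" by (auto simp: closed_segment_def)
      then have "Im k = (1 - u) * Im a + u * Im z" by simp
      moreover have "(1 - u) * (\<sigma> * Im (a - k)) + u * (\<sigma> * Im (z - k)) = \<sigma> * ((1 - u) * Im a + u * Im z - Im k)"
        by (simp add: algebra_simps)
      ultimately have "0 = (1 - u) * (\<sigma> * Im (a - k)) + u * (\<sigma> * Im (z - k))" by simp
      moreover have "0 \<le> u * (\<sigma> * Im (z - k))" using u z by simp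
      moreover have "0 \<le> (1 - u) * (\<sigma> * Im (a - k))" using u a by simp
      ultimately have "(1 - u) * (\<sigma> * Im (a - k)) = 0" by linarith
      then have "u = 1" using a(2) by auto
      then show False using u z by simp
    qed
    ultimately show "closed_segment a z \<subseteq> ?H - {k}" by blast
  qed (rule a)
qed

text \<open>Continuous away from \<open>p = (t, 0)\<close>; on the slit \<open>y = 0\<close> it is \<open>0\<close> to the left and \<open>1\<close> to
  the right of \<open>p\<close>.\<close>

definition ramp :: "real \<Rightarrow> real \<Rightarrow> complex \<Rightarrow> real" where
  "ramp c t z = (let a = max 0 (c * (Re z - t) + \<bar>Im z\<bar> / 2); b = max 0 (\<bar>Im z\<bar> / 2 - c * (Re z - t))
     in a / (a + b))"

text \<open>A map to the circle of degree one, up to sign, around the point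
  \<open>Complex t 0\<close>. All the turning takes place above the slit; on and below the slit the
  map is 1.\<close>

definition twist :: "real \<Rightarrow> real \<Rightarrow> complex \<Rightarrow> complex" where
  "twist c t z = (if Im z > 0 then exp (2 * of_real pi * \<i> * of_real (1 - ramp c t z)) else 1)"

lemma ramp_denominator:
  assumes "c > 0" "z \<noteq> Complex t 0"
  shows "max 0 (c * (Re z - t) + \<bar>Im z\<bar> / 2) + max 0 (\<bar>Im z\<bar> / 2 - c * (Re z - t)) > 0"
proof (cases "Im z = 0")
  case True
  then have "Re z \<noteq> t" using assms(2) by (auto simp: complex_eq_iff)
  then have "c * (Re z - t) \<noteq> 0" using assms(1) by simp
  then show ?thesis using True by linarith
next
  case False
  define q where "q = c * (Re z - t)"
  have "max 0 (q + \<bar>Im z\<bar> / 2) + max 0 (\<bar>Im z\<bar> / 2 - q) \<ge> (q + \<bar>Im z\<bar> / 2) + (\<bar>Im z\<bar> / 2 - q)"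
    by (intro add_mono max.cobounded2)
  moreover have "(q + \<bar>Im z\<bar> / 2) + (\<bar>Im z\<bar> / 2 - q) > 0" using False by simp
  ultimately show ?thesis unfolding q_def by linarith
qed

lemma continuous_on_ramp:
  assumes "c > 0"
  shows "continuous_on (- {Complex t 0}) (ramp c t)"
proof -
  have ne: "max 0 (c * (Re z - t) + \<bar>Im z\<bar> / 2) + max 0 (\<bar>Im z\<bar> / 2 - c * (Re z - t)) \<noteq> 0"
    if "z \<in> - {Complex t 0}" for z
  proof -
    have "z \<noteq> Complex t 0" using that by simp
    from ramp_denominator[OF assms this] show ?thesis by (rule less_imp_neq[THEN not_sym])
  qed
  have a: "continuous_on (- {Complex t 0}) (\<lambda>z. max 0 (c * (Re z - t) + \<bar>Im z\<bar> / 2))"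
    by (intro continuous_intros) auto
  have b: "continuous_on (- {Complex t 0}) (\<lambda>z. max 0 (\<bar>Im z\<bar> / 2 - c * (Re z - t)))"
    by (intro continuous_intros) auto
  show ?thesis unfolding ramp_def Let_def
    by (rule continuous_on_divide[OF a continuous_on_add[OF a b]]) (rule ballI, rule ne)
qed

lemma ramp_eq_1: "c > 0 \<Longrightarrow> z \<noteq> Complex t 0 \<Longrightarrow> \<bar>Im z\<bar> / 2 \<le> c * (Re z - t) \<Longrightarrow> ramp c t z = 1"
  using ramp_denominator[of c z t] by (simp add: ramp_def Let_def)

lemma ramp_eq_0: "\<bar>Im z\<bar> / 2 \<le> c * (t - Re z) \<Longrightarrow> ramp c t z = 0"
  by (simp add: ramp_def Let_def max_def algebra_simps)

text \<open>On the slit the ramp is 0 or 1, so the formula for the upper half also gives 1 there.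
  Hence the two halves fit together continuously.\<close>

lemma twist_upper:
  assumes c: "c > 0" and z: "z \<noteq> Complex t 0" "0 \<le> Im z"
  shows "twist c t z = exp (2 * of_real pi * \<i> * of_real (1 - ramp c t z))"
proof (cases "Im z > 0")
  case False
  then have 0: "Im z = 0" using z by simp
  then have "ramp c t z = 1 \<or> ramp c t z = 0"
    using ramp_eq_1[OF c z(1)] ramp_eq_0[of z c t] c by (cases "Re z \<ge> t") auto
  then show ?thesis using 0 by (auto simp: twist_def exp_eq_1)
qed (simp add: twist_def)

lemma continuous_on_closed_cover:
  assumes "closed A" "closed B" "S \<subseteq> A \<union> B" "continuous_on (S \<inter> A) f" "continuous_on (S \<inter> B) f"
  shows "continuous_on S f"
proof -
  have "continuous_map (top_of_set S) euclidean f"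
  proof (rule continuous_map_closed_Un[of _ "S \<inter> A" "S \<inter> B"])
    show "closedin (top_of_set S) (S \<inter> A)" "closedin (top_of_set S) (S \<inter> B)"
      using assms by (auto intro: closedin_closed_Int)
    show "continuous_map (subtopology (top_of_set S) (S \<inter> A)) euclidean f"
      "continuous_map (subtopology (top_of_set S) (S \<inter> B)) euclidean f"
      using assms by (auto simp: subtopology_subtopology)
  qed (use assms(3) in auto)
  then show ?thesis by simp
qed

lemma continuous_on_twist:
  assumes c: "c > 0"
  shows "continuous_on (- {Complex t 0}) (twist c t)"
proof (rule continuous_on_closed_cover[OF closed_halfspace_Im_ge[of 0] closed_halfspace_Im_le[of 0]])
  let ?S = "- {Complex t 0}"
  have "continuous_on (?S \<inter> {z. 0 \<le> Im z}) (\<lambda>z. exp (2 * of_real pi * \<i> * of_real (1 - ramp c t z)))"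
    by (intro continuous_intros continuous_on_subset[OF continuous_on_ramp[OF c]]) auto
  then show "continuous_on (?S \<inter> {z. 0 \<le> Im z}) (twist c t)"
    by (rule continuous_on_eq) (use twist_upper[OF c] in auto)
  show "continuous_on (?S \<inter> {z. Im z \<le> 0}) (twist c t)"
    by (rule continuous_on_eq[of _ "\<lambda>_. 1"]) (auto simp: twist_def)
qed auto

text \<open>On the lower half-disc a root is a constant sign. On the upper one it is a constant sign
  times the half-angle factor, which is 1 on the slit to the right and -1 to the left. The two signs
  cannot match on both sides.\<close>

lemma odd_point_twist:
  assumes c: "c > 0"
  shows "odd_point euclidean (twist c t) (Complex t 0)"
  unfolding odd_point_complex_iff
proof (intro notI; elim exE conjE)
  let ?p = "Complex t 0"
  fix r s assume r: "r > 0" and s: "continuous_on (ball ?p r - {?p}) s" "\<forall>x\<in>ball ?p r - {?p}. (s x)\<^sup>2 = twist c t x"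
  define B where "B \<sigma> = {z \<in> ball ?p r. 0 \<le> \<sigma> * Im (z - ?p)} - {?p}" for \<sigma> :: real
  have sign: "\<exists>v\<in>{1, -1}. \<forall>x\<in>S. f x = v"
    if S: "connected S" "S \<noteq> {}" "continuous_on S f" "\<And>x. x \<in> S \<Longrightarrow> (f x)\<^sup>2 = 1" for S and f :: "complex \<Rightarrow> complex"
  proof -
    have sub: "f ` S \<subseteq> {1, -1}" using S(4) by (auto simp: power2_eq_1_iff)
    then have "finite (f ` S)" by (meson finite.emptyI finite_insert finite_subset)
    moreover have "connected (f ` S)" using S by (intro connected_continuous_image)
    ultimately obtain v where "f ` S = {v}" using connected_finite_iff_sing S(2) by blast
    then show ?thesis using sub by blast
  qed
  have ramp01: "ramp c t (Complex (t + r / 2) 0) = 1" "ramp c t (Complex (t - r / 2) 0) = 0"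
    using ramp_eq_1[OF c, of "Complex (t + r / 2) 0" t] ramp_eq_0[of "Complex (t - r / 2) 0" c t] c r
    by (auto simp: complex_eq_iff)
  have pts: "Complex (t + r / 2) 0 \<in> B \<sigma>" "Complex (t - r / 2) 0 \<in> B \<sigma>" for \<sigma>
  proof -
    have "Complex t 0 - Complex (t + r / 2) 0 = of_real (- r / 2)" "Complex t 0 - Complex (t - r / 2) 0 = of_real (r / 2)"
      by (auto simp: complex_eq_iff)
    then have "dist ?p (Complex (t + r / 2) 0) < r" "dist ?p (Complex (t - r / 2) 0) < r"
      using r unfolding dist_norm by (simp_all only: norm_of_real)
    then show "Complex (t + r / 2) 0 \<in> B \<sigma>" "Complex (t - r / 2) 0 \<in> B \<sigma>"
      using r by (auto simp: B_def)
  qed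
  have BS: "B \<sigma> \<subseteq> ball ?p r - {?p}" for \<sigma> by (auto simp: B_def)
  have cB: "connected (B 1)" "connected (B (-1))"
    unfolding B_def by (rule connected_half_punctured_ball[OF r], simp)+
  have "\<exists>v\<in>{1, -1}. \<forall>x\<in>B (-1). s x = v"
  proof (rule sign[OF cB(2)])
    show "continuous_on (B (-1)) s" by (rule continuous_on_subset[OF s(1) BS])
    show "(s x)\<^sup>2 = 1" if "x \<in> B (-1)" for x
      using that s(2) BS[of "-1"] by (auto simp: B_def twist_def)
  qed (use pts in blast)
  then obtain v where v: "v \<in> {1, -1}" "\<And>x. x \<in> B (-1) \<Longrightarrow> s x = v" by blast
  define f where "f z = s z * exp (- (of_real pi * \<i> * of_real (1 - ramp c t z)))" for z
  have "\<exists>w\<in>{1, -1}. \<forall>x\<in>B 1. f x = w"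
  proof (rule sign[OF cB(1)])
    show "continuous_on (B 1) f" unfolding f_def
      by (intro continuous_intros continuous_on_subset[OF s(1) BS] continuous_on_subset[OF continuous_on_ramp[OF c]])
        (auto simp: B_def)
    fix x assume x: "x \<in> B 1"
    have "twist c t x = exp (2 * of_real pi * \<i> * of_real (1 - ramp c t x))"
      using x by (intro twist_upper[OF c]) (auto simp: B_def)
    moreover have "(s x)\<^sup>2 = twist c t x" using s(2) BS x by blast
    moreover have "(exp (- (of_real pi * \<i> * of_real (1 - ramp c t x))))\<^sup>2 = exp (- (2 * of_real pi * \<i> * of_real (1 - ramp c t x)))"
      by (simp add: exp_double[symmetric] algebra_simps)
    ultimately show "(f x)\<^sup>2 = 1"
      unfolding f_def power_mult_distrib by (simp add: exp_minus_inverse)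
  qed (use pts in blast)
  then obtain w where w: "w \<in> {1, -1}" "\<And>x. x \<in> B 1 \<Longrightarrow> f x = w" by blast
  have "w = v" using w(2)[OF pts(1)] v(2)[OF pts(1)] ramp01(1) by (simp add: f_def)
  moreover have "w = - v" using w(2)[OF pts(2)] v(2)[OF pts(2)] ramp01(2) by (simp add: f_def exp_minus)
  ultimately show False using v(1) by auto
qed

lemma continuous_map_complex_mult:
  assumes "continuous_map X euclidean f" "continuous_map X euclidean (g :: _ \<Rightarrow> complex)"
  shows "continuous_map X euclidean (\<lambda>x. f x * g x)"
  using assms by (simp add: continuous_map_atin tendsto_mult)

lemma coords_1: "coords 1 = range point1"
proof
  show "coords 1 \<subseteq> range point1"
  proof
    fix y :: "nat \<Rightarrow> real" assume "y \<in> coords 1"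
    then have "y = point1 (y 0)" by (auto simp: point1_def fun_eq_iff)
    then show "y \<in> range point1" by blast
  qed
qed (auto simp: point1_def)

lemma point1_eq_0 [simp]: "j \<ge> Suc 0 \<Longrightarrow> point1 y j = 0"
  by (simp add: point1_def)

lemma point1_in_cube [simp]: "point1 y \<in> cube (Suc 0) s \<longleftrightarrow> \<bar>y\<bar> \<le> s"
  by (simp add: cube_eq point1_def)

lemma point1_in_open_cube [simp]: "point1 y \<in> open_cube (Suc 0) s \<longleftrightarrow> \<bar>y\<bar> < s"
  by (simp add: open_cube_def point1_def)

lemma continuous_on_point1: "continuous_on UNIV point1"
  unfolding point1_def
proof (rule continuous_on_coordinatewise_then_product)
  show "continuous_on UNIV (\<lambda>t. if j = 0 then t else 0 :: real)" for j :: nat by (cases "j = 0") auto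
qed

section \<open>The two cases in which the core far out lies in one component\<close>

context handle_at_infinity
begin

lemma locally_compact_N: "locally_compact_space N"
  unfolding locally_compact_space_def
proof
  fix x assume x: "x \<in> topspace N"
  show "\<exists>U K. openin N U \<and> compactin N K \<and> x \<in> U \<and> U \<subseteq> K"
  proof (cases "x \<in> core")
    case False
    then obtain z where z: "x = i z" "z \<in> topspace M" using x not_core_iff by blast
    then obtain U K where "openin M U" "compactin M K" "z \<in> U" "U \<subseteq> K"
      using locally_compact_M unfolding locally_compact_space_def by blast
    then show ?thesis using openin_i compactin_i z(1) by blast
  next
    case True
    then obtain y where y: "x = e (0, y)" "y \<in> coords m" by (auto simp: core_def)
    have "compactin N {x}" using x by (simp add: compactin_sing)
    then obtain s where s: "\<And>y. y \<in> coords m \<Longrightarrow> e (0, y) \<in> {x} \<Longrightarrow> y \<in> open_cube m s"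
      by (rule compact_core_bounded) (use that in blast)
    have "x \<in> e ` ({-1<..<1} \<times> open_cube m s)"
      using s[OF y(2)] y(1) by (intro image_eqI[of _ _ "(0, y)"]) auto
    moreover have "e ` ({-1<..<1} \<times> open_cube m s) \<subseteq> e ` ({-1..1} \<times> cube m s)"
      using open_cube_subset_cube[of m s] by (intro image_mono) auto
    ultimately show ?thesis
      by (intro exI[of _ "e ` ({-1<..<1} \<times> open_cube m s)"] exI[of _ "e ` ({-1..1} \<times> cube m s)"]
          conjI openin_box compactin_box)
  qed
qed

lemma inverse_e:
  obtains c where "continuous_map (subtopology N (e ` (UNIV \<times> coords m))) (top_of_set (UNIV \<times> coords m)) c"
    "\<And>t y. y \<in> coords m \<Longrightarrow> c (e (t, y)) = (t, y)"
proof -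
  have "embedding_map (top_of_set (UNIV \<times> coords m)) N e"
    using cont_e open_e inj_e by (intro injective_open_imp_embedding_map) auto
  then obtain c where "homeomorphic_maps (top_of_set (UNIV \<times> coords m)) (subtopology N (e ` (UNIV \<times> coords m))) e c"
    by (auto simp: embedding_map_def homeomorphic_map_maps)
  then show thesis using that[of c] by (auto simp: homeomorphic_maps_def)
qed

lemma i_mem_iff: "x \<in> topspace M \<Longrightarrow> A \<subseteq> topspace M \<Longrightarrow> i x \<in> i ` A \<longleftrightarrow> x \<in> A"
  using inj_on_image_mem_iff[OF inj_i] .

lemma core_connected_at_infinity_high_dim:
  assumes m: "m \<ge> 2" and L: "compactin N L"
  shows "\<exists>s>0. \<exists>C. (\<forall>y\<in>coords m. e (0, y) \<in> L \<longrightarrow> y \<in> open_cube m s) \<and>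
      connectedin N C \<and> C \<inter> L = {} \<and> e ` ({0} \<times> (coords m - cube m s)) \<subseteq> C"
proof -
  obtain s where s: "s > 0" "\<And>y. y \<in> coords m \<Longrightarrow> e (0, y) \<in> L \<Longrightarrow> y \<in> open_cube m s"
    using compact_core_bounded[OF L] by blast
  have "connectedin N (e ` ({0} \<times> (coords m - cube m s)))"
    using s(1) m by (intro connectedin_e connected_Times connected_complement_cube) auto
  moreover have "e ` ({0} \<times> (coords m - cube m s)) \<inter> L = {}"
  proof -
    have "e (0, y) \<notin> L" if "y \<in> coords m - cube m s" for y
      using s(2)[of y] open_cube_subset_cube[of m s] that by blast
    then show ?thesis by auto
  qed
  ultimately show ?thesis using s
    by (intro exI[of _ s] conjI exI[of _ "e ` ({0} \<times> (coords m - cube m s))"]) auto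
qed

text \<open>Suppose that the two half-lines of the core outside \<open>L\<close> lie in different components of the
  complement of \<open>L\<close>, and let \<open>g\<close> be a function that is \<open>1\<close> on one of these components and \<open>0\<close>
  on the rest, away from a compact set. On the side of \<open>\<eta>\<close>, \<open>exp (2 \<pi> \<i> g)\<close> is \<open>1\<close> away from a compact set and
  winds once along the core. Cutting it off inside the strip produces a map to the circle on
  \<open>M\<close> with compact support and exactly one odd point.\<close>

lemma core_connected_at_infinity_surface:
  assumes m: "m = 1" and ne: "\<eta> \<noteq> \<eta>'" and bd: "compactin M Bd"
    and patch: "\<And>x. x \<in> topspace M - Bd \<Longrightarrow> \<exists>p. plane_patch M p \<and> x \<in> range p"
    and L: "compactin N L"
  shows "\<exists>s>0. \<exists>C. (\<forall>y\<in>coords m. e (0, y) \<in> L \<longrightarrow> y \<in> open_cube m s) \<and>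
      connectedin N C \<and> C \<inter> L = {} \<and> e ` ({0} \<times> (coords m - cube m s)) \<subseteq> C"
proof -
  define E where "E t y = e (t, point1 y)" for t y
  have EN: "E t y \<in> topspace N" for t y unfolding E_def by (rule e_in_topspace) (simp add: m point1_def)
  have Eeq: "E t y = E t' y' \<longleftrightarrow> t = t' \<and> y = y'" for t y t' y'
    unfolding E_def using e_eq_iff[of "point1 y" "point1 y'"] m by (auto simp: point1_def fun_eq_iff split: if_splits)
  \<comment> \<open>\<open>u\<close> will make the indicator function of a component of the
    complement of \<open>L\<close> continuous across \<open>L\<close>, at the price of other values
    inside the compact set \<kappa>.\<close>
  obtain O2 \<kappa> and u :: "'b \<Rightarrow> real" where u: "openin N O2" "L \<subseteq> O2" "compactin N \<kappa>"
    "continuous_map N euclideanreal u" "\<And>x. x \<in> topspace N \<Longrightarrow> 0 \<le> u x \<and> u x \<le> 1"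
    "\<And>x. x \<in> O2 \<Longrightarrow> u x = 1" "\<And>x. x \<in> topspace N - \<kappa> \<Longrightarrow> u x = 0"
    by (rule bump_function[OF locally_compact_N Hausdorff_N L]) (use that in blast)
  have L\<kappa>: "L \<subseteq> \<kappa>"
  proof
    fix x assume "x \<in> L"
    then have "u x = 1" "x \<in> topspace N" using u(2,6) compactin_subset_topspace[OF L] by auto
    then show "x \<in> \<kappa>" using u(7)[of x] by auto
  qed
  obtain s where s: "s > 0" "\<And>y. y \<in> coords m \<Longrightarrow> e (0, y) \<in> \<kappa> \<Longrightarrow> y \<in> open_cube m s"
    by (rule compact_core_bounded[OF u(3)]) (use that in blast)
  obtain \<delta>0 where \<delta>0: "\<delta>0 > 0" "\<And>t y. \<bar>t\<bar> < \<delta>0 \<Longrightarrow> y \<in> coords m \<Longrightarrow> e (t, y) \<in> \<kappa> \<Longrightarrow> y \<in> open_cube m s"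
    using compact_slab_bounded[OF u(3) s(2)] by blast
  have E\<kappa>: "E t y \<notin> \<kappa>" if "\<bar>t\<bar> < \<delta>0" "\<bar>y\<bar> \<ge> s" for t y
    using \<delta>0(2)[of t "point1 y"] that m unfolding E_def by auto
  \<comment> \<open>Half-strips around the two half-lines of the core. The aim is to show that both
    lie in the component \<open>A\<close>.\<close>
  define HU where "HU = e ` ({-\<delta>0<..<\<delta>0} \<times> point1 ` {s..})"
  define HD where "HD = e ` ({-\<delta>0<..<\<delta>0} \<times> point1 ` {..-s})"
  have HU: "E t y \<in> HU" if "\<bar>t\<bar> < \<delta>0" "y \<ge> s" for t y
    unfolding HU_def E_def using that by (intro imageI) auto
  have HD: "E t y \<in> HD" if "\<bar>t\<bar> < \<delta>0" "y \<le> -s" for t y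
    unfolding HD_def E_def using that by (intro imageI) auto
  have p1c: "point1 ` S \<subseteq> coords m" for S using m by auto
  have cH: "connectedin N HU" "connectedin N HD"
    unfolding HU_def HD_def
    by (intro connectedin_e connected_Times connected_continuous_image continuous_on_subset[OF continuous_on_point1];
        use p1c in auto)+
  have H\<kappa>: "HU \<inter> \<kappa> = {}" "HD \<inter> \<kappa> = {}"
    unfolding HU_def HD_def using E\<kappa> s(1) by (auto simp: E_def abs_if)
  let ?NL = "subtopology N (topspace N - L)"
  define A where "A = connected_component_of_set ?NL (E 0 s)"
  have opNL: "openin N (topspace N - L)" using closedin_compact[OF L] by blast
  have E0: "E 0 s \<in> topspace ?NL"
    using EN E\<kappa>[of 0 s] L\<kappa> s(1) \<delta>0(1) by auto
  have Acomp: "A \<in> connected_components_of ?NL"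
    unfolding A_def using E0 by (simp add: connected_component_in_connected_components_of)
  then have A: "connectedin N A" "A \<subseteq> topspace N - L"
    "\<And>T. connectedin N T \<Longrightarrow> T \<subseteq> topspace N - L \<Longrightarrow> T \<inter> A \<noteq> {} \<Longrightarrow> T \<subseteq> A"
    unfolding connected_components_of_subtopology_iff by auto
  have E0A: "E 0 s \<in> A" unfolding A_def using E0 by (simp add: connected_component_of_refl)
  have Hsub: "HU \<subseteq> topspace N - L" "HD \<subseteq> topspace N - L"
    using H\<kappa> L\<kappa> cH connectedin_subset_topspace by blast+
  have HUA: "HU \<subseteq> A" using A(3)[OF cH(1) Hsub(1)] E0A HU[of 0 s] \<delta>0(1) by auto
  have core_out: "e ` ({0} \<times> (coords m - cube m s)) \<subseteq> HU \<union> HD"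
  proof
    fix x assume "x \<in> e ` ({0} \<times> (coords m - cube m s))"
    then obtain y where "x = e (0, y)" "y \<in> coords 1 - cube 1 s" using m by auto
    then obtain b where "x = E 0 b" "\<not> \<bar>b\<bar> \<le> s" unfolding coords_1 E_def by auto
    then show "x \<in> HU \<union> HD" using HU[of 0 b] HD[of 0 b] \<delta>0(1) by (cases "b \<ge> 0") auto
  qed
  have sL: "\<forall>y\<in>coords m. e (0, y) \<in> L \<longrightarrow> y \<in> open_cube m s" using s(2) L\<kappa> by blast
  have "HD \<inter> A \<noteq> {}"
  proof
    assume HDA: "HD \<inter> A = {}"
    have opA: "openin N A"
      using locally_connected_N opNL Acomp unfolding locally_connected_space_open_connected_components by blast
    have opA': "openin N (topspace N - L - A)"
      by (rule openin_minus_component[OF locally_connected_N opNL Acomp])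
    \<comment> \<open>The maximum is constantly 1 on \<open>A \<union> O2\<close>, which removes the
      jump where \<open>A\<close> borders on \<open>L\<close>. On the remaining open set it is
      \<open>u\<close>.\<close>
    define g where "g x = max (if x \<in> A then 1 else 0) (u x)" for x
    have gout: "g x = (if x \<in> A then 1 else 0)" if "x \<in> topspace N - \<kappa>" for x
      using u(7)[OF that] by (simp add: g_def)
    have contg: "continuous_map N euclideanreal g"
    proof (rule continuous_map_open_Un[of N "A \<union> O2" "topspace N - L - A"])
      show "openin N (A \<union> O2)" using opA u(1) by blast
      show "topspace N \<subseteq> (A \<union> O2) \<union> (topspace N - L - A)" using u(2) by blast
      have g1: "g x = 1" if "x \<in> A \<union> O2" for x
        using that u(5)[of x] u(6)[of x] A(2) openin_subset[OF u(1)] by (auto simp: g_def max_def)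
      have "continuous_map (subtopology N (A \<union> O2)) euclideanreal (\<lambda>_. 1)" by simp
      then show "continuous_map (subtopology N (A \<union> O2)) euclideanreal g"
      proof (rule continuous_map_eq)
        show "1 = g x" if "x \<in> topspace (subtopology N (A \<union> O2))" for x using g1[of x] that by simp
      qed
      show "continuous_map (subtopology N (topspace N - L - A)) euclideanreal g"
        by (rule continuous_map_eq[OF continuous_map_from_subtopology[OF u(4)]]) (use u(5) in \<open>auto simp: g_def\<close>)
    qed (rule opA')
    obtain K1 where K1: "compactin M K1" "\<eta> K1 \<noteq> \<eta>' K1" using end_eqI[OF \<eta> \<eta>'] ne by blast
    have "\<exists>U L. openin M U \<and> compactin M L \<and> closedin M L \<and> Bd \<subseteq> U \<and> U \<subseteq> L"
      using locally_compact_space_compact_closed_compact[of M] locally_compact_M Hausdorff_M bd by simp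
    then obtain W Bd' where W: "openin M W" "compactin M Bd'" "Bd \<subseteq> W" "W \<subseteq> Bd'"
      by (elim exE conjE) (rule that; assumption)
    \<comment> \<open>\<open>K1\<close> separates \<eta> from \<eta>', so \<open>V\<close> avoids
      the side of \<eta>'. \<open>Bd'\<close> contains a neighbourhood of \<open>Bd\<close>, so even
      the closure of \<open>V\<close> misses \<open>Bd\<close>.\<close>
    define K0 where "K0 = K1 \<union> Bd'"
    have K0: "compactin M K0" unfolding K0_def using K1(1) W(2) by (rule compactin_Un)
    have K0M: "K0 \<subseteq> topspace M" using K0 compactin_subset_topspace by blast
    define V where "V = \<eta> K0"
    have V: "V \<subseteq> topspace M - K0" "openin M V"
      unfolding V_def using end_subset[OF \<eta> K0] openin_end[OF locally_connected_M Hausdorff_M \<eta> K0] by auto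
    have "\<eta> K0 \<noteq> \<eta>' K0" using end_eq_mono[OF \<eta> \<eta>' K1(1) K0] K1(2) by (auto simp: K0_def)
    then have V': "V \<inter> \<eta>' K0 = {}" using end_eq_if_overlap[OF \<eta> \<eta>' K0] by (auto simp: V_def)
    \<comment> \<open>The factor \<open>1 - w\<close> vanishes near \<open>K0\<close>, which
      contains the frontier of \<open>V\<close>; this will allow extension by 1 beyond
      \<open>V\<close>.\<close>
    obtain O3 \<kappa>' and w :: "'a \<Rightarrow> real" where w: "openin M O3" "K0 \<subseteq> O3" "compactin M \<kappa>'"
      "continuous_map M euclideanreal w" "\<And>x. x \<in> topspace M \<Longrightarrow> 0 \<le> w x \<and> w x \<le> 1"
      "\<And>x. x \<in> O3 \<Longrightarrow> w x = 1" "\<And>x. x \<in> topspace M - \<kappa>' \<Longrightarrow> w x = 0"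
      by (rule bump_function[OF locally_compact_M Hausdorff_M K0]) (use that in blast)
    have cU: "compactin M (K0 \<union> \<kappa>')" using K0 w(3) by (rule compactin_Un)
    obtain \<epsilon> where \<epsilon>: "\<epsilon> > 0" "e ` ({0<..<\<epsilon>} \<times> coords m) \<subseteq> i ` \<eta> (K0 \<union> \<kappa>')"
      "e ` ({-\<epsilon><..<0} \<times> coords m) \<subseteq> i ` \<eta>' (K0 \<union> \<kappa>')"
      by (rule avoid_slab[OF cU]) (use that in blast)
    have \<eta>sub: "\<eta> (K0 \<union> \<kappa>') \<subseteq> V - \<kappa>'" "\<eta>' (K0 \<union> \<kappa>') \<subseteq> \<eta>' K0"
      unfolding V_def using end_mono[OF \<eta> K0 cU] end_subset[OF \<eta> cU] end_mono[OF \<eta>' K0 cU] by auto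
    define \<delta> where "\<delta> = min \<epsilon> \<delta>0 / 2"
    have \<delta>: "\<delta> > 0" "2 * \<delta> \<le> \<epsilon>" "2 * \<delta> \<le> \<delta>0" using \<epsilon>(1) \<delta>0(1) by (auto simp: \<delta>_def)
    have plus: "E t y \<in> i ` (V - \<kappa>')" if "0 < t" "t < 2 * \<delta>" for t y
    proof -
      have "E t y \<in> e ` ({0<..<\<epsilon>} \<times> coords m)"
        unfolding E_def using that \<delta> m by (intro imageI) auto
      then show ?thesis using \<epsilon>(2) \<eta>sub(1) by blast
    qed
    have minus: "E t y \<in> i ` \<eta>' K0" if "-2 * \<delta> < t" "t < 0" for t y
    proof -
      have "E t y \<in> e ` ({-\<epsilon><..<0} \<times> coords m)"
        unfolding E_def using that \<delta> m by (intro imageI) auto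
      then show ?thesis using \<epsilon>(3) \<eta>sub(2) by blast
    qed
    have gE: "g (E t y) = (if y > 0 then 1 else 0)" if "\<bar>t\<bar> < \<delta>0" "\<bar>y\<bar> \<ge> s" for t y
    proof (cases "y > 0")
      case True
      then have "E t y \<in> A" using HUA HU[of t y] that by auto
      then show ?thesis using gout[of "E t y"] E\<kappa>[OF that] EN True by simp
    next
      case False
      then have "E t y \<notin> A" using HDA HD[of t y] that by auto
      then show ?thesis using gout[of "E t y"] E\<kappa>[OF that] EN False by simp
    qed
    obtain c where c: "continuous_map (subtopology N (e ` (UNIV \<times> coords m))) (top_of_set (UNIV \<times> coords m)) c"
      "\<And>t y. y \<in> coords m \<Longrightarrow> c (e (t, y)) = (t, y)"
      using inverse_e by blast
    define cc where "cc z = Complex (fst (c z)) (snd (c z) 0)" for z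
    have ccE: "cc (E t y) = Complex t y" for t y
      using c(2)[of "point1 y" t] m by (simp add: cc_def E_def) (simp add: point1_def)
    \<comment> \<open>Slope and centre are chosen so that for \<open>\<bar>y\<bar> \<le> s\<close>
      the ramp is 0 when \<open>t \<le> \<delta> / 4\<close> and 1 when
      \<open>t \<ge> \<delta>\<close>.\<close>
    define sl where "sl = 2 * s / \<delta>"
    define tp where "tp = \<delta> / 2"
    have sl: "sl > 0" using s(1) \<delta>(1) by (simp add: sl_def)
    \<comment> \<open>Where the ramp is 1, \<open>T b z\<close> is exp(2 pi i b); where it is 0,
      \<open>T b z\<close> is 1. It is also 1 when \<open>b\<close> is 1 above the slit or 0 below
      it. With \<open>b = g\<close> it fades the winding out towards the core, and the twist creates
      the puncture at \<open>tp\<close> that pays for this.\<close>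
    define T where "T b z = exp (2 * of_real pi * \<i> * of_real (ramp sl tp z * b)) * twist sl tp z" for b z
    have T0: "T 0 z = 1" if "Im z \<le> 0" for z using that by (simp add: T_def twist_def)
    have T1: "T 1 z = 1" if "Im z > 0" for z
    proof -
      have "2 * of_real pi * \<i> * of_real (ramp sl tp z * 1) + 2 * of_real pi * \<i> * of_real (1 - ramp sl tp z)
          = 2 * of_real pi * \<i>" by (simp add: algebra_simps)
      then show ?thesis using that by (simp add: T_def twist_def exp_add[symmetric])
    qed
    define rect where "rect = e ` ({0<..\<delta>} \<times> cube m s)"
    have rectE: "E t y \<in> rect \<longleftrightarrow> 0 < t \<and> t \<le> \<delta> \<and> \<bar>y\<bar> \<le> s" for t y
      unfolding rect_def E_def
      using e_in_image[of "point1 y" "{0<..\<delta>} \<times> cube m s" t] m by (auto simp: cube_eq point1_def)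
    \<comment> \<open>The map that winds along the core on the side of \<eta>, cut off near
      \<open>K0\<close>.\<close>
    define G0 where "G0 x = (if x \<in> V then exp (2 * of_real pi * \<i> * of_real ((1 - w x) * g (i x))) else 1)" for x
    define G where "G x = (if i x \<in> rect then T (g (i x)) (cc (i x)) else G0 x)" for x
    \<comment> \<open>Beyond the rectangle, \<open>G0\<close> agrees with \<open>T\<close> on the
      strip: there either \<open>g\<close> is 0 or 1 on the proper side of the slit, or the ramp is
      1. So \<open>G\<close> is given by one formula on the open strip and by the other off the
      rectangle.\<close>
    have strip: "G x = T (g (i x)) (cc (i x))" if x: "x \<in> topspace M" "i x = E t y" "0 < t" "t < 2 * \<delta>" for x t y
    proof (cases "i x \<in> rect")
      case True
      then show ?thesis by (simp add: G_def)
    next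
      case False
      have "x \<in> V - \<kappa>'"
        using plus[OF x(3,4), of y] i_mem_iff[OF x(1), of "V - \<kappa>'"] x(2) V(1) by auto
      then have G: "G x = exp (2 * of_real pi * \<i> * of_real (g (E t y)))"
        using False w(7)[of x] x(1,2) by (simp add: G_def G0_def)
      show ?thesis
      proof (cases "\<bar>y\<bar> \<ge> s")
        case True
        have "g (E t y) = (if y > 0 then 1 else 0)" using gE[OF _ True] x(3,4) \<delta> by auto
        then show ?thesis using T0[of "Complex t y"] T1[of "Complex t y"] by (auto simp: G x(2) ccE)
      next
        case y: False
        then have t: "t > \<delta>" using False rectE x(2,3) by auto
        have "s \<le> sl * (t - tp)"
        proof -
          have "sl * (\<delta> / 2) \<le> sl * (t - tp)" using sl t by (intro mult_left_mono) (auto simp: tp_def)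
          then show ?thesis using \<delta>(1) by (simp add: sl_def)
        qed
        then have "ramp sl tp (Complex t y) = 1"
          using y t \<delta>(1) s(1) by (intro ramp_eq_1[OF sl]) (auto simp: tp_def complex_eq_iff)
        then show ?thesis by (simp add: G x(2) ccE T_def twist_def)
      qed
    qed
    have "compactin N (e ` ({0..\<delta>} \<times> cube m s))" by (rule compactin_box)
    then have clrect: "closedin N (e ` ({0..\<delta>} \<times> cube m s))" by (rule closedin_compact)
    \<comment> \<open>The added edge \<open>t = 0\<close> lies in the core, outside the image of
      \<open>M\<close>. Hence the preimage of the half-open rectangle is closed in
      \<open>M\<close>.\<close>
    have rect_eq: "preim (e ` ({0..\<delta>} \<times> cube m s)) = preim rect"
    proof -
      have in_rect: "e z \<in> rect" if z: "z \<in> {0..\<delta>} \<times> cube m s" "e z \<in> i ` topspace M" for z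
      proof -
        obtain t y where ty: "z = (t, y)" by (cases z)
        have "t \<noteq> 0" using z ty e_in_core[of y t] i_image_eq by (auto simp: cube_eq)
        then show ?thesis unfolding rect_def using z ty by (intro imageI) auto
      qed
      show ?thesis
      proof
        show "preim rect \<subseteq> preim (e ` ({0..\<delta>} \<times> cube m s))"
          unfolding rect_def by (intro preim_mono image_mono) auto
        show "preim (e ` ({0..\<delta>} \<times> cube m s)) \<subseteq> preim rect"
        proof
          fix x assume x: "x \<in> preim (e ` ({0..\<delta>} \<times> cube m s))"
          then have "i x \<in> e ` ({0..\<delta>} \<times> cube m s)" "x \<in> topspace M" by (auto simp only: preim_def mem_Collect_eq)
          then obtain z where z: "i x = e z" "z \<in> {0..\<delta>} \<times> cube m s" by (elim imageE)
          then have "i x \<in> rect" using in_rect[OF z(2)] \<open>x \<in> topspace M\<close> by (metis imageI)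
          then show "x \<in> preim rect" using \<open>x \<in> topspace M\<close> by (simp add: preim_def)
        qed
      qed
    qed
    have opO2: "openin M (topspace M - preim rect)"
    proof -
      have "closedin M (preim (e ` ({0..\<delta>} \<times> cube m s)))"
        unfolding preim_def by (rule closedin_continuous_map_preimage[OF cont_i clrect])
      then show ?thesis unfolding rect_eq by blast
    qed
    define O1 where "O1 = preim (e ` ({0<..<2 * \<delta>} \<times> coords m))"
    have opO1: "openin M O1" unfolding O1_def preim_def
      by (rule openin_continuous_map_preimage[OF cont_i openin_slab])
    have O1E: "\<exists>t y. i x = E t y \<and> 0 < t \<and> t < 2 * \<delta>" if x: "x \<in> O1" for x
    proof -
      obtain t y where "i x = e (t, y)" "0 < t" "t < 2 * \<delta>" "y \<in> coords 1"
        using x m by (auto simp: O1_def preim_def)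
      then show ?thesis unfolding coords_1 E_def by blast
    qed
    have O1M: "O1 \<subseteq> topspace M" by (auto simp: O1_def preim_def)
    have rectO1: "preim rect \<subseteq> O1"
      unfolding O1_def rect_def using \<delta>(1) by (intro preim_mono image_mono) (auto simp: cube_eq)
    have contgi: "continuous_map M euclideanreal (\<lambda>x. g (i x))"
      using continuous_map_compose[OF cont_i contg] by (simp add: o_def)
    have contG0: "continuous_map M euclidean G0"
    proof -
      define k where "k x = (if x \<in> V then (1 - w x) * g (i x) else 0)" for x
      have "continuous_map M euclideanreal k"
      proof (rule continuous_map_closed_Un[of M "V \<union> K0" "topspace M - V"])
        have "topspace M - (V \<union> K0) = topspace M - K0 - V" by blast
        then have "openin M (topspace M - (V \<union> K0))"
          using openin_minus_end[OF locally_connected_M Hausdorff_M \<eta> K0] by (simp add: V_def)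
        then show "closedin M (V \<union> K0)" using V(1) K0M by (auto simp: closedin_def)
        show "closedin M (topspace M - V)" using V(2) by blast
        have "k x = (1 - w x) * g (i x)" if "x \<in> V \<union> K0" for x
          using that w(2,6) by (auto simp: k_def)
        moreover have "continuous_map M euclideanreal (\<lambda>x. (1 - w x) * g (i x))"
          by (intro continuous_intros contgi w(4))
        ultimately show "continuous_map (subtopology M (V \<union> K0)) euclideanreal k"
          by (intro continuous_map_eq[OF continuous_map_from_subtopology]) auto
        show "continuous_map (subtopology M (topspace M - V)) euclideanreal k"
          by (rule continuous_map_eq[of _ _ "\<lambda>_. 0"]) (auto simp: k_def)
      qed blast
      then have "continuous_map M euclidean ((\<lambda>b. exp (2 * of_real pi * \<i> * of_real b)) \<circ> k)"
        by (rule continuous_map_compose) (simp, intro continuous_intros)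
      then show ?thesis by (rule continuous_map_eq) (auto simp: k_def G0_def)
    qed
    have "E tp 0 \<in> i ` (V - \<kappa>')" using plus[of tp 0] \<delta>(1) by (simp add: tp_def)
    \<comment> \<open>The centre of the twist, the only point of \<open>M\<close> at which
      \<open>G\<close> is singular.\<close>
    then obtain xp where xp: "xp \<in> V" "i xp = E tp 0" by (auto simp: image_iff)
    have xpM: "xp \<in> topspace M" using xp V(1) by blast
    let ?p = "Complex tp 0"
    have contcc: "continuous_map (subtopology M O1) euclidean (\<lambda>x. cc (i x))"
    proof -
      have "continuous_map (subtopology M O1) (subtopology N (e ` (UNIV \<times> coords m))) i"
        using cont_i by (auto simp: continuous_map_in_subtopology continuous_map_from_subtopology O1_def preim_def)
      from continuous_map_compose[OF this c(1)]
      have 1: "continuous_map (subtopology M O1) euclidean (c \<circ> i)" by (simp add: continuous_map_in_subtopology)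
      have "continuous_on UNIV (\<lambda>z::real \<times> (nat \<Rightarrow> real). Complex (fst z) (snd z 0))"
      proof -
        have "continuous_on UNIV (\<lambda>z::real \<times> (nat \<Rightarrow> real). snd z 0)"
          by (rule continuous_on_compose2[OF continuous_on_product_coordinates]) (auto intro: continuous_intros)
        then show ?thesis by (intro continuous_on_Complex continuous_intros)
      qed
      then have "continuous_map euclidean euclidean (\<lambda>z::real \<times> (nat \<Rightarrow> real). Complex (fst z) (snd z 0))" by simp
      from continuous_map_compose[OF 1 this] show ?thesis by (simp add: o_def cc_def)
    qed
    have ccO1: "cc (i x) \<noteq> ?p" if x: "x \<in> O1 - {xp}" for x
    proof
      assume a: "cc (i x) = ?p"
      obtain t y where "i x = E t y" using O1E x by blast
      then have "i x = i xp" using a xp(2) by (simp add: ccE)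
      then show False using inj_onD[OF inj_i, of x xp] x O1M xpM by auto
    qed
    have contramp: "continuous_map (subtopology M (O1 - {xp})) euclideanreal (\<lambda>x. ramp sl tp (cc (i x)))"
      and conttwist: "continuous_map (subtopology M (O1 - {xp})) euclidean (\<lambda>x. twist sl tp (cc (i x)))"
    proof -
      have "continuous_map (subtopology M (O1 - {xp})) euclidean (\<lambda>x. cc (i x))"
        by (rule continuous_map_from_subtopology_mono[OF contcc]) auto
      then have 1: "continuous_map (subtopology M (O1 - {xp})) (top_of_set (- {?p})) (\<lambda>x. cc (i x))"
        using ccO1 by (auto simp: continuous_map_in_subtopology)
      show "continuous_map (subtopology M (O1 - {xp})) euclideanreal (\<lambda>x. ramp sl tp (cc (i x)))"
        using continuous_map_compose[OF 1, of euclideanreal "ramp sl tp"] continuous_on_ramp[OF sl] by (simp add: o_def)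
      show "continuous_map (subtopology M (O1 - {xp})) euclidean (\<lambda>x. twist sl tp (cc (i x)))"
        using continuous_map_compose[OF 1, of euclidean "twist sl tp"] continuous_on_twist[OF sl] by (simp add: o_def)
    qed
    have contT: "continuous_map (subtopology M (O1 - {xp})) euclidean (\<lambda>x. T (g (i x)) (cc (i x)))"
    proof -
      have "continuous_map (subtopology M (O1 - {xp})) euclideanreal (\<lambda>x. ramp sl tp (cc (i x)) * g (i x))"
        by (intro continuous_intros contramp continuous_map_from_subtopology[OF contgi])
      then have "continuous_map (subtopology M (O1 - {xp})) euclidean
          ((\<lambda>b. exp (2 * of_real pi * \<i> * of_real b)) \<circ> (\<lambda>x. ramp sl tp (cc (i x)) * g (i x)))"
        by (rule continuous_map_compose) (simp, intro continuous_intros)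
      then show ?thesis unfolding T_def using conttwist
        by (intro continuous_map_complex_mult) (simp_all add: o_def)
    qed
    have contG: "continuous_map (subtopology M (topspace M - {xp})) euclidean G"
    proof (rule continuous_map_open_Un[of _ "O1 - {xp}" "topspace M - preim rect - {xp}"])
      let ?X = "subtopology M (topspace M - {xp})"
      have *: "openin ?X (U - {xp})" if "openin M U" for U
      proof -
        have "U - {xp} = U \<inter> (topspace M - {xp})" using openin_subset[OF that] by blast
        then show ?thesis using that by (auto simp: openin_subtopology)
      qed
      show "openin ?X (O1 - {xp})" "openin ?X (topspace M - preim rect - {xp})"
        using * opO1 opO2 by auto
      show "topspace ?X \<subseteq> (O1 - {xp}) \<union> (topspace M - preim rect - {xp})" using rectO1 by auto
      have "continuous_map (subtopology M (O1 - {xp})) euclidean G"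
      proof (rule continuous_map_eq[OF contT])
        fix x assume "x \<in> topspace (subtopology M (O1 - {xp}))"
        then have x: "x \<in> O1" "x \<in> topspace M" by auto
        then show "T (g (i x)) (cc (i x)) = G x" using O1E[OF x(1)] strip[OF x(2)] by metis
      qed
      then show "continuous_map (subtopology ?X (O1 - {xp})) euclidean G"
        unfolding subtopology_subtopology by (rule continuous_map_from_subtopology_mono) auto
      have "continuous_map (subtopology M (topspace M - preim rect)) euclidean G"
        by (rule continuous_map_eq[OF continuous_map_from_subtopology[OF contG0]]) (auto simp: G_def preim_def)
      then show "continuous_map (subtopology ?X (topspace M - preim rect - {xp})) euclidean G"
        unfolding subtopology_subtopology by (rule continuous_map_from_subtopology_mono) auto
    qed
    have nT: "cmod (T b z) = 1" for b z
    proof -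
      have *: "cmod (exp (2 * of_real pi * \<i> * of_real b)) = 1" for b :: real
        by (simp add: norm_exp_eq_Re)
      show ?thesis unfolding T_def twist_def norm_mult using * by simp
    qed
    have nG: "cmod (G x) = 1" for x
      using nT by (simp add: G_def G0_def norm_exp_eq_Re)
    \<comment> \<open>Off this set \<open>G\<close> is 1. Its parts account for the cutoff, for the
      values of \<open>g\<close> other than 0 and 1, and for the places in the rectangle where the
      ramp may be positive. A thin slab is taken out of \<kappa> so that the rest lies in
      \<open>M\<close>; on that slab the ramp is 0 at points of \<kappa> with
      \<open>t > 0\<close>.\<close>
    define L1 where "L1 = \<kappa>' \<union> preim (\<kappa> - e ` ({-\<delta>/4<..<\<delta>/4} \<times> coords m)) \<union> preim (e ` ({\<delta>/4..\<delta>} \<times> cube m s))"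
    have cL1: "compactin M L1"
    proof -
      define D where "D = e ` ({-\<delta>/4<..<\<delta>/4} \<times> coords m)"
      have "closedin N (topspace N - D)"
        unfolding D_def by (intro closedin_diff closedin_topspace openin_slab)
      moreover have "\<kappa> - D = \<kappa> \<inter> (topspace N - D)" using compactin_subset_topspace[OF u(3)] by blast
      ultimately have "compactin N (\<kappa> - D)" using compact_Int_closedin[OF u(3)] by metis
      moreover have "\<kappa> - D \<subseteq> i ` topspace M"
      proof -
        have "core \<subseteq> D" unfolding core_def D_def using \<delta>(1) by (intro image_mono) auto
        then show ?thesis unfolding i_image_eq using compactin_subset_topspace[OF u(3)] by blast
      qed
      ultimately have 1: "compactin M (preim (\<kappa> - D))" by (rule compactin_preim[rotated])
      have "e ` ({\<delta>/4..\<delta>} \<times> cube m s) \<subseteq> i ` topspace M"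
      proof
        fix x assume "x \<in> e ` ({\<delta>/4..\<delta>} \<times> cube m s)"
        then obtain t y where ty: "x = e (t, y)" "t \<ge> \<delta>/4" "y \<in> coords m" by (auto simp: cube_eq)
        then have "x \<notin> core" using e_in_core[OF ty(3)] \<delta>(1) by auto
        then show "x \<in> i ` topspace M" using not_core_iff e_in_topspace[OF ty(3)] ty(1) by blast
      qed
      then have 2: "compactin M (preim (e ` ({\<delta>/4..\<delta>} \<times> cube m s)))" by (rule compactin_preim[OF _ compactin_box])
      show ?thesis unfolding L1_def using w(3) 1[unfolded D_def] 2 by (intro compactin_Un)
    qed
    \<comment> \<open>Intersecting with the closure of \<open>V\<close> removes \<open>Bd\<close>
      from the support, so that patches cover it.\<close>
    define LG where "LG = L1 \<inter> M closure_of V"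
    have cLG: "compactin M LG" unfolding LG_def by (rule compact_Int_closedin[OF cL1 closedin_closure_of])
    have out: "G x = 1" if x: "x \<in> topspace M - LG" for x
    proof (cases "x \<in> V")
      case False
      have "i x \<notin> rect"
      proof
        assume "i x \<in> rect"
        then have "x \<in> O1" using x rectO1 by (auto simp: preim_def)
        then obtain t y where "i x = E t y" "0 < t" "t < 2 * \<delta>" using O1E by blast
        then have "i x \<in> i ` (V - \<kappa>')" using plus by simp
        then show False using False x V(1) i_mem_iff[of x "V - \<kappa>'"] by auto
      qed
      then show ?thesis using False by (simp add: G_def G0_def)
    next
      case True
      then have "x \<in> M closure_of V" using closure_of_subset[of V M] V(1) by blast
      then have xL: "x \<notin> L1" using x by (auto simp: LG_def)
      have dich: "?thesis" if "g (i x) = 0 \<or> g (i x) = 1" "i x \<notin> rect"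
        using that True xL w(7)[of x] x by (auto simp: G_def G0_def L1_def exp_eq_1)
      show ?thesis
      proof (cases "i x \<in> \<kappa>")
        case \<kappa>F: False
        have g: "g (i x) = 0 \<or> g (i x) = 1" proof -
          have "i x \<in> topspace N" using x unfolding topspace_N by blast
          then show ?thesis using gout[of "i x"] \<kappa>F by (cases "i x \<in> A") auto
        qed
        show ?thesis
        proof (cases "i x \<in> rect")
          case r: True
          then have "x \<in> O1" using x rectO1 by (auto simp: preim_def)
          then obtain t y where ty: "i x = E t y" "0 < t" "t < 2 * \<delta>" using O1E by blast
          have "\<bar>y\<bar> \<le> s" "t \<le> \<delta>" using r rectE ty by auto
          have "t < \<delta> / 4"
          proof (rule ccontr)
            assume "\<not> ?thesis"
            then have "i x \<in> e ` ({\<delta>/4..\<delta>} \<times> cube m s)"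
              unfolding ty(1) E_def using \<open>t \<le> \<delta>\<close> \<open>\<bar>y\<bar> \<le> s\<close> m by (intro imageI) auto
            then show False using xL x by (auto simp: L1_def preim_def)
          qed
          then have "sl * (\<delta> / 4) \<le> sl * (tp - t)" using sl by (intro mult_left_mono) (auto simp: tp_def)
          then have "\<bar>y\<bar> / 2 \<le> sl * (tp - t)" using \<open>\<bar>y\<bar> \<le> s\<close> \<delta>(1) by (simp add: sl_def)
          then have "ramp sl tp (Complex t y) = 0" by (intro ramp_eq_0) simp
          then show ?thesis using r by (simp add: G_def ty(1) ccE T_def twist_def exp_eq_1)
        qed (use dich g in blast)
      next
        case \<kappa>T: True
        then have "i x \<in> e ` ({-\<delta>/4<..<\<delta>/4} \<times> coords m)" using xL x by (auto simp: L1_def preim_def)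
        then obtain t y where "i x = e (t, y)" "-\<delta>/4 < t" "t < \<delta>/4" "y \<in> coords 1" using m by auto
        then obtain b where tb: "i x = E t b" "-\<delta>/4 < t" "t < \<delta>/4" unfolding coords_1 E_def by blast
        have "t \<noteq> 0"
        proof
          assume "t = 0"
          then have "i x \<in> core" using tb(1) e_in_core[of "point1 b" t] m by (simp add: E_def)
          then show False using x i_image_eq by blast
        qed
        moreover have "\<not> t < 0"
        proof
          assume "t < 0"
          then have "i x \<in> i ` \<eta>' K0" using minus[of t b] tb \<delta>(1) by simp
          then have "x \<in> \<eta>' K0" using end_M_subset[OF \<eta>' K0] x i_mem_iff[of x "\<eta>' K0"] by auto
          then show False using True V' by blast
        qed
        ultimately have t: "t > 0" by simp
        then have "\<bar>b\<bar> < s" using E\<kappa>[of t b] \<kappa>T tb \<delta> by (auto simp: not_le[symmetric])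
        then have r: "i x \<in> rect" using rectE tb t \<delta>(1) by auto
        have "sl * (\<delta> / 4) \<le> sl * (tp - t)" using sl tb by (intro mult_left_mono) (auto simp: tp_def)
        then have "\<bar>b\<bar> / 2 \<le> sl * (tp - t)" using \<open>\<bar>b\<bar> < s\<close> \<delta>(1) by (simp add: sl_def)
        then have "ramp sl tp (Complex t b) = 0" by (intro ramp_eq_0) simp
        then show ?thesis using r by (simp add: G_def tb(1) ccE T_def twist_def exp_eq_1)
      qed
    qed
    have LGM: "LG \<subseteq> topspace M" using cLG compactin_subset_topspace by blast
    have "LG \<inter> Bd = {}"
    proof -
      have "V \<inter> W = {}" using V(1) W(4) by (auto simp: K0_def)
      then have "W \<inter> M closure_of V = {}" using openin_Int_closure_of_eq_empty[OF W(1), of V] by blast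
      then show ?thesis using W(3) by (auto simp: LG_def)
    qed
    then have "\<forall>x\<in>LG. \<exists>p. plane_patch M p \<and> x \<in> range p" using patch LGM by blast
    then obtain pp where pp: "\<And>x. x \<in> LG \<Longrightarrow> plane_patch M (pp x)" "\<And>x. x \<in> LG \<Longrightarrow> x \<in> range (pp x)" by metis
    have "\<exists>\<F>. finite \<F> \<and> \<F> \<subseteq> (\<lambda>x. range (pp x)) ` LG \<and> LG \<subseteq> \<Union>\<F>"
    proof (rule compactinD[OF cLG])
      show "openin M U" if "U \<in> (\<lambda>x. range (pp x)) ` LG" for U
        using that plane_patch_open[OF pp(1) open_UNIV] by auto
    qed (use pp(2) in blast)
    then obtain F where F: "finite F" "F \<subseteq> LG" "LG \<subseteq> \<Union>((\<lambda>x. range (pp x)) ` F)"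
      by (metis finite_subset_image)
    have xpLG: "xp \<in> LG"
    proof -
      have "i xp \<in> e ` ({\<delta>/4..\<delta>} \<times> cube m s)"
        unfolding xp(2) E_def using \<delta>(1) s(1) m by (intro imageI) (auto simp: tp_def)
      moreover have "xp \<in> M closure_of V" using xp(1) closure_of_subset[of V M] V(1) by blast
      ultimately show ?thesis using xpM by (auto simp: LG_def L1_def preim_def)
    qed
    have "even (card {k\<in>{xp}. odd_point M G k})"
    proof (rule even_card_odd_points[OF Hausdorff_M _ _ cLG _ _ _ contG nG out])
      show "finite (pp ` F)" using F(1) by simp
      show "plane_patch M p" if "p \<in> pp ` F" for p using that pp(1) F(2) by blast
      show "LG \<subseteq> (\<Union>p\<in>pp ` F. range p)" using F(3) by simp
    qed (use xpLG in auto)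
    moreover have "odd_point M G xp"
      unfolding odd_point_def
    proof (intro notI; elim exE conjE)
      fix U sq assume U: "openin M U" "xp \<in> U" "continuous_map (subtopology M (U - {xp})) euclidean sq"
        "\<forall>x\<in>U - {xp}. (sq x)\<^sup>2 = G x"
      obtain iv where iv: "continuous_map (subtopology N (i ` topspace M)) M iv" "\<And>x. x \<in> topspace M \<Longrightarrow> iv (i x) = x"
        by (rule inverse_i) (use that in blast)
      \<comment> \<open>The coordinates of the strip around \<open>xp\<close>, in which
        \<open>G\<close> becomes the planar model.\<close>
      define Q where "Q z = iv (E (Re z) (Im z))" for z
      let ?S = "{z. 0 < Re z \<and> Re z < 2 * \<delta>}"
      have opS: "open ?S" by (intro open_Collect_conj open_Collect_less continuous_intros)
      have pS: "?p \<in> ?S" using \<delta>(1) by (simp add: tp_def)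
      have EiM: "E (Re z) (Im z) \<in> i ` topspace M" if "z \<in> ?S" for z
        using plus[of "Re z" "Im z"] that V(1) by auto
      have iQ: "i (Q z) = E (Re z) (Im z)" "Q z \<in> topspace M" if "z \<in> ?S" for z
        using EiM[OF that] iv(2) by (auto simp: Q_def)
      have contE: "continuous_map (top_of_set ?S) N (\<lambda>z. E (Re z) (Im z))"
      proof -
        have "continuous_on ?S (\<lambda>z. (Re z, point1 (Im z)))"
          by (intro continuous_intros continuous_on_compose2[OF continuous_on_point1]) auto
        then have "continuous_map (top_of_set ?S) (top_of_set (UNIV \<times> coords m)) (\<lambda>z. (Re z, point1 (Im z)))"
          using m by (auto simp: continuous_map_in_subtopology)
        from continuous_map_compose[OF this cont_e] show ?thesis by (simp add: o_def E_def)
      qed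
      have contQ: "continuous_map (top_of_set ?S) M Q"
      proof -
        have "continuous_map (top_of_set ?S) (subtopology N (i ` topspace M)) (\<lambda>z. E (Re z) (Im z))"
          using contE EiM by (auto simp: continuous_map_in_subtopology)
        from continuous_map_compose[OF this iv(1)] show ?thesis by (simp add: o_def Q_def[abs_def])
      qed
      have Qp: "Q ?p = xp" using xp(2) iv(2)[OF xpM] by (simp add: Q_def)
      have "openin (top_of_set ?S) {z \<in> topspace (top_of_set ?S). Q z \<in> U}"
        by (rule openin_continuous_map_preimage[OF contQ U(1)])
      then have "open {z \<in> ?S. Q z \<in> U}" using opS by (simp add: openin_open_eq)
      moreover have "?p \<in> {z \<in> ?S. Q z \<in> U}" using pS Qp U(2) by simp
      ultimately obtain r where r: "r > 0" "ball ?p r \<subseteq> {z \<in> ?S. Q z \<in> U}" by (meson openE)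
      have Qne: "Q z \<noteq> xp" if "z \<in> ball ?p r - {?p}" for z
      proof
        assume "Q z = xp"
        then have "E (Re z) (Im z) = E tp 0" using iQ(1)[of z] that r(2) xp(2) by auto
        then show False using that by (auto simp: Eeq complex_eq_iff)
      qed
      have cQ: "continuous_map (top_of_set (ball ?p r - {?p})) (subtopology M (U - {xp})) Q"
      proof -
        have "ball ?p r - {?p} \<subseteq> ?S" using r(2) by blast
        from continuous_map_from_subtopology_mono[OF contQ this] 
        have "continuous_map (top_of_set (ball ?p r - {?p})) M Q" .
        moreover have "Q z \<in> U - {xp}" if "z \<in> ball ?p r - {?p}" for z using r(2) that Qne[OF that] by blast
        ultimately show ?thesis unfolding continuous_map_in_subtopology topspace_euclidean_subtopology by blast
      qed
      have "continuous_on (ball ?p r - {?p}) (\<lambda>z. sq (Q z))"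
        using continuous_map_compose[OF cQ U(3)] by (simp add: o_def)
      moreover have "(sq (Q z))\<^sup>2 = T (g (E (Re z) (Im z))) z" if z: "z \<in> ball ?p r - {?p}" for z
      proof -
        have zS: "z \<in> ?S" "Q z \<in> U - {xp}" using z r(2) Qne by auto
        have "G (Q z) = T (g (i (Q z))) (cc (i (Q z)))"
          using strip[OF iQ(2)[OF zS(1)] iQ(1)[OF zS(1)]] zS(1) by simp
        then show ?thesis using U(4) zS iQ(1)[OF zS(1)] by (simp add: ccE)
      qed
      ultimately have nodd: "\<not> odd_point euclidean (\<lambda>z. T (g (E (Re z) (Im z))) z) ?p"
        unfolding odd_point_complex_iff using r(1) by blast
      \<comment> \<open>This factor has a continuous logarithm on the punctured disc, hence degree
        0, so the parity at the puncture is that of the twist.\<close>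
      define T' where "T' z = exp (2 * of_real pi * \<i> * of_real (ramp sl tp z * g (E (Re z) (Im z))))" for z
      have contgE: "continuous_on (ball ?p r) (\<lambda>z. g (E (Re z) (Im z)))"
      proof -
        have "continuous_on ?S (\<lambda>z. g (E (Re z) (Im z)))"
          using continuous_map_compose[OF contE contg] by (simp add: o_def)
        then show ?thesis by (rule continuous_on_subset) (use r(2) in auto)
      qed
      have h: "continuous_on (ball ?p r - {?p}) (\<lambda>z. 2 * of_real pi * \<i> * of_real (ramp sl tp z * g (E (Re z) (Im z))))"
        by (intro continuous_intros continuous_on_subset[OF continuous_on_ramp[OF sl]] continuous_on_subset[OF contgE]) auto
      have "odd_point euclidean T' ?p \<longleftrightarrow> odd (0::int)"
        by (rule odd_point_powi_exp[OF r(1) h]) (simp add: T'_def)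
      moreover have "odd_point euclidean (\<lambda>z. T' z * twist sl tp z) ?p \<longleftrightarrow>
          (odd_point euclidean T' ?p \<noteq> odd_point euclidean (twist sl tp) ?p)"
      proof (rule odd_point_mult[OF r(1)])
        show "continuous_on (ball ?p r - {?p}) T'" unfolding T'_def by (intro continuous_on_exp h)
        show "continuous_on (ball ?p r - {?p}) (twist sl tp)"
          by (rule continuous_on_subset[OF continuous_on_twist[OF sl]]) auto
        show "T' z \<noteq> 0 \<and> twist sl tp z \<noteq> 0" for z by (simp add: T'_def twist_def)
      qed
      ultimately have "odd_point euclidean (\<lambda>z. T' z * twist sl tp z) ?p"
        using odd_point_twist[OF sl] by simp
      then show False using nodd by (simp add: T_def T'_def)
    qed
    then have "{k\<in>{xp}. odd_point M G k} = {xp}" by blast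
    ultimately show False by simp
  qed
  then have "HD \<subseteq> A" by (rule A(3)[OF cH(2) Hsub(2)])
  then show ?thesis
    using s(1) sL A(1,2) order_trans[OF core_out Un_least[OF HUA]] by (intro exI[of _ s] conjI exI[of _ A]) auto
qed

end

section \<open>Local topology of manifolds\<close>

text \<open>Folding along the boundary hyperplane. Retracts inherit local compactness and local
  connectedness, which settles boundary charts.\<close>

lemma retraction_map_half_space:
  "retraction_map (Euclidean_space n) (subtopology (Euclidean_space n) (half_space n)) (\<lambda>x. x(0 := \<bar>x 0\<bar>))"
proof -
  have c: "continuous_map (Euclidean_space n) (Euclidean_space n) (\<lambda>x. x(0 := \<bar>x 0\<bar>))"
    unfolding Euclidean_space_eq_top_of_set continuous_map_in_subtopology continuous_map_iff_continuous
  proof (intro conjI)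
    show "continuous_on (coords n) (\<lambda>x. x(0 := \<bar>x 0\<bar>))"
    proof (rule continuous_on_coordinatewise_then_product)
      fix j
      have "continuous_on (coords n) (\<lambda>x. x j)" for j
        by (rule continuous_on_subset[OF continuous_on_product_coordinates]) auto
      then show "continuous_on (coords n) (\<lambda>x. (x(0 := \<bar>x 0\<bar>)) j)"
        by (cases "j = 0") (auto intro: continuous_on_rabs)
    qed
  qed auto
  show ?thesis
    unfolding retraction_map_def retraction_maps_def
  proof (intro exI[of _ "\<lambda>x. x"] conjI)
    show "continuous_map (Euclidean_space n) (subtopology (Euclidean_space n) (half_space n)) (\<lambda>x. x(0 := \<bar>x 0\<bar>))"
      using c by (auto simp: continuous_map_in_subtopology half_space_def topspace_Euclidean_space)
  qed (auto simp: half_space_def fun_eq_iff)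
qed

lemma openin_locally_compact_connected:
  assumes "\<And>x. x \<in> topspace X \<Longrightarrow> \<exists>U. openin X U \<and> x \<in> U \<and>
      locally_compact_space (subtopology X U) \<and> locally_connected_space (subtopology X U)"
  shows "locally_compact_space X" "locally_connected_space X"
proof -
  show "locally_compact_space X"
    unfolding locally_compact_space_def
  proof
    fix x assume "x \<in> topspace X"
    then obtain U where U: "openin X U" "x \<in> U" "locally_compact_space (subtopology X U)" using assms by blast
    then obtain W K where "openin (subtopology X U) W" "compactin (subtopology X U) K" "x \<in> W" "W \<subseteq> K"
      using openin_subset[OF U(1)] unfolding locally_compact_space_def by (metis IntI subsetD topspace_subtopology)
    then show "\<exists>W K. openin X W \<and> compactin X K \<and> x \<in> W \<and> W \<subseteq> K"
      using openin_trans_full[OF _ U(1)] by (metis compactin_subtopology)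
  qed
  show "locally_connected_space X"
    unfolding locally_connected_space
  proof (intro allI impI, elim conjE)
    fix V x assume V: "openin X V" "x \<in> V"
    then have "x \<in> topspace X" using openin_subset by blast
    then obtain U where U: "openin X U" "x \<in> U" "locally_connected_space (subtopology X U)" using assms by blast
    have "openin (subtopology X U) (V \<inter> U)" using V(1) by (auto simp: openin_subtopology)
    then obtain W where "openin (subtopology X U) W" "connectedin (subtopology X U) W" "x \<in> W" "W \<subseteq> V \<inter> U"
      using U V unfolding locally_connected_space by (metis IntI)
    then show "\<exists>W. openin X W \<and> connectedin X W \<and> x \<in> W \<and> W \<subseteq> V"
      using openin_trans_full[OF _ U(1)] by (metis connectedin_subtopology le_inf_iff)
  qed
qed

lemma is_chart_locally:
  assumes "is_chart n M (U, \<psi>)"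
  shows "locally_compact_space (subtopology M U)" "locally_connected_space (subtopology M U)"
proof -
  let ?E = "Euclidean_space n" and ?H = "subtopology (Euclidean_space n) (half_space n)"
  have U: "openin M U" "embedding_map (subtopology M U) ?E \<psi>" "openin ?E (\<psi> ` U) \<or> openin ?H (\<psi> ` U)"
    using assms by (auto simp: is_chart_def)
  have tU: "topspace (subtopology M U) = U" using openin_subset[OF U(1)] by auto
  then have h: "subtopology M U homeomorphic_space subtopology ?E (\<psi> ` U)"
    using U(2) by (auto simp: embedding_map_def intro: homeomorphic_map_imp_homeomorphic_space)
  have lE: "locally_compact_space ?E" "locally_connected_space ?E"
    by (rule locally_compact_Euclidean_space, rule locally_connected_Euclidean_space)
  have lH: "locally_compact_space ?H" "locally_connected_space ?H"
    using locally_compact_space_retraction_map_image[OF retraction_map_half_space lE(1)]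
      locally_connected_space_retraction_map_image[OF retraction_map_half_space lE(2)] .
  have HE: "Hausdorff_space ?E" "Hausdorff_space ?H"
    by (auto simp: Hausdorff_Euclidean_space Hausdorff_space_subtopology)
  have "locally_compact_space (subtopology ?E (\<psi> ` U)) \<and> locally_connected_space (subtopology ?E (\<psi> ` U))"
    using U(3)
  proof
    assume "openin ?E (\<psi> ` U)"
    then show ?thesis using lE HE locally_compact_space_open_subset locally_connected_space_open_subset by blast
  next
    assume o: "openin ?H (\<psi> ` U)"
    then have "\<psi> ` U \<subseteq> half_space n" using openin_imp_subset by blast
    then have "subtopology ?H (\<psi> ` U) = subtopology ?E (\<psi> ` U)"
      by (simp add: subtopology_subtopology Int_absorb1)
    then show ?thesis
      using lH HE o locally_compact_space_open_subset locally_connected_space_open_subset by metis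
  qed
  then show "locally_compact_space (subtopology M U)" "locally_connected_space (subtopology M U)"
    using homeomorphic_locally_compact_space[OF h] homeomorphic_locally_connected_space[OF h] by auto
qed

lemma pl_manifold_locally:
  assumes "pl_manifold n M \<A>"
  shows "locally_compact_space M" "locally_connected_space M"
proof -
  have "\<exists>U. openin M U \<and> x \<in> U \<and> locally_compact_space (subtopology M U) \<and> locally_connected_space (subtopology M U)"
    if x: "x \<in> topspace M" for x
  proof -
    have "x \<in> \<Union>(fst ` \<A>)" using x assms by (simp add: pl_manifold_def)
    then obtain c where c: "c \<in> \<A>" "x \<in> fst c" by blast
    have "is_chart n M c" using assms c(1) by (simp add: pl_manifold_def)
    then have "is_chart n M (fst c, snd c)" by simp
    then show ?thesis using is_chart_locally[of n M "fst c" "snd c"] c(2) by (auto simp: is_chart_def)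
  qed
  then show "locally_compact_space M" "locally_connected_space M"
    using openin_locally_compact_connected[of M] by auto
qed

section \<open>Interior points: invariance of domain and plane patches\<close>

definition join_first :: "real \<times> (nat \<Rightarrow> real) \<Rightarrow> nat \<Rightarrow> real" where
  "join_first z = (\<lambda>j. case j of 0 \<Rightarrow> fst z | Suc k \<Rightarrow> snd z k)"

lemma split_join [simp]: "split_first (join_first z) = z"
  by (cases z) (simp add: split_first_def join_first_def)

lemma continuous_on_split_first: "continuous_on UNIV split_first"
  unfolding split_first_def
  by (intro continuous_on_Pair continuous_on_coordinatewise_then_product continuous_on_product_coordinates)

text \<open>Openness in \<open>M\<close> is a matter of invariance of domain, since a tube is given
  only as an embedding. Its image lies in the interior, so near each image point a Euclidean
  neighbourhood turns \<phi> into an injective map between subsets of Euclidean space of the same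
  dimension.\<close>

lemma openin_injective_image:
  fixes S :: "(real \<times> (nat \<Rightarrow> real)) set"
  assumes cont: "continuous_map (top_of_set S) M \<phi>" and S: "openin (top_of_set (UNIV \<times> coords m)) S"
    and inj: "inj_on \<phi> S" and int: "\<phi> ` S \<subseteq> manifold_interior (Suc m) M"
  shows "openin M (\<phi> ` S)"
proof (subst openin_subopen, intro ballI)
  fix x assume x: "x \<in> \<phi> ` S"
  let ?E = "Euclidean_space (Suc m)"
  obtain U V where U: "openin M U" "x \<in> U" and V: "openin ?E V"
    and h: "subtopology M U homeomorphic_space subtopology ?E V"
    using x int by (auto simp: manifold_interior_def)
  obtain f g where fg: "homeomorphic_maps (subtopology M U) (subtopology ?E V) f g"
    using h by (auto simp: homeomorphic_space_def)
  have tU: "topspace (subtopology M U) = U" "topspace (subtopology ?E V) = V"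
    using openin_subset[OF U(1)] openin_subset[OF V] by auto
  have f: "continuous_map (subtopology M U) (subtopology ?E V) f" "continuous_map (subtopology ?E V) (subtopology M U) g"
    "\<And>x. x \<in> U \<Longrightarrow> g (f x) = x" "\<And>y. y \<in> V \<Longrightarrow> f (g y) = y"
    using fg unfolding homeomorphic_maps_def tU by auto
  define S' where "S' = {z \<in> S. \<phi> z \<in> U}"
  define Q where "Q = split_first -` S' \<inter> coords (Suc m)"
  have "openin (top_of_set S) S'"
    using openin_continuous_map_preimage[OF cont U(1)] by (simp add: S'_def)
  then have "openin (top_of_set (UNIV \<times> coords m)) S'" using S openin_trans by blast
  then obtain O' where O': "open O'" "S' = (UNIV \<times> coords m) \<inter> O'" by (auto simp: openin_open)
  have opQ: "openin ?E Q"
  proof -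
    have "open (split_first -` O')" using continuous_on_split_first O'(1) by (simp add: open_vimage)
    moreover have "Q = coords (Suc m) \<inter> split_first -` O'"
      unfolding Q_def O'(2) by (auto simp: split_first_def)
    ultimately show ?thesis unfolding Euclidean_space_eq_top_of_set by (simp add: openin_open_Int)
  qed
  have Qim: "split_first ` Q = S'"
  proof
    show "S' \<subseteq> split_first ` Q"
    proof
      fix z assume z: "z \<in> S'"
      then have "z \<in> UNIV \<times> coords m" using O'(2) by blast
      then have "join_first z \<in> coords (Suc m)" by (auto simp: join_first_def split: nat.split)
      then have "join_first z \<in> Q" using z by (simp add: Q_def)
      then show "z \<in> split_first ` Q" by (metis imageI split_join)
    qed
  qed (auto simp: Q_def)
  have injsplit: "inj split_first"
  proof (rule injI)
    fix x y assume "split_first x = split_first y"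
    then have "x 0 = y 0" "\<And>j. x (Suc j) = y (Suc j)" by (auto simp: split_first_def fun_eq_iff)
    then have "x j = y j" for j by (cases j) auto
    then show "x = y" by blast
  qed
  have c1: "continuous_map (subtopology ?E Q) (top_of_set S') split_first"
  proof -
    have "subtopology ?E Q = top_of_set Q"
      unfolding Euclidean_space_eq_top_of_set subtopology_subtopology by (simp add: Q_def Int_absorb1)
    then show ?thesis using Qim continuous_on_subset[OF continuous_on_split_first]
      by (auto simp: continuous_map_in_subtopology)
  qed
  have c2: "continuous_map (top_of_set S') (subtopology M U) \<phi>"
    using continuous_map_from_subtopology_mono[OF cont, of S'] by (auto simp: continuous_map_in_subtopology S'_def)
  have c3: "continuous_map (subtopology ?E Q) (subtopology ?E V) (f \<circ> (\<phi> \<circ> split_first))"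
    by (rule continuous_map_compose[OF continuous_map_compose[OF c1 c2] f(1)])
  have inj3: "inj_on (f \<circ> (\<phi> \<circ> split_first)) Q"
  proof (intro comp_inj_on)
    show "inj_on split_first Q" using injsplit inj_on_subset by blast
    show "inj_on \<phi> (split_first ` Q)" unfolding Qim using inj by (rule inj_on_subset) (auto simp: S'_def)
    have "inj_on f U" by (rule inj_on_inverseI[of U g]) (rule f(3))
    then show "inj_on f ((\<phi> \<circ> split_first) ` Q)"
      by (rule inj_on_subset) (use Qim in \<open>auto simp: S'_def image_comp[symmetric]\<close>)
  qed
  have "openin ?E ((f \<circ> (\<phi> \<circ> split_first)) ` Q)"
    using invariance_of_domain_Euclidean_space[OF opQ _ inj3] c3 by (simp add: continuous_map_in_subtopology)
  moreover have im: "(f \<circ> (\<phi> \<circ> split_first)) ` Q = f ` \<phi> ` S'" by (simp only: image_comp[symmetric] Qim)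
  ultimately have op: "openin ?E (f ` \<phi> ` S')" by simp
  have sub: "\<phi> ` S' \<subseteq> U" by (auto simp: S'_def)
  then have fV: "f ` \<phi> ` S' \<subseteq> V" using f(1) tU by (auto simp: continuous_map_def Pi_iff)
  have "openin (subtopology M U) {x \<in> topspace (subtopology M U). f x \<in> f ` \<phi> ` S'}"
    by (rule openin_continuous_map_preimage[OF f(1)]) (use op fV in \<open>auto simp: openin_subtopology\<close>)
  moreover have "{x \<in> topspace (subtopology M U). f x \<in> f ` \<phi> ` S'} = \<phi> ` S'"
    unfolding tU
  proof safe
    fix a z assume "a \<in> U" "z \<in> S'" "f a = f (\<phi> z)"
    then have "a = \<phi> z" using f(3) sub by (metis image_subset_iff)
    then show "a \<in> \<phi> ` S'" using \<open>z \<in> S'\<close> by blast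
  qed (use sub in auto)
  ultimately have "openin M (\<phi> ` S')" using openin_trans_full[OF _ U(1)] by simp
  moreover have "x \<in> \<phi> ` S'" using x U(2) by (auto simp: S'_def)
  moreover have "\<phi> ` S' \<subseteq> \<phi> ` S" by (auto simp: S'_def)
  ultimately show "\<exists>T. openin M T \<and> x \<in> T \<and> T \<subseteq> \<phi> ` S" by blast
qed

text \<open>A Euclidean neighbourhood contains the image of a round disc, and an open disc is
  homeomorphic to the whole plane. The parametrization by the whole plane is what the planar parity
  theorem requires.\<close>

lemma plane_patch_interior:
  assumes x: "x \<in> manifold_interior 2 M"
  shows "\<exists>p. plane_patch M p \<and> x \<in> range p"
proof -
  let ?E = "Euclidean_space 2"
  obtain U V where U: "openin M U" "x \<in> U" and V: "openin ?E V"
    and h: "subtopology M U homeomorphic_space subtopology ?E V"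
    using x by (auto simp: manifold_interior_def)
  obtain f g where fg: "homeomorphic_maps (subtopology M U) (subtopology ?E V) f g"
    using h by (auto simp: homeomorphic_space_def)
  have tU: "topspace (subtopology M U) = U" "topspace (subtopology ?E V) = V"
    using openin_subset[OF U(1)] openin_subset[OF V] by auto
  have f: "continuous_map (subtopology M U) (subtopology ?E V) f" "continuous_map (subtopology ?E V) (subtopology M U) g"
    "\<And>x. x \<in> U \<Longrightarrow> g (f x) = x" "\<And>y. y \<in> V \<Longrightarrow> f (g y) = y"
    using fg unfolding homeomorphic_maps_def tU by auto
  have gopen: "open_map (subtopology ?E V) (subtopology M U) g"
    using fg homeomorphic_maps_map homeomorphic_imp_open_map by metis
  define pt where "pt z = (\<lambda>j::nat. if j = 0 then Re z else if j = 1 then Im z else 0)" for z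
  have ptc: "pt z \<in> coords 2" for z by (auto simp: pt_def)
  have ptinv: "Complex (pt z 0) (pt z 1) = z" for z by (simp add: pt_def)
  have ptsurj: "pt (Complex (y 0) (y 1)) = y" if "y \<in> coords 2" for y
  proof
    fix j show "pt (Complex (y 0) (y 1)) j = y j"
    proof (cases "j < 2")
      case True then have "j = 0 \<or> j = 1" by auto
      then show ?thesis by (auto simp: pt_def)
    next
      case False then show ?thesis using that by (auto simp: pt_def)
    qed
  qed
  have contpt: "continuous_on UNIV pt"
  proof (rule continuous_on_coordinatewise_then_product)
    fix j show "continuous_on UNIV (\<lambda>z. pt z j)"
      unfolding pt_def by (cases "j = 0"; cases "j = 1") (auto intro!: continuous_intros)
  qed
  have opV: "open {z. pt z \<in> V}"
  proof -
    obtain O' where "open O'" "V = coords 2 \<inter> O'"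
      using V unfolding Euclidean_space_eq_top_of_set by (auto simp: openin_open)
    then have "{z. pt z \<in> V} = pt -` O'" using ptc by auto
    then show ?thesis using contpt \<open>open O'\<close> by (simp add: open_vimage)
  qed
  have fxV: "f x \<in> V" using f(1) U(2) tU by (auto simp: continuous_map_def Pi_iff)
  then have fxc: "f x \<in> coords 2" using openin_subset[OF V] by (auto simp: topspace_Euclidean_space)
  define w where "w = Complex (f x 0) (f x 1)"
  have ptw: "pt w = f x" unfolding w_def by (rule ptsurj[OF fxc])
  then have "w \<in> {z. pt z \<in> V}" using fxV by simp
  then obtain r where r: "r > 0" "ball w r \<subseteq> {z. pt z \<in> V}" using opV by (meson openE)
  obtain a b where ab: "homeomorphism (UNIV::complex set) (ball w r) a b"
    using homeomorphic_ball_UNIV[OF r(1), of w] homeomorphic_sym by (metis homeomorphic_def)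
  then have a: "continuous_on UNIV a" "continuous_on (ball w r) b" "range a = ball w r"
    "\<And>z. b (a z) = z" "\<And>z. z \<in> ball w r \<Longrightarrow> a (b z) = z"
    by (auto simp: homeomorphism_def)
  define p where "p z = g (pt (a z))" for z
  have aV: "pt (a z) \<in> V" for z using a(3) r(2) by auto
  have "continuous_map euclidean (subtopology ?E V) (\<lambda>z. pt (a z))"
  proof -
    have "continuous_on UNIV (\<lambda>z. pt (a z))" by (rule continuous_on_compose2[OF contpt a(1)]) auto
    then show ?thesis unfolding Euclidean_space_eq_top_of_set subtopology_subtopology
      using aV ptc by (auto simp: continuous_map_in_subtopology)
  qed
  from continuous_map_compose[OF this f(2)] have contp: "continuous_map euclidean M p"
    by (simp add: o_def p_def[abs_def] continuous_map_in_subtopology)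
  have injp: "inj p"
  proof (rule injI)
    fix z z' assume "p z = p z'"
    then have "pt (a z) = pt (a z')" using f(4)[OF aV] unfolding p_def by metis
    then show "z = z'" using ptinv a(4) by metis
  qed
  have "open_map euclidean M p"
    unfolding open_map_def
  proof (intro allI impI)
    fix S :: "complex set" assume "openin euclidean S"
    then have "open S" by simp
    have "openin (top_of_set (ball w r)) (ball w r \<inter> b -` S)"
      using a(2) \<open>open S\<close> by (simp add: continuous_on_open_invariant continuous_openin_preimage_gen)
    moreover have aS: "a ` S = ball w r \<inter> b -` S"
    proof (intro equalityI subsetI)
      fix z assume "z \<in> ball w r \<inter> b -` S"
      then show "z \<in> a ` S" using a(5)[of z] by (metis IntE imageI vimage_eq)
    qed (use a(3,4) in auto)
    ultimately have opa: "open (a ` S)" using openin_open_trans open_ball by metis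
    have "openin ?E (pt ` a ` S)"
    proof -
      have "continuous_on UNIV (\<lambda>y::nat \<Rightarrow> real. Complex (y 0) (y 1))"
        by (intro continuous_on_Complex continuous_on_product_coordinates)
      then have "open ((\<lambda>y::nat \<Rightarrow> real. Complex (y 0) (y 1)) -` a ` S)" using opa by (simp add: open_vimage)
      moreover have "pt ` a ` S = coords 2 \<inter> (\<lambda>y::nat \<Rightarrow> real. Complex (y 0) (y 1)) -` a ` S"
      proof (intro equalityI subsetI)
        fix y assume "y \<in> coords 2 \<inter> (\<lambda>y::nat \<Rightarrow> real. Complex (y 0) (y 1)) -` a ` S"
        then have y: "y \<in> coords 2" "Complex (y 0) (y 1) \<in> a ` S" by (simp_all only: Int_iff vimage_eq)
        then have "pt (Complex (y 0) (y 1)) \<in> pt ` a ` S" by (intro imageI)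
        then show "y \<in> pt ` a ` S" unfolding ptsurj[OF y(1)] .
      qed (use ptc ptinv in auto)
      ultimately show ?thesis unfolding Euclidean_space_eq_top_of_set by (simp add: openin_open_Int)
    qed
    moreover have "pt ` a ` S \<subseteq> V" using aV by auto
    ultimately have "openin (subtopology ?E V) (pt ` a ` S)" by (auto simp: openin_subtopology)
    then have "openin (subtopology M U) (g ` pt ` a ` S)" using gopen by (simp add: open_map_def)
    then have "openin M (g ` pt ` a ` S)" using openin_trans_full[OF _ U(1)] by blast
    moreover have "p ` S = g ` pt ` a ` S" by (auto simp: p_def)
    ultimately show "openin M (p ` S)" by simp
  qed
  then have "plane_patch M p" using contp injp by (simp add: plane_patch_def)
  moreover have "x \<in> range p"
  proof -
    have "p (b w) = x" using r(1) a(5)[of w] ptw f(3)[OF U(2)] by (simp add: p_def)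
    then show ?thesis by blast
  qed
  ultimately show ?thesis by blast
qed

section \<open>The 1-handle at infinity\<close>

text \<open>In dimension 0 an interior point is isolated, whereas the origin of an embedded
  half-line is not. This makes \<open>n - 1\<close> an honest predecessor.\<close>

lemma dimension_positive:
  assumes "is_ray n M \<A> r"
  shows "n \<noteq> 0"
proof
  assume "n = 0"
  then have "r 0 \<in> manifold_interior 0 M" and emb: "embedding_map (top_of_set {0..}) M r"
    using assms by (auto simp: is_ray_def)
  then obtain U V where U: "openin M U" "r 0 \<in> U" and V: "openin (Euclidean_space 0) V"
    and h: "subtopology M U homeomorphic_space subtopology (Euclidean_space 0) V"
    by (auto simp: manifold_interior_def)
  obtain f g where fg: "homeomorphic_maps (subtopology M U) (subtopology (Euclidean_space 0) V) f g"
    using h by (auto simp: homeomorphic_space_def)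
  have "f x \<in> topspace (Euclidean_space 0)" "g (f x) = x" if "x \<in> U" for x
    using fg that openin_subset[OF U(1)] unfolding homeomorphic_maps_def continuous_map_def by auto
  then have "f x = (\<lambda>_. 0)" "g (f x) = x" if "x \<in> U" for x
    using that by (auto simp: topspace_Euclidean_space)
  then have U1: "x = r 0" if "x \<in> U" for x using that U(2) by metis
  have hom: "homeomorphic_map (top_of_set {0..}) (subtopology M (r ` {0..})) r"
    using emb by (simp add: embedding_map_def)
  have inj: "inj_on r {0..}" and c: "continuous_map (top_of_set {0..}) M r"
    using homeomorphic_imp_injective_map[OF hom] homeomorphic_imp_continuous_map[OF hom]
    by (simp_all add: continuous_map_in_subtopology)
  have "openin (top_of_set {0..}) {t \<in> topspace (top_of_set {0..}). r t \<in> U}"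
    by (rule openin_continuous_map_preimage[OF c U(1)])
  moreover have "{t \<in> topspace (top_of_set {0..}). r t \<in> U} = {0}"
  proof -
    have "t = 0" if "t \<ge> 0" "r t \<in> U" for t :: real
      using inj_onD[OF inj, of t 0] U1[OF that(2)] that(1) by auto
    then show ?thesis using U(2) by auto
  qed
  ultimately have "openin (top_of_set {0..}) {0::real}" by simp
  then obtain O' where O': "open O'" "{0::real} = {0..} \<inter> O'" by (auto simp: openin_open)
  then obtain e where "e > 0" "ball 0 e \<subseteq> O'" by (metis IntD2 openE singletonI)
  then have "e / 2 \<in> {0..} \<inter> O'" by (auto simp: subset_iff dist_norm)
  then have "e / 2 \<in> {0::real}" by (simp only: O'(2)[symmetric])
  then show False using \<open>e > 0\<close> by simp
qed

lemma orientation_reversing_iso_props: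
  assumes "orientation_reversing_iso \<rho>"
  shows "continuous_on {0<..} \<rho>" "inj_on \<rho> {0<..}" "\<rho> ` {0<..} = {0<..}"
    "\<And>s t. 0 < s \<Longrightarrow> s < t \<Longrightarrow> \<rho> t < \<rho> s"
proof -
  let ?X = "subtopology (Euclidean_space 1) (point1 ` {0<..})"
  let ?f = "\<lambda>x. point1 (\<rho> (x 0))"
  have h: "homeomorphic_map ?X ?X ?f" and dec: "\<forall>s>0. \<forall>t>s. \<rho> t < \<rho> s"
    using assms by (auto simp: orientation_reversing_iso_def pl_iso_def)
  show "\<rho> t < \<rho> s" if "0 < s" "s < t" for s t using dec that by blast
  then show "inj_on \<rho> {0<..}" by (intro inj_onI) (metis greaterThan_iff less_irrefl linorder_less_linear)
  have sub: "point1 ` {0<..} \<subseteq> coords 1" by auto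
  have X: "?X = top_of_set (point1 ` {0<..})"
    unfolding Euclidean_space_eq_top_of_set subtopology_subtopology using sub by (simp add: Int_absorb1)
  have c: "continuous_on (point1 ` {0<..}) ?f" and im: "?f ` point1 ` {0<..} = point1 ` {0<..}"
    using h homeomorphic_imp_continuous_map homeomorphic_imp_surjective_map unfolding X
    by (fastforce simp: continuous_map_in_subtopology)+
  have p0: "point1 t 0 = t" for t by (simp add: point1_def)
  have "continuous_on {0<..} (\<lambda>t. ?f (point1 t))"
    by (rule continuous_on_compose2[OF c continuous_on_subset[OF continuous_on_point1]]) auto
  then have "continuous_on {0<..} (\<lambda>t. ?f (point1 t) 0)"
    by (rule continuous_on_compose2[OF continuous_on_product_coordinates]) auto
  then show "continuous_on {0<..} \<rho>" by (simp add: p0)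
  have "(\<lambda>x. x 0) ` ?f ` point1 ` {0<..} = (\<lambda>x. x 0) ` point1 ` {0<..}" by (simp only: im)
  then show "\<rho> ` {0<..} = {0<..}" by (simp add: image_image p0)
qed

lemma radial_expansion_iso_inverse:
  assumes "radial_expansion_iso m l"
  defines "l' \<equiv> inv_into (open_disk m) l"
  shows "continuous_on (coords m) l'" "inj_on l' (coords m)" "l' ` coords m \<subseteq> cube m 1"
proof -
  have od: "open_disk m \<subseteq> coords m" by (auto simp: open_disk_def topspace_Euclidean_space)
  have h: "homeomorphic_map (subtopology (Euclidean_space m) (open_disk m)) (subtopology (Euclidean_space m) (topspace (Euclidean_space m))) l"
    using assms(1) by (simp add: radial_expansion_iso_def pl_iso_def)
  have X: "subtopology (Euclidean_space m) (open_disk m) = top_of_set (open_disk m)"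
    unfolding Euclidean_space_eq_top_of_set subtopology_subtopology using od by (simp add: Int_absorb1)
  have h': "homeomorphic_map (top_of_set (open_disk m)) (top_of_set (coords m)) l"
    using h unfolding X by (simp add: Euclidean_space_eq_top_of_set subtopology_subtopology)
  then obtain g where g: "homeomorphic_maps (top_of_set (open_disk m)) (top_of_set (coords m)) l g"
    by (auto simp: homeomorphic_map_maps)
  have g': "continuous_on (coords m) g" "\<And>y. y \<in> coords m \<Longrightarrow> g y \<in> open_disk m"
    "\<And>y. y \<in> coords m \<Longrightarrow> l (g y) = y" "\<And>x. x \<in> open_disk m \<Longrightarrow> g (l x) = x"
    using g by (auto simp: homeomorphic_maps_def continuous_map_in_subtopology Pi_iff)
  have inj: "inj_on l (open_disk m)" by (rule inj_on_inverseI[of _ g]) (rule g'(4))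
  have eq: "l' y = g y" if "y \<in> coords m" for y
    using inv_into_f_f[OF inj g'(2)[OF that]] unfolding l'_def g'(3)[OF that] .
  show "continuous_on (coords m) l'" by (rule continuous_on_eq[OF g'(1)]) (simp add: eq)
  show "inj_on l' (coords m)" by (rule inj_on_inverseI[of _ l]) (use g'(3) eq in auto)
  show "l' ` coords m \<subseteq> cube m 1"
  proof
    fix x assume "x \<in> l' ` coords m"
    then have "x \<in> open_disk m" using eq g'(2) by auto
    then show "x \<in> cube m 1" by (force simp: open_disk_def cube_def)
  qed
qed

lemma connected_cube: "connected (cube m s)"
proof (rule connected_if_segments)
  fix x y t assume xy: "x \<in> cube m s" "y \<in> cube m s" "0 \<le> (t::real)" "t \<le> 1"
  have "\<bar>(1 - t) * x j + t * y j\<bar> \<le> s" if j: "j < m" for j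
  proof -
    have "(1 - t) * x j + t * y j \<le> s"
      using xy j by (intro convex_bound_le) (auto simp: cube_eq abs_le_iff)
    moreover have "(1 - t) * (- x j) + t * (- y j) \<le> s"
      using xy j by (intro convex_bound_le) (auto simp: cube_eq abs_le_iff)
    ultimately show ?thesis by (auto simp: abs_le_iff algebra_simps)
  qed
  then show "(\<lambda>j. (1 - t) * x j + t * y j) \<in> cube m s" using xy by (auto simp: cube_eq)
qed

text \<open>One of the two sides of the handle: \<open>\<phi>\<close> is \<open>phi_plus\<close>, or \<open>phi_minus\<close> after reflecting \<open>\<real>\<close>.\<close>

lemma tubular_nbhd_side:
  assumes \<nu>: "is_tubular_nbhd_map (Suc m) M \<A> r \<nu>" and \<rho>: "orientation_reversing_iso \<rho>"
    and l: "radial_expansion_iso m l" and r: "points_to M r \<eta>" and \<eta>: "\<eta> \<in> ends M"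
  defines "\<phi> \<equiv> \<lambda>(t, y). \<nu> (\<rho> t, inv_into (open_disk m) l y)"
  shows "continuous_map (top_of_set ({0<..} \<times> coords m)) M \<phi>"
    and "inj_on \<phi> ({0<..} \<times> coords m)"
    and "\<phi> ` ({0<..} \<times> coords m) \<subseteq> manifold_interior (Suc m) M"
    and "\<phi> ` ({0<..} \<times> coords m) \<subseteq> \<nu> ` ({0..} \<times> cube m 1)"
    and "\<And>K. compactin M K \<Longrightarrow> \<exists>\<epsilon>>0. \<phi> ` ({0<..<\<epsilon>} \<times> coords m) \<subseteq> \<eta> K"
proof -
  let ?l = "inv_into (open_disk m) l"
  let ?T = "{0..} \<times> cube m 1"
  have cc: "cube m 1 \<subseteq> coords m" by (auto simp: cube_eq)
  have X: "prod_topology (top_of_set {0..}) (subtopology (Euclidean_space m) (cube m 1)) = top_of_set ?T"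
    unfolding Euclidean_space_eq_top_of_set subtopology_subtopology Int_absorb1[OF cc]
    by (simp add: prod_topology_subtopology subtopology_subtopology prod_topology_euclidean Times_Int_Times)
  have emb: "embedding_map (top_of_set ?T) M \<nu>" and proper: "proper_map (top_of_set ?T) M \<nu>"
    and int: "\<nu> ` ?T \<subseteq> manifold_interior (Suc m) M" and ray: "\<And>t. t \<ge> 0 \<Longrightarrow> \<nu> (t, \<lambda>_. 0) = r t"
    using \<nu> unfolding is_tubular_nbhd_map_def Let_def diff_Suc_1 X by auto
  have hom: "homeomorphic_map (top_of_set ?T) (subtopology M (\<nu> ` ?T)) \<nu>"
    using emb by (simp add: embedding_map_def)
  have c\<nu>: "continuous_map (top_of_set ?T) M \<nu>"
    using homeomorphic_imp_continuous_map[OF hom] by (simp add: continuous_map_in_subtopology)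
  have inj\<nu>: "inj_on \<nu> ?T"
    using homeomorphic_imp_injective_map[OF hom] by simp
  note R = orientation_reversing_iso_props[OF \<rho>]
  note l' = radial_expansion_iso_inverse[OF l]
  define \<theta> where "\<theta> z = (\<rho> (fst z), ?l (snd z))" for z
  have \<phi>\<theta>: "\<phi> = \<nu> \<circ> \<theta>" by (auto simp: \<phi>_def \<theta>_def)
  let ?S = "{0::real<..} \<times> coords m"
  have \<rho>pos: "\<rho> t > 0" if "t > 0" for t using R(3) that by auto
  have \<theta>im: "\<theta> ` ?S \<subseteq> ?T"
  proof (rule image_subsetI)
    fix z assume "z \<in> ?S"
    then have "fst z > 0" "snd z \<in> coords m" by auto
    then show "\<theta> z \<in> ?T" using \<rho>pos[of "fst z"] l'(3) by (simp add: \<theta>_def image_subset_iff)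
  qed
  have c\<theta>: "continuous_on ?S \<theta>"
    unfolding \<theta>_def
    by (intro continuous_on_Pair continuous_on_compose2[OF R(1)] continuous_on_compose2[OF l'(1)] continuous_intros) auto
  have inj\<theta>: "inj_on \<theta> ?S"
    using R(2) l'(2) by (auto simp: inj_on_def \<theta>_def)
  have "continuous_map (top_of_set ?S) (top_of_set ?T) \<theta>"
    using c\<theta> \<theta>im by (auto simp: continuous_map_in_subtopology)
  then show "continuous_map (top_of_set ?S) M \<phi>" unfolding \<phi>\<theta> using c\<nu> by (rule continuous_map_compose)
  show "inj_on \<phi> ?S" unfolding \<phi>\<theta> using inj\<theta> inj_on_subset[OF inj\<nu> \<theta>im] by (rule comp_inj_on)
  show sub: "\<phi> ` ?S \<subseteq> \<nu> ` ?T" unfolding \<phi>\<theta> using \<theta>im by auto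
  then show "\<phi> ` ?S \<subseteq> manifold_interior (Suc m) M" using int by blast
  fix K assume K: "compactin M K"
  \<comment> \<open>Properness bounds, along the length of the tube, the part that meets
    \<open>K\<close>. The far part is connected, misses \<open>K\<close> and contains a tail of the
    ray, so it lies in \<eta> K.\<close>
  have "compactin (top_of_set ?T) {z \<in> topspace (top_of_set ?T). \<nu> z \<in> K}"
    using compactin_proper_map_preimage[OF proper K] .
  then have "compact {z \<in> ?T. \<nu> z \<in> K}" by (simp add: compactin_subtopology)
  then have "compact (fst ` {z \<in> ?T. \<nu> z \<in> K})" by (intro compact_continuous_image continuous_intros)
  then obtain B where B: "\<And>z. z \<in> ?T \<Longrightarrow> \<nu> z \<in> K \<Longrightarrow> \<bar>fst z\<bar> \<le> B"
    using compact_imp_bounded bounded_iff by (metis (mono_tags, lifting) imageI mem_Collect_eq real_norm_def)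
  \<comment> \<open>Positive as well as larger than \<open>B\<close>, so that \<open>b\<close> lies
    in the range of \<rho>.\<close>
  define b where "b = \<bar>B\<bar> + 1"
  let ?C = "\<nu> ` ({b<..} \<times> cube m 1)"
  have bT: "{b<..} \<times> cube m 1 \<subseteq> ?T" by (auto simp: b_def)
  have "connected ({b<..} \<times> cube m 1)" by (intro connected_Times connected_cube) auto
  then have "connectedin M ?C"
    by (intro connectedin_continuous_map_image[OF c\<nu>]) (use bT in \<open>simp add: connectedin_subtopology\<close>)
  moreover have "?C \<inter> K = {}"
  proof -
    have "\<nu> z \<notin> K" if "z \<in> {b<..} \<times> cube m 1" for z
    proof
      assume "\<nu> z \<in> K"
      then have "\<bar>fst z\<bar> \<le> B" using B bT that by blast
      then show False using that by (auto simp: b_def)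
    qed
    then show ?thesis by blast
  qed
  moreover have "?C \<inter> \<eta> K \<noteq> {}"
  proof -
    obtain a where a: "a \<ge> 0" "r ` {a<..} \<subseteq> \<eta> K" using r K by (auto simp: points_to_def)
    define t where "t = max a b + 1"
    have "t > a" "t > b" "t \<ge> 0" using a(1) by (auto simp: t_def)
    moreover have "(\<lambda>_. 0) \<in> cube m 1" by (rule zero_in_cube) simp
    ultimately have "\<nu> (t, \<lambda>_. 0) \<in> ?C" by (intro imageI) auto
    moreover have "\<nu> (t, \<lambda>_. 0) \<in> \<eta> K" using ray[of t] a(2) \<open>t > a\<close> \<open>t \<ge> 0\<close> by auto
    ultimately show ?thesis by blast
  qed
  ultimately have C: "?C \<subseteq> \<eta> K" by (rule end_maximal[OF \<eta> K])
  \<comment> \<open>As \<rho> reverses the order, handle parameters below \<epsilon> correspond to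
    the tube beyond length \<open>b\<close>.\<close>
  have "b \<in> \<rho> ` {0<..}" unfolding R(3) by (auto simp: b_def)
  then obtain \<epsilon> where \<epsilon>: "\<epsilon> > 0" "\<rho> \<epsilon> = b" by auto
  have "\<phi> ` ({0<..<\<epsilon>} \<times> coords m) \<subseteq> ?C"
  proof -
    have "\<theta> z \<in> {b<..} \<times> cube m 1" if "z \<in> {0<..<\<epsilon>} \<times> coords m" for z
      using that R(4)[of "fst z" \<epsilon>] \<epsilon>(2) l'(3) by (auto simp: \<theta>_def)
    then show ?thesis unfolding \<phi>\<theta> by auto
  qed
  then show "\<exists>\<epsilon>>0. \<phi> ` ({0<..<\<epsilon>} \<times> coords m) \<subseteq> \<eta> K" using C \<epsilon>(1) by blast
qed

lemma open_map_from_euclidean_side: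
  fixes A :: "real set"
  assumes "continuous_map (top_of_set S) M \<phi>" "S = A \<times> coords m" "open A" "inj_on \<phi> S"
    "\<phi> ` S \<subseteq> manifold_interior (Suc m) M" "openin (top_of_set (UNIV \<times> coords m)) W"
  shows "openin M (\<phi> ` (W \<inter> S))"
proof (rule openin_injective_image)
  show "continuous_map (top_of_set (W \<inter> S)) M \<phi>"
    by (rule continuous_map_from_subtopology_mono[OF assms(1)]) auto
  have "S = (UNIV \<times> coords m) \<inter> (A \<times> UNIV)" using assms(2) by auto
  moreover have "open (A \<times> (UNIV :: (nat \<Rightarrow> real) set))" by (intro open_Times assms(3) open_UNIV)
  ultimately have "openin (top_of_set (UNIV \<times> coords m)) S" by (simp only: openin_open_Int)
  then show "openin (top_of_set (UNIV \<times> coords m)) (W \<inter> S)" using assms(6) by blast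
  show "inj_on \<phi> (W \<inter> S)" by (rule inj_on_subset[OF assms(4)]) auto
qed (use assms(5) in auto)

text \<open>The function \<open>q\<close> reaches a normal form in at most one step of the relation,
  so two points are equivalent iff their normal forms coincide.\<close>

lemma generated_equiv_kernel:
  assumes r: "\<And>a b. (a, b) \<in> r \<Longrightarrow> a \<in> A \<and> b \<in> A \<and> q a = b \<and> q b = b"
    and q: "\<And>a. a \<in> A \<Longrightarrow> (a, q a) \<in> r \<or> q a = a"
  shows "generated_equiv A r = {(a, b) \<in> A \<times> A. q a = q b}"
proof
  show "generated_equiv A r \<subseteq> {(a, b) \<in> A \<times> A. q a = q b}"
    by (rule generated_equiv_least) (use r in \<open>auto simp: equiv_def refl_on_def sym_def trans_def\<close>)
  have e: "equiv A (generated_equiv A r)" by (rule equiv_generated_equiv)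
  have 1: "(a, q a) \<in> generated_equiv A r" if "a \<in> A" for a
  proof (cases "q a = a")
    case True then show ?thesis using e that by (simp add: equiv_def refl_on_def)
  next
    case False
    then have "(a, q a) \<in> r" using q[OF that] by blast
    then have "(a, q a) \<in> (r \<union> r\<inverse>)\<^sup>*" "q a \<in> A" using r[of a "q a"] by auto
    then show ?thesis using that unfolding generated_equiv_def by blast
  qed
  show "{(a, b) \<in> A \<times> A. q a = q b} \<subseteq> generated_equiv A r"
  proof clarify
    fix a b assume ab: "a \<in> A" "b \<in> A" "q a = q b"
    have "(a, q b) \<in> generated_equiv A r" using 1[OF ab(1)] ab(3) by simp
    moreover have "(q b, b) \<in> generated_equiv A r" using 1[OF ab(2)] e by (meson equivE symE)
    ultimately show "(a, b) \<in> generated_equiv A r" using e by (meson equivE transE)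
  qed
qed

text \<open>Once the gluing relation is the kernel of a normal form \<open>q\<close>, openness of
  the two inclusions can be checked on each summand. Injectivity on the handle comes from
  injectivity of the two gluing maps and disjointness of the tubes.\<close>

lemma handle_at_infinity_add_handle:
  fixes M :: "'a topology"
  assumes M: "pl_manifold (Suc m) M \<A>" and \<eta>: "\<eta> \<in> ends M" "\<eta>' \<in> ends M"
    and r: "points_to M r \<eta>" "points_to M r' \<eta>'"
    and \<nu>: "is_tubular_nbhd_map (Suc m) M \<A> r \<nu>" "is_tubular_nbhd_map (Suc m) M \<A> r' \<nu>'"
    and disj: "disjnt (\<nu> ` ({0..} \<times> cube m 1)) (\<nu>' ` ({0..} \<times> cube m 1))"
    and \<rho>: "orientation_reversing_iso \<rho>" and l: "radial_expansion_iso m l"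
  shows "handle_at_infinity M (add_handle (Suc m) M \<nu> \<nu>' \<rho> l) (add_handle_incl (Suc m) M \<nu> \<nu>' \<rho> l)
    (\<lambda>z. handle_relation (Suc m) M \<nu> \<nu>' \<rho> l `` {Inr z}) m \<eta> \<eta>'"
proof -
  let ?Y = "UNIV \<times> coords m" and ?P = "{0::real<..} \<times> coords m" and ?M = "{..<0::real} \<times> coords m"
  let ?lc = "top_of_set ((UNIV :: real set) \<times> coords m)"
  define \<phi> where "\<phi> = phi_plus (Suc m) \<nu> \<rho> l"
  define \<psi> where "\<psi> = phi_minus (Suc m) \<nu>' \<rho> l"
  define \<psi>0 where "\<psi>0 = (\<lambda>(t, y). \<nu>' (\<rho> t, inv_into (open_disk m) l y))"
  \<comment> \<open>Reflecting the handle reduces its negative side to the positive one.\<close>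
  define neg where "neg z = (- fst z, snd z)" for z :: "real \<times> (nat \<Rightarrow> real)"
  have \<psi>: "\<psi> = \<psi>0 \<circ> neg" by (auto simp: \<psi>_def \<psi>0_def phi_minus_def neg_def)
  have \<phi>eq: "\<phi> = (\<lambda>(t, y). \<nu> (\<rho> t, inv_into (open_disk m) l y))" by (simp add: \<phi>_def phi_plus_def)
  note \<phi> = tubular_nbhd_side[OF \<nu>(1) \<rho> l r(1) \<eta>(1), folded \<phi>eq]
  note \<psi>0 = tubular_nbhd_side[OF \<nu>(2) \<rho> l r(2) \<eta>(2), folded \<psi>0_def]
  have negneg: "neg (neg z) = z" for z by (simp add: neg_def)
  have neg_im: "neg ` ?M = ?P" "neg ` ({-\<epsilon><..<0} \<times> coords m) = {0<..<\<epsilon>} \<times> coords m" for \<epsilon>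
  proof -
    have img: "neg ` A = B" if "\<And>z. z \<in> A \<Longrightarrow> neg z \<in> B" "\<And>z. z \<in> B \<Longrightarrow> neg z \<in> A" for A B
    proof (intro equalityI subsetI)
      fix z assume "z \<in> B"
      then show "z \<in> neg ` A" using that(2) negneg[of z] by (intro image_eqI[of _ _ "neg z"]) simp_all
    qed (use that(1) in auto)
    show "neg ` ?M = ?P" "neg ` ({-\<epsilon><..<0} \<times> coords m) = {0<..<\<epsilon>} \<times> coords m"
      by (rule img; auto simp: neg_def)+
  qed
  have negc: "continuous_map (top_of_set ?M) (top_of_set ?P) neg"
  proof -
    have "continuous_on ?M neg" unfolding neg_def by (intro continuous_intros)
    then show ?thesis using neg_im(1) by (auto simp: continuous_map_in_subtopology)
  qed
  have c\<psi>: "continuous_map (top_of_set ?M) M \<psi>" unfolding \<psi> by (rule continuous_map_compose[OF negc \<psi>0(1)])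
  have inj\<psi>: "inj_on \<psi> ?M" unfolding \<psi>
  proof (rule comp_inj_on)
    show "inj_on neg ?M" by (rule inj_on_inverseI[of _ neg]) (rule negneg)
    show "inj_on \<psi>0 (neg ` ?M)" unfolding neg_im by (rule \<psi>0(2))
  qed
  have im\<psi>: "\<psi> ` S = \<psi>0 ` neg ` S" for S by (simp add: \<psi> image_comp)
  have int\<psi>: "\<psi> ` ?M \<subseteq> manifold_interior (Suc m) M" unfolding im\<psi> neg_im using \<psi>0(3) .
  have disj': "\<phi> ` ?P \<inter> \<psi> ` ?M = {}"
    using \<phi>(4) \<psi>0(4) disj unfolding im\<psi> neg_im disjnt_def by blast
  have \<phi>M: "\<phi> z \<in> topspace M" if "z \<in> ?P" for z using \<phi>(1) that by (auto simp: continuous_map_def)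
  have \<psi>M: "\<psi> z \<in> topspace M" if "z \<in> ?M" for z using c\<psi> that by (auto simp: continuous_map_def)
  have hd: "handle (Suc m) = ?lc" by (simp add: handle_def prod_Euclidean_space_eq_top_of_set)
  define D where "D = disjoint_sum_topology M (handle (Suc m))"
  have topD: "topspace D = topspace M <+> ?Y"
    by (simp add: D_def topspace_disjoint_sum_topology hd)
  define R where "R = handle_relation (Suc m) M \<nu> \<nu>' \<rho> l"
  \<comment> \<open>The normal form moves handle points off the core into \<open>M\<close> and fixes
    everything else.\<close>
  define q :: "'a + real \<times> (nat \<Rightarrow> real) \<Rightarrow> 'a + real \<times> (nat \<Rightarrow> real)" where
    "q a = (case a of Inl x \<Rightarrow> Inl x | Inr z \<Rightarrow>
       if fst z > 0 then Inl (\<phi> z) else if fst z < 0 then Inl (\<psi> z) else Inr z)" for a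
  have q: "q (Inl x) = Inl x" "z \<in> ?P \<Longrightarrow> q (Inr z) = Inl (\<phi> z)" "z \<in> ?M \<Longrightarrow> q (Inr z) = Inl (\<psi> z)"
    "fst z = 0 \<Longrightarrow> q (Inr z) = Inr z" for x z
    by (auto simp: q_def)
  have Rq: "R = {(a, b) \<in> topspace D \<times> topspace D. q a = q b}"
    unfolding R_def handle_relation_def D_def[symmetric]
  proof (rule generated_equiv_kernel)
    fix a b :: "'a + real \<times> (nat \<Rightarrow> real)"
    have hp: "handle_plus (Suc m) = ?P" "handle_minus (Suc m) = ?M"
      by (auto simp: handle_plus_def handle_minus_def topspace_Euclidean_space)
    assume "(a, b) \<in> {(Inr x, Inl (phi_plus (Suc m) \<nu> \<rho> l x)) |x. x \<in> handle_plus (Suc m)} \<union>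
        {(Inr x, Inl (phi_minus (Suc m) \<nu>' \<rho> l x)) |x. x \<in> handle_minus (Suc m)}"
    then have "(\<exists>z\<in>?P. a = Inr z \<and> b = Inl (\<phi> z)) \<or> (\<exists>z\<in>?M. a = Inr z \<and> b = Inl (\<psi> z))"
      unfolding hp \<phi>_def[symmetric] \<psi>_def[symmetric] by auto
    then show "a \<in> topspace D \<and> b \<in> topspace D \<and> q a = b \<and> q b = b"
      using q \<phi>M \<psi>M unfolding topD by (elim disjE bexE conjE) (simp_all, auto)
  next
    fix a :: "'a + real \<times> (nat \<Rightarrow> real)" assume a: "a \<in> topspace D"
    show "(a, q a) \<in> {(Inr x, Inl (phi_plus (Suc m) \<nu> \<rho> l x)) |x. x \<in> handle_plus (Suc m)} \<union>
        {(Inr x, Inl (phi_minus (Suc m) \<nu>' \<rho> l x)) |x. x \<in> handle_minus (Suc m)} \<or> q a = a"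
    proof (cases a)
      case (Inl x)
      then show ?thesis by (simp add: q)
    next
      case (Inr z)
      then have z: "z \<in> ?Y" using a topD by auto
      show ?thesis
        using z Inr unfolding q_def handle_plus_def handle_minus_def topspace_Euclidean_space \<phi>_def \<psi>_def
        by (cases z) auto
    qed
  qed
  have eqR: "equiv (topspace D) R"
    unfolding R_def handle_relation_def D_def by (rule equiv_generated_equiv)
  define N where "N = add_handle (Suc m) M \<nu> \<nu>' \<rho> l"
  have N: "N = quotient_topology D R" by (simp add: N_def add_handle_def D_def R_def)
  define i where "i = add_handle_incl (Suc m) M \<nu> \<nu>' \<rho> l"
  have i: "i x = R `` {Inl x}" for x by (simp add: i_def add_handle_incl_def R_def)
  define e where "e z = R `` {Inr z}" for z
  have topN: "topspace N = topspace D // R" unfolding N by (rule topspace_quotient_topology[OF eqR])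
  have openN: "openin N W \<longleftrightarrow> W \<subseteq> topspace D // R \<and> openin D (\<Union>W)" for W
    unfolding N by (rule openin_quotient_topology[OF eqR])
  have cls: "R `` {a} = R `` {b} \<longleftrightarrow> q a = q b" if "a \<in> topspace D" "b \<in> topspace D" for a b
    using eq_equiv_class_iff[OF eqR that] that by (simp add: Rq)
  have quo: "continuous_map D N (\<lambda>a. R `` {a})"
    unfolding N by (rule quotient_imp_continuous_map[OF quotient_map_quotient_topology[OF eqR]])
  have InlD: "Inl x \<in> topspace D \<longleftrightarrow> x \<in> topspace M" and InrD: "Inr z \<in> topspace D \<longleftrightarrow> z \<in> ?Y" for x z
    by (auto simp: topD)
  have cInl: "continuous_map M D Inl" and cInr: "continuous_map ?lc D Inr"
  proof -
    have "openin M {x \<in> topspace M. Inl x \<in> U}" "openin ?lc {x \<in> topspace ?lc. Inr x \<in> U}" if "openin D U" for U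
    proof -
      have o: "openin M (Inl -` U)" "openin ?lc (Inr -` U)"
        using that unfolding D_def openin_disjoint_sum_topology hd by auto
      have "{x \<in> topspace M. Inl x \<in> U} = Inl -` U" "{x \<in> topspace ?lc. Inr x \<in> U} = Inr -` U"
        using openin_subset[OF o(1)] openin_subset[OF o(2)] by auto
      then show "openin M {x \<in> topspace M. Inl x \<in> U}" "openin ?lc {x \<in> topspace ?lc. Inr x \<in> U}"
        using o by auto
    qed
    then show "continuous_map M D Inl" "continuous_map ?lc D Inr"
      unfolding continuous_map_def using InlD InrD by auto
  qed
  have ci: "continuous_map M N i" and ce: "continuous_map ?lc N e"
    using continuous_map_compose[OF cInl quo] continuous_map_compose[OF cInr quo]
    by (simp_all add: o_def i[abs_def] e_def[abs_def])
  have ie: "e z = i (\<phi> z)" if "z \<in> ?P" for z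
    unfolding e_def i using cls[of "Inr z" "Inl (\<phi> z)"] q that InrD InlD \<phi>M[OF that] by auto
  have ie': "e z = i (\<psi> z)" if "z \<in> ?M" for z
    unfolding e_def i using cls[of "Inr z" "Inl (\<psi> z)"] q that InrD InlD \<psi>M[OF that] by auto
  have sat: "\<Union>((\<lambda>a. R `` {a}) ` A) = {b \<in> topspace D. \<exists>a\<in>A. q a = q b}" if "A \<subseteq> topspace D" for A
    using that by (auto simp: Rq)
  have qInr_inj: "z = z'" if "z \<in> ?Y" "z' \<in> ?Y" "q (Inr z) = q (Inr z')" for z z'
  proof -
    have split: "z \<in> ?P \<or> z \<in> ?M \<or> fst z = 0" if "z \<in> ?Y" for z
      using that by (cases z) auto
    show ?thesis
      using split[OF that(1)] split[OF that(2)]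
    proof (elim disjE)
      assume z: "z \<in> ?P" "z' \<in> ?P"
      then have "\<phi> z = \<phi> z'" using that(3) q(2)[OF z(1)] q(2)[OF z(2)] by simp
      then show ?thesis by (rule inj_onD[OF \<phi>(2) _ z])
    next
      assume z: "z \<in> ?M" "z' \<in> ?M"
      then have "\<psi> z = \<psi> z'" using that(3) q(3)[OF z(1)] q(3)[OF z(2)] by simp
      then show ?thesis by (rule inj_onD[OF inj\<psi> _ z])
    next
      assume z: "z \<in> ?P" "z' \<in> ?M"
      then have "\<phi> z = \<psi> z'" using that(3) q(2)[OF z(1)] q(3)[OF z(2)] by simp
      then have "\<phi> z \<in> \<psi> ` ?M" using imageI[OF z(2), of \<psi>] by simp
      with imageI[OF z(1)] have "\<phi> z \<in> \<phi> ` ?P \<inter> \<psi> ` ?M" by (rule IntI)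
      then show ?thesis unfolding disj' by (rule emptyE)
    next
      assume z: "z \<in> ?M" "z' \<in> ?P"
      then have "\<psi> z = \<phi> z'" using that(3) q(3)[OF z(1)] q(2)[OF z(2)] by simp
      then have "\<psi> z \<in> \<phi> ` ?P" using imageI[OF z(2), of \<phi>] by simp
      then have "\<psi> z \<in> \<phi> ` ?P \<inter> \<psi> ` ?M" using imageI[OF z(1)] by (rule IntI)
      then show ?thesis unfolding disj' by (rule emptyE)
    qed (use that(3) in \<open>auto simp: q_def split: if_splits\<close>)
  qed
  have openP: "openin ?lc ?P" "openin ?lc ?M"
  proof -
    have "?P = ?Y \<inter> ({0<..} \<times> UNIV)" "?M = ?Y \<inter> ({..<0} \<times> UNIV)" by auto
    moreover have "open ({0::real<..} \<times> (UNIV :: (nat \<Rightarrow> real) set))" "open ({..<0::real} \<times> (UNIV :: (nat \<Rightarrow> real) set))"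
      by (auto intro: open_Times)
    ultimately show "openin ?lc ?P" "openin ?lc ?M" by (simp_all only: openin_open_Int)
  qed
  have oi: "open_map M N i"
    unfolding open_map_def
  proof (intro allI impI)
    fix U assume U: "openin M U"
    have UM: "U \<subseteq> topspace M" using openin_subset[OF U] .
    have img: "i ` U = (\<lambda>a. R `` {a}) ` (Inl ` U)" by (auto simp: i)
    have sub: "Inl ` U \<subseteq> topspace D" using UM InlD by auto
    have un: "\<Union>(i ` U) = {b \<in> topspace D. \<exists>x\<in>U. Inl x = q b}"
      unfolding img sat[OF sub] by (auto simp: q)
    have "Inl -` \<Union>(i ` U) = U" unfolding un using UM InlD by (auto simp: q)
    moreover have "Inr -` \<Union>(i ` U) = {z \<in> topspace (top_of_set ?P). \<phi> z \<in> U} \<union> {z \<in> topspace (top_of_set ?M). \<psi> z \<in> U}"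
      unfolding un using InrD by (auto simp: q_def split: if_splits)
    moreover have "openin ?lc {z \<in> topspace (top_of_set ?P). \<phi> z \<in> U}"
      using openin_continuous_map_preimage[OF \<phi>(1) U] openP(1) openin_trans by blast
    moreover have "openin ?lc {z \<in> topspace (top_of_set ?M). \<psi> z \<in> U}"
      using openin_continuous_map_preimage[OF c\<psi> U] openP(2) openin_trans by blast
    ultimately have "openin D (\<Union>(i ` U))"
      unfolding D_def openin_disjoint_sum_topology hd using U by (simp add: openin_Un)
    moreover have "i ` U \<subseteq> topspace D // R" unfolding img using sub by (auto intro: quotientI)
    ultimately show "openin N (i ` U)" unfolding openN by blast
  qed
  have oe: "open_map ?lc N e"
    unfolding open_map_def
  proof (intro allI impI)
    fix W assume W: "openin ?lc W"
    have WY: "W \<subseteq> ?Y" using openin_subset[OF W] by simp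
    have img: "e ` W = (\<lambda>a. R `` {a}) ` (Inr ` W)" by (auto simp: e_def)
    have sub: "Inr ` W \<subseteq> topspace D" using WY InrD by auto
    have un: "\<Union>(e ` W) = {b \<in> topspace D. \<exists>z\<in>W. q (Inr z) = q b}"
      unfolding img sat[OF sub] by auto
    have "Inr -` \<Union>(e ` W) = W"
    proof (intro equalityI subsetI)
      fix z assume "z \<in> Inr -` \<Union>(e ` W)"
      then obtain w where w: "w \<in> W" "q (Inr w) = q (Inr z)" "z \<in> ?Y"
        unfolding un vimage_def mem_Collect_eq InrD by (elim conjE bexE)
      then have "w = z" using qInr_inj WY by blast
      then show "z \<in> W" using w(1) by simp
    next
      fix z assume z: "z \<in> W"
      then have "z \<in> ?Y" using WY by blast
      then show "z \<in> Inr -` \<Union>(e ` W)" unfolding un vimage_def mem_Collect_eq InrD using z by blast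
    qed
    \<comment> \<open>The trace in \<open>M\<close> of an open subset of the handle is its image
      under the two gluing maps, and is open by invariance of domain.\<close>
    moreover have "Inl -` \<Union>(e ` W) = \<phi> ` (W \<inter> ?P) \<union> \<psi> ` (W \<inter> ?M)"
    proof (intro equalityI subsetI)
      fix x assume "x \<in> Inl -` \<Union>(e ` W)"
      then obtain z where z: "z \<in> W" "q (Inr z) = Inl x" unfolding un by (auto simp: q)
      then show "x \<in> \<phi> ` (W \<inter> ?P) \<union> \<psi> ` (W \<inter> ?M)"
        using WY by (cases z) (auto simp: q_def split: if_splits)
    next
      fix x assume "x \<in> \<phi> ` (W \<inter> ?P) \<union> \<psi> ` (W \<inter> ?M)"
      then consider z where "z \<in> W" "z \<in> ?P" "x = \<phi> z" | z where "z \<in> W" "z \<in> ?M" "x = \<psi> z" by blast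
      then show "x \<in> Inl -` \<Union>(e ` W)"
      proof cases
        case 1 then show ?thesis unfolding un using q(1,2) InlD \<phi>M by auto
      next
        case 2 then show ?thesis unfolding un using q(1,3) InlD \<psi>M by auto
      qed
    qed
    moreover have "openin M (\<phi> ` (W \<inter> ?P))"
      by (rule open_map_from_euclidean_side[OF \<phi>(1) refl _ \<phi>(2,3) W]) auto
    moreover have "openin M (\<psi> ` (W \<inter> ?M))"
      by (rule open_map_from_euclidean_side[OF c\<psi> refl _ inj\<psi> int\<psi> W]) auto
    ultimately have "openin D (\<Union>(e ` W))"
      unfolding D_def openin_disjoint_sum_topology hd using W by (simp add: openin_Un)
    moreover have "e ` W \<subseteq> topspace D // R" unfolding img using sub by (auto intro: quotientI)
    ultimately show "openin N (e ` W)" unfolding openN by blast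
  qed
  have ii: "inj_on i (topspace M)"
    using cls InlD by (auto simp: inj_on_def i q)
  have ej: "inj_on e ?Y"
    using cls InrD qInr_inj by (auto simp: inj_on_def e_def)
  have topN': "topspace N = i ` topspace M \<union> e ` ({0} \<times> coords m)"
  proof
    show "topspace N \<subseteq> i ` topspace M \<union> e ` ({0} \<times> coords m)"
    proof
      fix c assume "c \<in> topspace N"
      then obtain a where a: "a \<in> topspace D" "c = R `` {a}" unfolding topN by (rule quotientE)
      show "c \<in> i ` topspace M \<union> e ` ({0} \<times> coords m)"
      proof (cases a)
        case (Inl x)
        then show ?thesis using a InlD i by auto
      next
        case (Inr z)
        then have z: "z \<in> ?Y" "c = e z" using a InrD by (auto simp: e_def)
        then consider "z \<in> ?P" | "z \<in> ?M" | "z \<in> {0} \<times> coords m" by (cases z) (auto, linarith)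
        then show ?thesis
        proof cases
          case 1 then show ?thesis using ie[OF 1] z(2) \<phi>M[OF 1] by blast
        next
          case 2 then show ?thesis using ie'[OF 2] z(2) \<psi>M[OF 2] by blast
        next
          case 3 then show ?thesis using z(2) by blast
        qed
      qed
    qed
    show "i ` topspace M \<union> e ` ({0} \<times> coords m) \<subseteq> topspace N"
      unfolding topN using InlD InrD by (auto simp: i e_def intro!: quotientI)
  qed
  have dis: "i ` topspace M \<inter> e ` ({0} \<times> coords m) = {}"
  proof -
    have "i x \<noteq> e (0, y)" if "x \<in> topspace M" "y \<in> coords m" for x y
      using cls[of "Inl x" "Inr (0, y)"] InlD InrD that q(1)[of x] q(4)[of "(0, y)"] by (auto simp: i e_def)
    then show ?thesis by auto
  qed
  have tail: "\<exists>\<epsilon>>0. e ` ({0<..<\<epsilon>} \<times> coords m) \<subseteq> i ` \<eta> K \<and> e ` ({-\<epsilon><..<0} \<times> coords m) \<subseteq> i ` \<eta>' K"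
    if K: "compactin M K" for K
  proof -
    obtain \<epsilon>1 where e1: "\<epsilon>1 > 0" "\<phi> ` ({0<..<\<epsilon>1} \<times> coords m) \<subseteq> \<eta> K" using \<phi>(5)[OF K] by blast
    obtain \<epsilon>2 where e2: "\<epsilon>2 > 0" "\<psi>0 ` ({0<..<\<epsilon>2} \<times> coords m) \<subseteq> \<eta>' K" using \<psi>0(5)[OF K] by blast
    then have e2': "\<psi> ` ({-\<epsilon>2<..<0} \<times> coords m) \<subseteq> \<eta>' K" unfolding im\<psi> neg_im by simp
    show ?thesis
    proof (intro exI[of _ "min \<epsilon>1 \<epsilon>2"] conjI)
      show "e ` ({0<..<min \<epsilon>1 \<epsilon>2} \<times> coords m) \<subseteq> i ` \<eta> K"
      proof
        fix c assume "c \<in> e ` ({0<..<min \<epsilon>1 \<epsilon>2} \<times> coords m)"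
        then obtain z where z: "z \<in> {0<..<min \<epsilon>1 \<epsilon>2} \<times> coords m" "c = e z" by blast
        then have "z \<in> ?P" "z \<in> {0<..<\<epsilon>1} \<times> coords m" by auto
        then have "\<phi> z \<in> \<eta> K" using e1(2) by blast
        then show "c \<in> i ` \<eta> K" using ie[OF \<open>z \<in> ?P\<close>] z(2) by simp
      qed
      show "e ` ({- min \<epsilon>1 \<epsilon>2<..<0} \<times> coords m) \<subseteq> i ` \<eta>' K"
      proof
        fix c assume "c \<in> e ` ({- min \<epsilon>1 \<epsilon>2<..<0} \<times> coords m)"
        then obtain z where z: "z \<in> {- min \<epsilon>1 \<epsilon>2<..<0} \<times> coords m" "c = e z" by blast
        then have "z \<in> ?M" "z \<in> {-\<epsilon>2<..<0} \<times> coords m" by auto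
        then have "\<psi> z \<in> \<eta>' K" using e2' by blast
        then show "c \<in> i ` \<eta>' K" using ie'[OF \<open>z \<in> ?M\<close>] z(2) by simp
      qed
    qed (use e1 e2 in auto)
  qed
  have "handle_at_infinity M N i e m \<eta> \<eta>'"
  proof
    show "Hausdorff_space M" using M by (simp add: pl_manifold_def)
    show "locally_compact_space M" "locally_connected_space M" using pl_manifold_locally[OF M] by auto
  qed (fact \<eta> ci oi ii ce oe ej topN' dis tail)+
  moreover have "e = (\<lambda>z. handle_relation (Suc m) M \<nu> \<nu>' \<rho> l `` {Inr z})" by (simp add: e_def[abs_def] R_def)
  ultimately show ?thesis by (simp add: N_def i_def)
qed

theorem lemma5p9:
  fixes M :: "'a topology" and \<A> :: "'a chart set" and n :: nat
    and \<eta> \<eta>' :: "'a set \<Rightarrow> 'a set"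
    and r r' :: "real \<Rightarrow> 'a"
    and \<nu> \<nu>' :: "real \<times> (nat \<Rightarrow> real) \<Rightarrow> 'a"
    and \<rho> :: "real \<Rightarrow> real"
    and l :: "(nat \<Rightarrow> real) \<Rightarrow> (nat \<Rightarrow> real)"
    and N :: "('a + real \<times> (nat \<Rightarrow> real)) set topology"
    and h :: "(('a + real \<times> (nat \<Rightarrow> real)) set set \<Rightarrow> ('a + real \<times> (nat \<Rightarrow> real)) set set)
              \<Rightarrow> ('a set \<Rightarrow> 'a set) set"
  assumes "pl_manifold n M \<A>"
    and "\<eta> \<in> ends M" and "\<eta>' \<in> ends M"
    and "is_ray n M \<A> r" and "is_ray n M \<A> r'"
    and "disjnt (r ` {0..}) (r' ` {0..})"
    and "points_to M r \<eta>" and "points_to M r' \<eta>'"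
    and "is_tubular_nbhd_map n M \<A> r \<nu>" and "is_tubular_nbhd_map n M \<A> r' \<nu>'"
    and "disjnt (\<nu> ` ({0..} \<times> cube (n - 1) 1)) (\<nu>' ` ({0..} \<times> cube (n - 1) 1))"
    and "orientation_reversing_iso \<rho>"
    and "radial_expansion_iso (n - 1) l"
    and N_eq: "N = add_handle n M \<nu> \<nu>' \<rho> l"
    and h_eq: "h = canonical_end_map M N (add_handle_incl n M \<nu> \<nu>' \<rho> l) \<eta> \<eta>'"
  shows "continuous_map (ends_topology N) (ends_quotient M \<eta> \<eta>') h \<and>
    (n \<ge> 2 \<longrightarrow> h ` ends N = topspace (ends_quotient M \<eta> \<eta>')) \<and>
    ((n = 2 \<and> compactin M (manifold_boundary n M) \<and> \<eta> \<noteq> \<eta>') \<or> n \<ge> 3 \<longrightarrow>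
       homeomorphic_map (ends_topology N) (ends_quotient M \<eta> \<eta>') h)"
proof -
  obtain m where n: "n = Suc m" using dimension_positive[OF assms(4)] not0_implies_Suc by blast
  interpret H: handle_at_infinity M N "add_handle_incl n M \<nu> \<nu>' \<rho> l"
    "\<lambda>z. handle_relation n M \<nu> \<nu>' \<rho> l `` {Inr z}" m \<eta> \<eta>'
    using assms(1-3,7-13) unfolding n N_eq diff_Suc_1 by (rule handle_at_infinity_add_handle)
  have "homeomorphic_map (ends_topology N) (ends_quotient M \<eta> \<eta>') h"
    if c: "(n = 2 \<and> compactin M (manifold_boundary n M) \<and> \<eta> \<noteq> \<eta>') \<or> n \<ge> 3"
    unfolding h_eq
  proof (rule H.homeomorphic_h)
    show "m \<ge> 1" using c n by auto
    fix L assume L: "compactin N L"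
    let ?goal = "\<exists>s>0. \<exists>C. (\<forall>y\<in>coords m. handle_relation n M \<nu> \<nu>' \<rho> l `` {Inr (0, y)} \<in> L \<longrightarrow> y \<in> open_cube m s) \<and>
      connectedin N C \<and> C \<inter> L = {} \<and>
      (\<lambda>z. handle_relation n M \<nu> \<nu>' \<rho> l `` {Inr z}) ` ({0} \<times> (coords m - cube m s)) \<subseteq> C"
    show ?goal
    proof (cases "n \<ge> 3")
      case True
      then show ?thesis using n by (intro H.core_connected_at_infinity_high_dim[OF _ L]) simp
    next
      case False
      then have c2: "n = 2" "compactin M (manifold_boundary 2 M)" "\<eta> \<noteq> \<eta>'" using c by auto
      show ?thesis
      proof (rule H.core_connected_at_infinity_surface[OF _ c2(3,2) _ L])
        show "m = 1" using c2(1) n by simp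
        show "\<exists>p. plane_patch M p \<and> x \<in> range p" if "x \<in> topspace M - manifold_boundary 2 M" for x
          using that by (intro plane_patch_interior) (auto simp: manifold_boundary_def)
      qed
    qed
  qed
  then show ?thesis using H.continuous_h H.surj_h n unfolding h_eq by auto
qed

end
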